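(* Let $(M,\varphi,\xi,\eta,g)$ be a $(2n+1)$-dimensional $K$-paracontact metric manifold. Then its Ricci operator satisfies $Q\xi=-2n\,\xi$. Hence $K$-paracontact (in particular, paraSasakian) manifolds are $H$-paracontact. Moreover, the Reeb vector field $\xi$ of any $K$-paracontact metric manifold defines a harmonic map $\xi:(M,g)\to(T_1M,g^s)$.
   Context: All manifolds are smooth and connected. A $(2n+1)$-dimensional contact manifold is a manifold $M^{2n+1}$ with a global 1-form $\eta$ such that $\eta\wedge(d\eta)^n\neq 0$ everywhere; its Reeb vector field $\xi$ is the unique vector field with $\eta(\xi)=1$, $d\eta(\xi,\cdot)=0$. A paracontact metric structure $(\varphi,\xi,\eta,g)$ on $M$ consists of such $\eta,\xi$, a semi-Riemannian metric $g$ and a $(1,1)$-tensor $\varphi$ with $\eta=g(\xi,\cdot)$, $d\eta(\cdot,\cdot)=g(\cdot,\varphi\,\cdot)$, $\varphi^2=I-\eta\otimes\xi$ (here $2\,d\eta(X,Y)=X\eta(Y)-Y\eta(X)-\eta([X,Y])$). $\nabla$ is the Levi-Civita connection, $R_{XY}=\nabla_{[X,Y]}-[\nabla_X,\nabla_Y]$, $\varrho$ is the usual Ricci tensor and $Q$ the Ricci operator, $g(QX,Y)=\varrho(X,Y)$. A paracontact metric manifold is $K$-paracontact if $\xi$ is a Killing vector field (equivalently, $h=\frac12\mathcal L_\xi\varphi=0$). It is paraSasakian if $(\nabla_X\varphi)Y=-g(X,Y)\xi+\eta(Y)X$ for all $X,Y$; every paraSasakian manifold is $K$-paracontact. It is $H$-paracontact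 if $\xi$ is a harmonic vector field. Harmonic vector fields: the energy of a vector field $V$ on $(M,g)$ is the energy of the map $V:(M,g)\to(TM,g^s)$, $g^s$ the Sasaki metric (computed over relatively compact domains if $M$ is non-compact). A vector field $V$ of constant length $g(V,V)=r\neq 0$ is harmonic if it is a critical point of the energy restricted to vector fields of the same constant length $r$; equivalently, $\bar\Delta V$ is collinear to $V$, where $\bar\Delta V=-\mathrm{tr}\,\nabla^2V=\sum_i\varepsilon_i(\nabla_{\nabla_{E_i}E_i}V-\nabla_{E_i}\nabla_{E_i}V)$ for a local pseudo-orthonormal frame $\{E_i\}$, $\varepsilon_i=g(E_i,E_i)=\pm1$. $(T_1M,g^s)$ is the unit tangent sphere bundle $\{v\in TM: g(v,v)=1\}$ with the metric induced by the Sasaki metric; a unit vector field $V$ defines a harmonic map $V:(M,g)\to(T_1M,g^s)$ when $V$ is a harmonic vector field and $\mathrm{tr}[R(\nabla_\cdot V,V)\cdot]=\sum_i\varepsilon_iR(\nabla_{E_i}V,V)E_i=0$. *)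

theory Defs
  imports "HOL-Analysis.Analysis"
begin

section \<open>Smooth manifolds and tensor fields\<close>

text \<open>\<open>Ck k S f\<close> is meant for open \<open>S\<close> and finite-dimensional domains: \<open>f\<close> is of class
  \<open>C^k\<close> on \<open>S\<close>.\<close>

primrec Ck :: "nat \<Rightarrow> 'b::real_normed_vector set \<Rightarrow> ('b \<Rightarrow> 'c::real_normed_vector) \<Rightarrow> bool" where
  "Ck 0 S f \<longleftrightarrow> continuous_on S f"
| "Ck (Suc k) S f \<longleftrightarrow>
     f differentiable_on S \<and> (\<forall>v. Ck k S (\<lambda>x. frechet_derivative f (at x) v))"

definition smooth_on :: "'b::real_normed_vector set \<Rightarrow> ('b \<Rightarrow> 'c::real_normed_vector) \<Rightarrow> bool" where
  "smooth_on S f \<longleftrightarrow> (\<forall>k. Ck k S f)"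

text \<open>A chart is a pair of its domain and its coordinate map.  The points of the manifold are all
  elements of a Hausdorff, second countable type \<open>'a\<close>.\<close>

type_synonym ('a, 'm) chart = "'a set \<times> ('a \<Rightarrow> real ^ 'm)"

definition cdom :: "('a, 'm::finite) chart \<Rightarrow> (real ^ 'm) set" where
  "cdom c = snd c ` fst c"

definition cinv :: "('a, 'm::finite) chart \<Rightarrow> real ^ 'm \<Rightarrow> 'a" where
  "cinv c = inv_into (fst c) (snd c)"

definition transition :: "('a, 'm::finite) chart \<Rightarrow> ('a, 'm) chart \<Rightarrow> real ^ 'm \<Rightarrow> real ^ 'm" where
  "transition c d = snd d \<circ> cinv c"

definition overlap :: "('a, 'm::finite) chart \<Rightarrow> ('a, 'm) chart \<Rightarrow> (real ^ 'm) set" where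
  "overlap c d = snd c ` (fst c \<inter> fst d)"

definition smooth_manifold ::
    "('a::{t2_space,second_countable_topology}, 'm::finite) chart set \<Rightarrow> bool" where
  "smooth_manifold A \<longleftrightarrow>
     connected (UNIV :: 'a set) \<and> (\<Union>c\<in>A. fst c) = UNIV \<and>
     (\<forall>c\<in>A. open (fst c) \<and> open (cdom c) \<and> homeomorphism (fst c) (cdom c) (snd c) (cinv c)) \<and>
     (\<forall>c\<in>A. \<forall>d\<in>A. smooth_on (overlap c d) (transition c d))"

text \<open>A tensor field is given by its components with respect to the coordinate frame of each chart,
  as functions of the coordinates in \<open>cdom c\<close>, subject to the transformation law under changes of
  charts; values outside \<open>cdom c\<close> are irrelevant.  A \<open>(1,1)\<close>-tensor acts by \<open>u \<mapsto> \<phi> *v u\<close>, a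
  bilinear form by \<open>bil\<close>, a 1-form \<open>\<eta>\<close> by \<open>u \<mapsto> \<eta> \<bullet> u\<close>.\<close>

type_synonym ('a, 'm, 't) field = "('a, 'm) chart \<Rightarrow> real ^ 'm \<Rightarrow> 't"

definition bil :: "real ^ 'm ^ 'm \<Rightarrow> real ^ 'm \<Rightarrow> real ^ 'm::finite \<Rightarrow> real" where
  "bil B u v = u \<bullet> (B *v v)"

definition vector_field ::
    "('a, 'm::finite) chart set \<Rightarrow> ('a, 'm, real ^ 'm) field \<Rightarrow> bool" where
  "vector_field A X \<longleftrightarrow>
     (\<forall>c\<in>A. smooth_on (cdom c) (X c)) \<and>
     (\<forall>c\<in>A. \<forall>d\<in>A. \<forall>x\<in>overlap c d.
        X d (transition c d x) = jacobian (transition c d) (at x) *v X c x)"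

definition one_form ::
    "('a, 'm::finite) chart set \<Rightarrow> ('a, 'm, real ^ 'm) field \<Rightarrow> bool" where
  "one_form A \<eta> \<longleftrightarrow>
     (\<forall>c\<in>A. smooth_on (cdom c) (\<eta> c)) \<and>
     (\<forall>c\<in>A. \<forall>d\<in>A. \<forall>x\<in>overlap c d.
        \<eta> c x = transpose (jacobian (transition c d) (at x)) *v \<eta> d (transition c d x))"

definition endo_field ::
    "('a, 'm::finite) chart set \<Rightarrow> ('a, 'm, real ^ 'm ^ 'm) field \<Rightarrow> bool" where
  "endo_field A \<phi> \<longleftrightarrow>
     (\<forall>c\<in>A. smooth_on (cdom c) (\<phi> c)) \<and>
     (\<forall>c\<in>A. \<forall>d\<in>A. \<forall>x\<in>overlap c d.
        \<phi> d (transition c d x) ** jacobian (transition c d) (at x)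
          = jacobian (transition c d) (at x) ** \<phi> c x)"

definition semi_riemannian_metric ::
    "('a, 'm::finite) chart set \<Rightarrow> ('a, 'm, real ^ 'm ^ 'm) field \<Rightarrow> bool" where
  "semi_riemannian_metric A g \<longleftrightarrow>
     (\<forall>c\<in>A. smooth_on (cdom c) (g c)) \<and>
     (\<forall>c\<in>A. \<forall>d\<in>A. \<forall>x\<in>overlap c d.
        g c x = transpose (jacobian (transition c d) (at x)) ** g d (transition c d x)
                  ** jacobian (transition c d) (at x)) \<and>
     (\<forall>c\<in>A. \<forall>x\<in>cdom c. transpose (g c x) = g c x \<and> invertible (g c x))"

section \<open>Local differential geometry in a chart\<close>

text \<open>In this section \<open>X\<close>, \<open>Y\<close>, \<open>Z\<close>, \<open>V\<close>, \<open>\<eta>\<close>, \<open>\<phi>\<close>, \<open>G\<close> are component functions of fields in a fixed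
  chart.  Tensors defined through vector fields are evaluated on tangent vectors \<open>u\<close> by extending
  them with constant components, \<open>\<lambda>_. u\<close>.\<close>

definition lie_bracket ::
    "(real ^ 'm \<Rightarrow> real ^ 'm) \<Rightarrow> (real ^ 'm \<Rightarrow> real ^ 'm) \<Rightarrow> real ^ 'm \<Rightarrow> real ^ 'm::finite" where
  "lie_bracket X Y x =
     frechet_derivative Y (at x) (X x) - frechet_derivative X (at x) (Y x)"

text \<open>The convention is \<open>2 d\<eta>(X,Y) = X \<eta>(Y) - Y \<eta>(X) - \<eta>([X,Y])\<close>.\<close>

definition ext_d ::
    "(real ^ 'm \<Rightarrow> real ^ 'm) \<Rightarrow> (real ^ 'm \<Rightarrow> real ^ 'm) \<Rightarrow> (real ^ 'm \<Rightarrow> real ^ 'm)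
       \<Rightarrow> real ^ 'm::finite \<Rightarrow> real" where
  "ext_d \<eta> X Y x =
     (frechet_derivative (\<lambda>y. \<eta> y \<bullet> Y y) (at x) (X x)
      - frechet_derivative (\<lambda>y. \<eta> y \<bullet> X y) (at x) (Y x)
      - \<eta> x \<bullet> lie_bracket X Y x) / 2"

text \<open>\<open>\<eta> \<and> (d\<eta>)^n\<close> evaluated on \<open>v 0, \<dots>, v (2n)\<close>, up to a nonzero constant that depends only on
  \<open>n\<close> and on the normalisation of the wedge product.\<close>

definition wedge_contact ::
    "nat \<Rightarrow> (real ^ 'm \<Rightarrow> real ^ 'm) \<Rightarrow> real ^ 'm \<Rightarrow> (nat \<Rightarrow> real ^ 'm::finite) \<Rightarrow> real" where
  "wedge_contact n \<eta> x v =
     (\<Sum>\<sigma> | \<sigma> permutes {0..2*n}.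
        of_int (sign \<sigma>) * (\<eta> x \<bullet> v (\<sigma> 0)) *
        (\<Prod>i<n. ext_d \<eta> (\<lambda>_. v (\<sigma> (2*i+1))) (\<lambda>_. v (\<sigma> (2*i+2))) x))"

text \<open>\<open>christoffel G x u v\<close> has components \<open>\<Gamma>^k_ij u^i v^j\<close> with
  \<open>\<Gamma>^k_ij = (1/2) g^kl (\<partial>_i g_jl + \<partial>_j g_il - \<partial>_l g_ij)\<close>.\<close>

definition christoffel ::
    "(real ^ 'm \<Rightarrow> real ^ 'm ^ 'm) \<Rightarrow> real ^ 'm \<Rightarrow> real ^ 'm \<Rightarrow> real ^ 'm \<Rightarrow> real ^ 'm::finite" where
  "christoffel G x u v =
     matrix_inv (G x) *v
       (\<chi> l. (bil (frechet_derivative G (at x) u) v (axis l 1)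
             + bil (frechet_derivative G (at x) v) u (axis l 1)
             - bil (frechet_derivative G (at x) (axis l 1)) u v) / 2)"

text \<open>The Levi-Civita covariant derivative of \<open>V\<close> along \<open>X\<close>.\<close>

definition nabla ::
    "(real ^ 'm \<Rightarrow> real ^ 'm ^ 'm) \<Rightarrow> (real ^ 'm \<Rightarrow> real ^ 'm) \<Rightarrow> (real ^ 'm \<Rightarrow> real ^ 'm)
       \<Rightarrow> real ^ 'm \<Rightarrow> real ^ 'm::finite" where
  "nabla G X V x = frechet_derivative V (at x) (X x) + christoffel G x (X x) (V x)"

definition nabla_endo ::
    "(real ^ 'm \<Rightarrow> real ^ 'm ^ 'm) \<Rightarrow> (real ^ 'm \<Rightarrow> real ^ 'm) \<Rightarrow> (real ^ 'm \<Rightarrow> real ^ 'm ^ 'm)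
       \<Rightarrow> (real ^ 'm \<Rightarrow> real ^ 'm) \<Rightarrow> real ^ 'm \<Rightarrow> real ^ 'm::finite" where
  "nabla_endo G X \<phi> Y x = nabla G X (\<lambda>y. \<phi> y *v Y y) x - \<phi> x *v nabla G X Y x"

text \<open>The sign convention is \<open>R_XY = \<nabla>_[X,Y] - [\<nabla>_X, \<nabla>_Y]\<close>.  With it the usual Ricci tensor (the
  one that is positive on round spheres) is the trace of \<open>w \<mapsto> R_uw v\<close>.\<close>

definition curvature ::
    "(real ^ 'm \<Rightarrow> real ^ 'm ^ 'm) \<Rightarrow> (real ^ 'm \<Rightarrow> real ^ 'm) \<Rightarrow> (real ^ 'm \<Rightarrow> real ^ 'm)
       \<Rightarrow> (real ^ 'm \<Rightarrow> real ^ 'm) \<Rightarrow> real ^ 'm \<Rightarrow> real ^ 'm::finite" where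
  "curvature G X Y Z x =
     nabla G (lie_bracket X Y) Z x
     - (nabla G X (nabla G Y Z) x - nabla G Y (nabla G X Z) x)"

definition ricci ::
    "(real ^ 'm \<Rightarrow> real ^ 'm ^ 'm) \<Rightarrow> real ^ 'm \<Rightarrow> real ^ 'm \<Rightarrow> real ^ 'm::finite \<Rightarrow> real" where
  "ricci G x u v =
     (\<Sum>k\<in>UNIV. curvature G (\<lambda>_. u) (\<lambda>_. axis k 1) (\<lambda>_. v) x $ k)"

text \<open>The Ricci operator is determined by \<open>g(Q u, v) = ricci u v\<close>.\<close>

definition ricci_op ::
    "(real ^ 'm \<Rightarrow> real ^ 'm ^ 'm) \<Rightarrow> real ^ 'm \<Rightarrow> real ^ 'm \<Rightarrow> real ^ 'm::finite" where
  "ricci_op G x u = matrix_inv (G x) *v (\<chi> j. ricci G x u (axis j 1))"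

text \<open>The Lie derivative \<open>(L_V g)(X,Y) = V g(X,Y) - g([V,X],Y) - g(X,[V,Y])\<close>.\<close>

definition lie_metric ::
    "(real ^ 'm \<Rightarrow> real ^ 'm ^ 'm) \<Rightarrow> (real ^ 'm \<Rightarrow> real ^ 'm) \<Rightarrow> (real ^ 'm \<Rightarrow> real ^ 'm)
       \<Rightarrow> (real ^ 'm \<Rightarrow> real ^ 'm) \<Rightarrow> real ^ 'm::finite \<Rightarrow> real" where
  "lie_metric G V X Y x =
     frechet_derivative (\<lambda>y. bil (G y) (X y) (Y y)) (at x) (V x)
     - bil (G x) (lie_bracket V X x) (Y x) - bil (G x) (X x) (lie_bracket V Y x)"

text \<open>The trace \<open>g^ij B(\<partial>_i, \<partial>_j)\<close> of a bilinear map, which equals \<open>\<Sum>\<^sub>i \<epsilon>\<^sub>i B(E\<^sub>i, E\<^sub>i)\<close> for every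
  pseudo-orthonormal frame.\<close>

definition metric_trace ::
    "real ^ 'm ^ 'm \<Rightarrow> (real ^ 'm \<Rightarrow> real ^ 'm::finite \<Rightarrow> 'b::real_vector) \<Rightarrow> 'b" where
  "metric_trace G B =
     (\<Sum>i\<in>UNIV. \<Sum>j\<in>UNIV. (matrix_inv G $ i $ j) *\<^sub>R B (axis i 1) (axis j 1))"

text \<open>The Sasaki metric in the chart \<open>(x, v)\<close> of the tangent bundle induced by a chart of the
  manifold: a tangent vector \<open>(a, b)\<close> at \<open>(x, v)\<close> has horizontal part \<open>a\<close>, and the connection map
  sends it to \<open>b + \<Gamma>\<^sub>x(a, v)\<close>.\<close>

definition sasaki ::
    "(real ^ 'm \<Rightarrow> real ^ 'm ^ 'm) \<Rightarrow> (real ^ 'm) \<times> (real ^ 'm)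
       \<Rightarrow> (real ^ 'm) \<times> (real ^ 'm) \<Rightarrow> (real ^ 'm) \<times> (real ^ 'm::finite) \<Rightarrow> real" where
  "sasaki G p s t =
     (let x = fst p; v = snd p; K = (\<lambda>w. snd w + christoffel G x (fst w) v)
      in bil (G x) (fst s) (fst t) + bil (G x) (K s) (K t))"

text \<open>The energy density of \<open>V : (M, g) \<rightarrow> (TM, g\<^sup>s)\<close>, i.e. half the trace of the pullback of
  the Sasaki metric.\<close>

definition local_energy_density ::
    "(real ^ 'm \<Rightarrow> real ^ 'm ^ 'm) \<Rightarrow> (real ^ 'm \<Rightarrow> real ^ 'm) \<Rightarrow> real ^ 'm::finite \<Rightarrow> real" where
  "local_energy_density G V x =
     (let dV = frechet_derivative (\<lambda>y. (y, V y)) (at x)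
      in metric_trace (G x) (\<lambda>u v. sasaki G (x, V x) (dV u) (dV v)) / 2)"

section \<open>Harmonic vector fields\<close>

text \<open>The energy density does not depend on the chart, so an arbitrary one around \<open>p\<close> is used.\<close>

definition chart_at :: "('a, 'm::finite) chart set \<Rightarrow> 'a \<Rightarrow> ('a, 'm) chart" where
  "chart_at A p = (SOME c. c \<in> A \<and> p \<in> fst c)"

definition energy_density ::
    "('a, 'm::finite) chart set \<Rightarrow> ('a, 'm, real ^ 'm ^ 'm) field
       \<Rightarrow> ('a, 'm, real ^ 'm) field \<Rightarrow> 'a \<Rightarrow> real" where
  "energy_density A g V p =
     (let c = chart_at A p in local_energy_density (g c) (V c) (snd c p))"

text \<open>The semi-Riemannian volume measure \<open>dv\<^sub>g = sqrt |det g| dx\<close>.  By second countability there is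
  exactly one such Borel measure on a given manifold.\<close>

definition volume_measure ::
    "('a::{t2_space,second_countable_topology}, 'm::finite) chart set
       \<Rightarrow> ('a, 'm, real ^ 'm ^ 'm) field \<Rightarrow> 'a measure \<Rightarrow> bool" where
  "volume_measure A g \<mu> \<longleftrightarrow>
     sets \<mu> = sets borel \<and>
     (\<forall>c\<in>A. \<forall>B\<in>sets borel. B \<subseteq> fst c \<longrightarrow>
        emeasure \<mu> B = (\<integral>\<^sup>+x\<in>snd c ` B. ennreal (sqrt \<bar>det (g c x)\<bar>) \<partial>lborel))"

definition energy ::
    "('a::{t2_space,second_countable_topology}, 'm::finite) chart set
       \<Rightarrow> ('a, 'm, real ^ 'm ^ 'm) field \<Rightarrow> 'a measure \<Rightarrow> 'a set
       \<Rightarrow> ('a, 'm, real ^ 'm) field \<Rightarrow> real" where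
  "energy A g \<mu> D V = (LINT p:D|\<mu>. energy_density A g V p)"

definition constant_length ::
    "('a, 'm::finite) chart set \<Rightarrow> ('a, 'm, real ^ 'm ^ 'm) field \<Rightarrow> real
       \<Rightarrow> ('a, 'm, real ^ 'm) field \<Rightarrow> bool" where
  "constant_length A g r V \<longleftrightarrow> (\<forall>c\<in>A. \<forall>x\<in>cdom c. bil (g c x) (V c x) (V c x) = r)"

text \<open>Smooth variations of \<open>V\<close>, for \<open>\<bar>t\<bar> < \<epsilon>\<close>, through vector fields of constant length \<open>r\<close>, that
  agree with \<open>V\<close> outside a compact subset of \<open>D\<close>.\<close>

definition length_variation ::
    "('a::{t2_space,second_countable_topology}, 'm::finite) chart set
       \<Rightarrow> ('a, 'm, real ^ 'm ^ 'm) field \<Rightarrow> real \<Rightarrow> 'a set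
       \<Rightarrow> ('a, 'm, real ^ 'm) field \<Rightarrow> real \<Rightarrow> (real \<Rightarrow> ('a, 'm, real ^ 'm) field) \<Rightarrow> bool" where
  "length_variation A g r D V \<epsilon> W \<longleftrightarrow>
     (\<forall>t. \<bar>t\<bar> < \<epsilon> \<longrightarrow> vector_field A (W t) \<and> constant_length A g r (W t)) \<and>
     (\<forall>c\<in>A. smooth_on ({-\<epsilon><..<\<epsilon>} \<times> cdom c) (\<lambda>(t, x). W t c x)) \<and>
     (\<forall>c\<in>A. \<forall>x\<in>cdom c. W 0 c x = V c x) \<and>
     (\<exists>K. compact K \<and> K \<subseteq> D \<and>
        (\<forall>t. \<bar>t\<bar> < \<epsilon> \<longrightarrow> (\<forall>c\<in>A. \<forall>p\<in>fst c - K. W t c (snd c p) = V c (snd c p))))"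

text \<open>For compact \<open>M\<close> the choice \<open>D = UNIV\<close> is allowed.\<close>

definition harmonic_vector_field ::
    "('a::{t2_space,second_countable_topology}, 'm::finite) chart set
       \<Rightarrow> ('a, 'm, real ^ 'm ^ 'm) field \<Rightarrow> ('a, 'm, real ^ 'm) field \<Rightarrow> bool" where
  "harmonic_vector_field A g V \<longleftrightarrow>
     vector_field A V \<and>
     (\<exists>r. r \<noteq> 0 \<and> constant_length A g r V \<and>
       (\<forall>\<mu> D \<epsilon> W. volume_measure A g \<mu> \<and>
            open D \<and> connected D \<and> compact (closure D) \<and>
            \<epsilon> > 0 \<and> length_variation A g r D V \<epsilon> W \<longrightarrow>
          ((\<lambda>t. energy A g \<mu> D (W t)) has_real_derivative 0) (at 0)))"

text \<open>A unit vector field \<open>V\<close> defines a harmonic map \<open>V : (M, g) \<rightarrow> (T\<^sub>1M, g\<^sup>s)\<close> when it is a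
  harmonic vector field and \<open>tr [R(\<nabla>\<^sub>\<cdot> V, V) \<cdot>] = 0\<close>.\<close>

definition defines_harmonic_map_T1 ::
    "('a::{t2_space,second_countable_topology}, 'm::finite) chart set
       \<Rightarrow> ('a, 'm, real ^ 'm ^ 'm) field \<Rightarrow> ('a, 'm, real ^ 'm) field \<Rightarrow> bool" where
  "defines_harmonic_map_T1 A g V \<longleftrightarrow>
     constant_length A g 1 V \<and> harmonic_vector_field A g V \<and>
     (\<forall>c\<in>A. \<forall>x\<in>cdom c.
        metric_trace (g c x)
          (\<lambda>u v. curvature (g c) (nabla (g c) (\<lambda>_. u) (V c)) (V c) (\<lambda>_. v) x) = 0)"

section \<open>Paracontact metric manifolds\<close>

definition contact_form ::
    "('a, 'm::finite) chart set \<Rightarrow> nat \<Rightarrow> ('a, 'm, real ^ 'm) field \<Rightarrow> bool" where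
  "contact_form A n \<eta> \<longleftrightarrow>
     one_form A \<eta> \<and> (\<forall>c\<in>A. \<forall>x\<in>cdom c. \<exists>v. wedge_contact n (\<eta> c) x v \<noteq> 0)"

definition reeb_field ::
    "('a, 'm::finite) chart set \<Rightarrow> ('a, 'm, real ^ 'm) field
       \<Rightarrow> ('a, 'm, real ^ 'm) field \<Rightarrow> bool" where
  "reeb_field A \<eta> \<xi> \<longleftrightarrow>
     vector_field A \<xi> \<and>
     (\<forall>c\<in>A. \<forall>x\<in>cdom c. \<eta> c x \<bullet> \<xi> c x = 1 \<and> (\<forall>u. ext_d (\<eta> c) (\<xi> c) (\<lambda>_. u) x = 0))"

definition paracontact_metric_manifold ::
    "('a::{t2_space,second_countable_topology}, 'm::finite) chart set \<Rightarrow> nat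
       \<Rightarrow> ('a, 'm, real ^ 'm ^ 'm) field \<Rightarrow> ('a, 'm, real ^ 'm) field
       \<Rightarrow> ('a, 'm, real ^ 'm) field \<Rightarrow> ('a, 'm, real ^ 'm ^ 'm) field \<Rightarrow> bool" where
  "paracontact_metric_manifold A n \<phi> \<xi> \<eta> g \<longleftrightarrow>
     smooth_manifold A \<and> CARD('m) = 2 * n + 1 \<and>
     contact_form A n \<eta> \<and> reeb_field A \<eta> \<xi> \<and>
     semi_riemannian_metric A g \<and> endo_field A \<phi> \<and>
     (\<forall>c\<in>A. \<forall>x\<in>cdom c. \<forall>u v.
        \<eta> c x \<bullet> u = bil (g c x) (\<xi> c x) u \<and>
        ext_d (\<eta> c) (\<lambda>_. u) (\<lambda>_. v) x = bil (g c x) u (\<phi> c x *v v) \<and>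
        \<phi> c x *v (\<phi> c x *v u) = u - (\<eta> c x \<bullet> u) *\<^sub>R \<xi> c x)"

definition killing_field ::
    "('a, 'm::finite) chart set \<Rightarrow> ('a, 'm, real ^ 'm ^ 'm) field
       \<Rightarrow> ('a, 'm, real ^ 'm) field \<Rightarrow> bool" where
  "killing_field A g V \<longleftrightarrow>
     vector_field A V \<and>
     (\<forall>c\<in>A. \<forall>x\<in>cdom c. \<forall>u v. lie_metric (g c) (V c) (\<lambda>_. u) (\<lambda>_. v) x = 0)"

definition K_paracontact ::
    "('a::{t2_space,second_countable_topology}, 'm::finite) chart set \<Rightarrow> nat
       \<Rightarrow> ('a, 'm, real ^ 'm ^ 'm) field \<Rightarrow> ('a, 'm, real ^ 'm) field
       \<Rightarrow> ('a, 'm, real ^ 'm) field \<Rightarrow> ('a, 'm, real ^ 'm ^ 'm) field \<Rightarrow> bool" where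
  "K_paracontact A n \<phi> \<xi> \<eta> g \<longleftrightarrow>
     paracontact_metric_manifold A n \<phi> \<xi> \<eta> g \<and> killing_field A g \<xi>"

definition paraSasakian ::
    "('a::{t2_space,second_countable_topology}, 'm::finite) chart set \<Rightarrow> nat
       \<Rightarrow> ('a, 'm, real ^ 'm ^ 'm) field \<Rightarrow> ('a, 'm, real ^ 'm) field
       \<Rightarrow> ('a, 'm, real ^ 'm) field \<Rightarrow> ('a, 'm, real ^ 'm ^ 'm) field \<Rightarrow> bool" where
  "paraSasakian A n \<phi> \<xi> \<eta> g \<longleftrightarrow>
     paracontact_metric_manifold A n \<phi> \<xi> \<eta> g \<and>
     (\<forall>c\<in>A. \<forall>x\<in>cdom c. \<forall>u v.
        nabla_endo (g c) (\<lambda>_. u) (\<phi> c) (\<lambda>_. v) x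
          = - bil (g c x) u v *\<^sub>R \<xi> c x + (\<eta> c x \<bullet> v) *\<^sub>R u)"

definition H_paracontact ::
    "('a::{t2_space,second_countable_topology}, 'm::finite) chart set \<Rightarrow> nat
       \<Rightarrow> ('a, 'm, real ^ 'm ^ 'm) field \<Rightarrow> ('a, 'm, real ^ 'm) field
       \<Rightarrow> ('a, 'm, real ^ 'm) field \<Rightarrow> ('a, 'm, real ^ 'm ^ 'm) field \<Rightarrow> bool" where
  "H_paracontact A n \<phi> \<xi> \<eta> g \<longleftrightarrow>
     paracontact_metric_manifold A n \<phi> \<xi> \<eta> g \<and> harmonic_vector_field A g \<xi>"

end

theory Submission
  imports Defs
begin

text \<open>In a chart, skewness of \<open>\<nabla>\<xi>\<close> and \<open>d\<eta> = g(\<cdot>, \<phi> \<cdot>)\<close> give \<open>\<nabla>\<xi> = -\<phi>\<close>, and since a Killing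
  field preserves the connection, \<open>R\<^bsub>\<xi>u\<^esub> v = (\<nabla>\<^sub>u\<nabla>\<xi>) v\<close>.  Closedness of \<open>d\<eta>\<close> and the derivative of
  \<open>(\<nabla>\<xi>)\<^sup>2 = I - \<eta> \<otimes> \<xi>\<close> determine the traces of \<open>\<nabla>\<^sup>2\<xi>\<close>, hence \<open>Q\<xi>\<close>, the harmonic map condition, and
  the collinearity of \<open>tr \<nabla>\<^sup>2\<xi>\<close> with \<open>\<xi>\<close>.  By the last fact the first variation of the energy
  density in a direction \<open>U \<bottom> \<xi>\<close> is the divergence of \<open>-\<nabla>\<^sub>U\<xi>\<close>.  Its integral vanishes: a partition of unity
  reduces this to one chart, where it follows from translation invariance of Lebesgue measure.\<close>

section \<open>Calculus\<close>

text \<open>The metric is indefinite, so positivity is never available: vectors are compared by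
  pairing them with every \<open>w\<close>, and traces over pseudo-orthonormal frames become traces
  of endomorphisms, which are evaluated by passing to adjoints and by cyclicity. Only first
  derivatives of a variation field enter the energy. A partition of unity of class C^1 therefore
  suffices, and squares of positive parts of quadratic polynomials serve as bumps; this is why the
  class \<open>C1\<close> accompanies \<open>smooth_on\<close>. The energy is a Bochner integral and
  has the value 0 on functions that are not integrable. Finiteness of the energy is not established
  on the way; the two cases are treated separately. In the paraSasakian case the Killing property
  has to be derived. There \<nabla>\<xi> = -\<phi> comes from differentiating \<phi>\<xi> = 0, and
  skewness of \<phi> then gives skewness of \<nabla>\<xi>.\<close>

abbreviation D :: "('b::real_normed_vector \<Rightarrow> 'c::real_normed_vector) \<Rightarrow> 'b \<Rightarrow> 'b \<Rightarrow> 'c" where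
  "D f x \<equiv> frechet_derivative f (at x)"

lemma D_eqI: "(f has_derivative f') (at x) \<Longrightarrow> D f x = f'"
  using frechet_derivative_at by metis

lemma D_works: "f differentiable (at x) \<Longrightarrow> (f has_derivative D f x) (at x)"
  using frechet_derivative_works by blast

lemma D_linear: "f differentiable (at x) \<Longrightarrow> linear (D f x)"
  by (rule linear_frechet_derivative)

lemma D_cong_open:
  assumes "open S" "x \<in> S" "\<And>y. y \<in> S \<Longrightarrow> f y = g y"
  shows "D f x = D g x"
proof -
  have "(f has_derivative f') (at x) \<longleftrightarrow> (g has_derivative f') (at x)" for f'
    using has_derivative_transform_within_open[of f f' x UNIV S g]
      has_derivative_transform_within_open[of g f' x UNIV S f] assms by auto
  then show ?thesis by (simp add: frechet_derivative_def)
qed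

lemma differentiable_cong_open:
  assumes "open S" "x \<in> S" "\<And>y. y \<in> S \<Longrightarrow> f y = g y" "f differentiable (at x)"
  shows "g differentiable (at x)"
  using assms unfolding differentiable_def
  by (metis has_derivative_transform_within_open)

lemma Ck_Suc_open:
  assumes "open S"
  shows "Ck (Suc k) S f \<longleftrightarrow> (\<forall>x\<in>S. f differentiable (at x)) \<and> (\<forall>v. Ck k S (\<lambda>x. D f x v))"
  by (simp add: differentiable_on_eq_differentiable_at[OF assms])

lemma C2_openD:
  assumes "Ck (Suc (Suc 0)) S f" "open S"
  shows "y \<in> S \<Longrightarrow> f differentiable (at y)" "y \<in> S \<Longrightarrow> (\<lambda>z. D f z w) differentiable (at y)"
    and "continuous_on S (\<lambda>y. D (\<lambda>z. D f z w) y v)"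
  using assms unfolding Ck_Suc_open[OF assms(2)] by auto

lemma Ck_continuous_on: "Ck k S f \<Longrightarrow> continuous_on S f"
  by (cases k) (auto intro: differentiable_imp_continuous_on)

lemma smooth_on_D: "smooth_on S f \<Longrightarrow> smooth_on S (\<lambda>x. D f x v)"
  unfolding smooth_on_def by (metis Ck.simps(2))

lemma smooth_on_differentiable: "\<lbrakk>smooth_on S f; open S; x \<in> S\<rbrakk> \<Longrightarrow> f differentiable (at x)"
  unfolding smooth_on_def by (metis Ck_Suc_open)

lemma smooth_on_continuous: "smooth_on S f \<Longrightarrow> continuous_on S f"
  unfolding smooth_on_def by (metis Ck.simps(1))

section \<open>Symmetry of second derivatives\<close>

lemma second_difference_real:
  fixes f :: "'b::real_normed_vector \<Rightarrow> real"
  assumes d: "\<And>y. y \<in> ball x r \<Longrightarrow> f differentiable (at y)"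
    and dd: "\<And>y. y \<in> ball x r \<Longrightarrow> (\<lambda>z. D f z u) differentiable (at y)"
    and h: "h > 0" "h * (norm u + norm v) < r"
  shows "\<exists>y \<in> ball x r. f (x + h *\<^sub>R u + h *\<^sub>R v) - f (x + h *\<^sub>R u) - f (x + h *\<^sub>R v) + f x
            = h * h * D (\<lambda>z. D f z u) y v"
proof -
  have inb: "x + s *\<^sub>R u + t *\<^sub>R v \<in> ball x r" if "0 \<le> s" "s \<le> h" "0 \<le> t" "t \<le> h" for s t
  proof -
    have nm: "norm (s *\<^sub>R u + t *\<^sub>R v) \<le> s * norm u + t * norm v"
      using norm_triangle_ineq[of "s *\<^sub>R u" "t *\<^sub>R v"] that by simp
    have "s * norm u + t * norm v \<le> h * (norm u + norm v)"
      using that by (simp add: distrib_left add_mono mult_right_mono)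
    with nm h have "norm (s *\<^sub>R u + t *\<^sub>R v) < r" by linarith
    moreover have "dist x (x + s *\<^sub>R u + t *\<^sub>R v) = norm (s *\<^sub>R u + t *\<^sub>R v)"
      unfolding dist_commute[of x] by (simp add: dist_norm add.assoc)
    ultimately show ?thesis by simp
  qed
  have line: "((\<lambda>s. g (p + s *\<^sub>R w)) has_real_derivative D g (p + s *\<^sub>R w) w) (at s)"
    if "g differentiable (at (p + s *\<^sub>R w))" for g :: "'b \<Rightarrow> real" and p w s
  proof -
    have "((\<lambda>s. g (p + s *\<^sub>R w)) has_derivative (\<lambda>a. D g (p + s *\<^sub>R w) (a *\<^sub>R w))) (at s)"
      by (rule has_derivative_compose[where f = "\<lambda>s. p + s *\<^sub>R w", OF _ D_works[OF that]])
        (auto intro!: derivative_eq_intros)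
    moreover have "(\<lambda>a. D g (p + s *\<^sub>R w) (a *\<^sub>R w)) = (*) (D g (p + s *\<^sub>R w) w)"
      using linear_scale[OF D_linear[OF that]] by (auto simp: fun_eq_iff)
    ultimately show ?thesis by (simp add: has_field_derivative_def)
  qed
  \<comment> \<open>The increment in direction v, as a function of the position along u. The mean
    value theorem in direction u and then in direction v leaves the mixed derivative in which u is
    taken first.\<close>
  define F where "F = (\<lambda>s. f ((x + h *\<^sub>R v) + s *\<^sub>R u) - f (x + s *\<^sub>R u))"
  have "\<exists>s. 0 < s \<and> s < h \<and>
      F h - F 0 = (h - 0) * (D f ((x + h *\<^sub>R v) + s *\<^sub>R u) u - D f (x + s *\<^sub>R u) u)"
  proof (rule MVT2)
    fix s assume s: "0 \<le> s" "s \<le> h"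
    show "(F has_real_derivative
        D f ((x + h *\<^sub>R v) + s *\<^sub>R u) u - D f (x + s *\<^sub>R u) u) (at s)"
      unfolding F_def
      by (intro DERIV_diff line d) (use inb[of s h] inb[of s 0] s h in \<open>auto simp: algebra_simps\<close>)
  qed (use h in auto)
  then obtain s where s: "0 < s" "s < h"
    and e1: "F h - F 0 = h * (D f ((x + h *\<^sub>R v) + s *\<^sub>R u) u - D f (x + s *\<^sub>R u) u)" by auto
  have "\<exists>t. 0 < t \<and> t < h \<and>
      D f ((x + s *\<^sub>R u) + h *\<^sub>R v) u - D f ((x + s *\<^sub>R u) + 0 *\<^sub>R v) u
        = (h - 0) * D (\<lambda>z. D f z u) ((x + s *\<^sub>R u) + t *\<^sub>R v) v"
    by (rule MVT2) (use h s inb[of s] in \<open>auto intro!: line dd\<close>)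
  then obtain t where t: "0 < t" "t < h"
    and e2: "D f ((x + s *\<^sub>R u) + h *\<^sub>R v) u - D f (x + s *\<^sub>R u) u
        = h * D (\<lambda>z. D f z u) ((x + s *\<^sub>R u) + t *\<^sub>R v) v" by auto
  have "F h - F 0 = h * h * D (\<lambda>z. D f z u) ((x + s *\<^sub>R u) + t *\<^sub>R v) v"
    using e1 e2 by (simp add: algebra_simps)
  then show ?thesis
    using inb[of s t] s t by (intro bexI[of _ "x + s *\<^sub>R u + t *\<^sub>R v"]) (auto simp: F_def algebra_simps)
qed

text \<open>The second difference is symmetric in u and v and equals either mixed derivative at some
  point near x, up to the factor h * h. Continuity of both at x forces them to agree there.\<close>

lemma D_D_symmetric_real:
  fixes f :: "'b::real_normed_vector \<Rightarrow> real"
  assumes S: "open S" "x \<in> S" and f: "Ck (Suc (Suc 0)) S f"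
  shows "D (\<lambda>y. D f y v) x u = D (\<lambda>y. D f y u) x v"
proof (rule ccontr)
  let ?A = "\<lambda>y. D (\<lambda>y. D f y v) y u" and ?B = "\<lambda>y. D (\<lambda>y. D f y u) y v"
  assume ne: "?A x \<noteq> ?B x"
  \<comment> \<open>Half the supposed gap: if each mixed derivative moves by less than
    \<open>e\<close>, the two cannot take a common value near x.\<close>
  define e where "e = \<bar>?A x - ?B x\<bar> / 2"
  have e: "e > 0" using ne by (simp add: e_def)
  have cont: "isCont ?A x" "isCont ?B x"
    using C2_openD(3)[OF f S(1)] S by (auto simp: continuous_on_eq_continuous_at)
  obtain r1 where r1: "r1 > 0" "\<And>y. dist y x < r1 \<Longrightarrow> dist (?A y) (?A x) < e"
    using cont(1) e unfolding continuous_at_eps_delta by metis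
  obtain r2 where r2: "r2 > 0" "\<And>y. dist y x < r2 \<Longrightarrow> dist (?B y) (?B x) < e"
    using cont(2) e unfolding continuous_at_eps_delta by metis
  obtain r3 where r3: "r3 > 0" "ball x r3 \<subseteq> S" using S openE by blast
  define r where "r = min r1 (min r2 r3)"
  have r: "r > 0" using r1 r2 r3 by (simp add: r_def)
  \<comment> \<open>The summand 1 keeps the denominator positive, also for u = v = 0, and makes the
    bound \<open>hr\<close> strict.\<close>
  define h where "h = r / (norm u + norm v + 1)"
  have h: "h > 0" unfolding h_def using r by (intro divide_pos_pos) (auto simp: add_nonneg_pos)
  have pos: "norm u + norm v + 1 > 0" by (simp add: add_nonneg_pos)
  have "h * (norm u + norm v) < h * (norm u + norm v + 1)" using h by simp
  also have "\<dots> = r" unfolding h_def using pos by simp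
  finally have hr: "h * (norm u + norm v) < r" .
  have sub: "y \<in> S" if "y \<in> ball x r" for y using that r3 by (auto simp: r_def)
  have fd: "f differentiable (at y)" "(\<lambda>z. D f z w) differentiable (at y)"
    if "y \<in> ball x r" for y w
    using C2_openD(1,2)[OF f S(1) sub[OF that]] by auto
  obtain y1 where y1: "y1 \<in> ball x r" and
    e1: "f (x + h *\<^sub>R u + h *\<^sub>R v) - f (x + h *\<^sub>R u) - f (x + h *\<^sub>R v) + f x = h * h * ?B y1"
    using second_difference_real[of x r f u h v] fd h hr by blast
  obtain y2 where y2: "y2 \<in> ball x r" and
    e2: "f (x + h *\<^sub>R v + h *\<^sub>R u) - f (x + h *\<^sub>R v) - f (x + h *\<^sub>R u) + f x = h * h * ?A y2"
    using second_difference_real[of x r f v h u] fd h hr by (auto simp: add.commute)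
  have "h * h * ?B y1 = h * h * ?A y2" using e1 e2 by (simp add: algebra_simps)
  then have "?B y1 = ?A y2" using h by simp
  moreover have "dist (?B y1) (?B x) < e" "dist (?A y2) (?A x) < e"
    using r1(2)[of y2] r2(2)[of y1] y1 y2 by (auto simp: r_def dist_commute)
  ultimately show False unfolding e_def dist_real_def by argo
qed

lemma D_inner_left:
  assumes "f differentiable (at x)"
  shows "D (\<lambda>y. f y \<bullet> b) x v = D f x v \<bullet> b"
  by (subst D_eqI) (auto intro!: derivative_eq_intros D_works assms)

lemma D_D_symmetric:
  fixes f :: "'b::real_normed_vector \<Rightarrow> 'c::euclidean_space"
  assumes S: "open S" "x \<in> S" and f: "Ck (Suc (Suc 0)) S f"
  shows "D (\<lambda>y. D f y v) x u = D (\<lambda>y. D f y u) x v"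
proof (rule euclidean_eqI)
  fix b :: 'c
  have d1: "f differentiable (at y)" "(\<lambda>z. D f z w) differentiable (at y)" if "y \<in> S" for y w
    using C2_openD(1,2)[OF f S(1) that] by auto
  have e1: "D (\<lambda>y. f y \<bullet> b) y w = D f y w \<bullet> b" if "y \<in> S" for y w
    by (rule D_inner_left[OF d1(1)[OF that]])
  have e2: "D (\<lambda>y. D (\<lambda>y. f y \<bullet> b) y w) y w' = D (\<lambda>y. D f y w) y w' \<bullet> b" if "y \<in> S" for y w w'
    by (subst D_cong_open[OF S(1) that e1]) (auto simp: D_inner_left d1 that)
  have "Ck (Suc (Suc 0)) S (\<lambda>y. f y \<bullet> b)"
  proof -
    have "(\<lambda>y. f y \<bullet> b) differentiable (at y)" if "y \<in> S" for y
      using d1(1)[OF that] by simp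
    moreover have "(\<lambda>z. D (\<lambda>y. f y \<bullet> b) z w) differentiable (at y)" if "y \<in> S" for y w
      by (rule differentiable_cong_open[OF S(1) that e1[symmetric]]) (use d1(2)[OF that] in auto)
    moreover have "continuous_on S (\<lambda>y. D (\<lambda>y. D (\<lambda>y. f y \<bullet> b) y w) y w')" for w w'
    proof -
      have "continuous_on S (\<lambda>y. D (\<lambda>y. D f y w) y w' \<bullet> b)"
        by (intro continuous_intros C2_openD(3)[OF f S(1)])
      then show ?thesis by (rule continuous_on_eq) (simp add: e2)
    qed
    ultimately show ?thesis unfolding Ck_Suc_open[OF S(1)] by simp
  qed
  from D_D_symmetric_real[OF S this, of v u] show "D (\<lambda>y. D f y v) x u \<bullet> b = D (\<lambda>y. D f y u) x v \<bullet> b"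
    by (simp add: e2 S)
qed

lemma smooth_on_D_D_symmetric:
  fixes f :: "'b::real_normed_vector \<Rightarrow> 'c::euclidean_space"
  assumes "smooth_on S f" "open S" "x \<in> S"
  shows "D (\<lambda>y. D f y v) x u = D (\<lambda>y. D f y u) x v"
  using D_D_symmetric[OF assms(2,3)] assms(1) unfolding smooth_on_def by blast

subsection \<open>Matrices\<close>

lemma bounded_bilinear_matrix_vector_mult:
  "bounded_bilinear ((*v) :: real ^ 'n::finite ^ 'm::finite \<Rightarrow> real ^ 'n \<Rightarrow> real ^ 'm)"
  unfolding bilinear_conv_bounded_bilinear[symmetric] bilinear_def
  by (auto intro!: linearI simp: matrix_vector_right_distrib matrix_vector_mult_add_rdistrib
      matrix_vector_mult_scaleR scaleR_matrix_vector_assoc)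

lemmas has_derivative_matrix_vector_mult [derivative_intros] =
  bounded_bilinear.FDERIV[OF bounded_bilinear_matrix_vector_mult]

lemmas continuous_on_matrix_vector_mult [continuous_intros] =
  bounded_bilinear.continuous_on[OF bounded_bilinear_matrix_vector_mult]

lemma bounded_bilinear_matrix_mult:
  "bounded_bilinear ((**) :: real ^ 'n::finite ^ 'm::finite \<Rightarrow> real ^ 'p::finite ^ 'n \<Rightarrow> real ^ 'p ^ 'm)"
  unfolding bilinear_conv_bounded_bilinear[symmetric] bilinear_def
  by (auto intro!: linearI simp: matrix_matrix_mult_def vec_eq_iff sum_distrib_left algebra_simps
      sum.distrib)

lemmas has_derivative_matrix_mult [derivative_intros] =
  bounded_bilinear.FDERIV[OF bounded_bilinear_matrix_mult]

lemma has_derivative_vec_nth [derivative_intros]: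
  "(f has_derivative f') F \<Longrightarrow> ((\<lambda>x. f x $ i) has_derivative (\<lambda>h. f' h $ i)) F"
  by (rule bounded_linear.has_derivative[OF bounded_linear_vec_nth])

text \<open>In the Leibniz formula a permutation other than \<open>id\<close> moves at least two
  indices. After one factor is differentiated, an off-diagonal entry of the identity matrix is still
  left in the product, so only \<open>id\<close> contributes.\<close>

lemma has_derivative_det_id:
  fixes F :: "'b::real_normed_vector \<Rightarrow> real ^ 'n::finite ^ 'n"
  assumes F: "(F has_derivative F') (at x)" and id: "F x = mat 1"
  shows "((\<lambda>y. det (F y)) has_derivative (\<lambda>h. trace (F' h))) (at x)"
proof -
  have "((\<lambda>y. det (F y)) has_derivative (\<lambda>h. \<Sum>p | p permutes UNIV. of_int (sign p) *
      (\<Sum>i\<in>UNIV. F' h $ i $ p i * (\<Prod>j\<in>UNIV - {i}. F x $ j $ p j)))) (at x)"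
    unfolding det_def by (auto intro!: derivative_eq_intros F)
  moreover have "(\<Sum>p | p permutes UNIV. of_int (sign p) *
      (\<Sum>i\<in>UNIV. F' h $ i $ p i * (\<Prod>j\<in>UNIV - {i}. F x $ j $ p j))) = trace (F' h)" for h
  proof -
    have z: "of_int (sign p) * (\<Sum>i\<in>UNIV. F' h $ i $ p i * (\<Prod>j\<in>UNIV - {i}. F x $ j $ p j)) = 0"
      if p: "p permutes UNIV" "p \<noteq> id" for p
    proof -
      have "(\<Prod>j\<in>UNIV - {i}. F x $ j $ p j) = 0" for i
      proof -
        obtain k where k: "p k \<noteq> k" using p(2) by (auto simp: fun_eq_iff)
        have "p (p k) \<noteq> p k" using k p(1) by (metis permutes_inj injD)
        with k have "\<exists>j. j \<noteq> i \<and> p j \<noteq> j" by metis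
        then obtain j where j: "j \<noteq> i" "p j \<noteq> j" by blast
        show ?thesis by (rule prod_zero[OF _ bexI[of _ j]]) (use j in \<open>auto simp: id mat_def\<close>)
      qed
      then show ?thesis by (simp only: mult_zero_right sum.neutral_const)
    qed
    have "(\<Sum>p | p permutes UNIV. of_int (sign p) *
        (\<Sum>i\<in>UNIV. F' h $ i $ p i * (\<Prod>j\<in>UNIV - {i}. F x $ j $ p j))) =
        (\<Sum>p\<in>{id}. of_int (sign p) *
        (\<Sum>i\<in>UNIV. F' h $ i $ p i * (\<Prod>j\<in>UNIV - {i}. F x $ j $ p j)))"
      by (rule sum.mono_neutral_right) (auto simp: z permutes_id)
    also have "\<dots> = trace (F' h)" by (simp add: trace_def id mat_def sign_id)
    finally show ?thesis .
  qed
  ultimately show ?thesis by simp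
qed

lemma matrix_inv_mult:
  fixes A :: "real ^ 'n::finite ^ 'n"
  assumes "invertible A"
  shows "A ** matrix_inv A = mat 1" "matrix_inv A ** A = mat 1"
  using someI_ex[OF assms[unfolded invertible_def]] unfolding matrix_inv_def by auto

lemma matrix_inv_vec:
  fixes A :: "real ^ 'n::finite ^ 'n"
  assumes "invertible A"
  shows "A *v (matrix_inv A *v u) = u" "matrix_inv A *v (A *v u) = u"
  by (simp_all add: matrix_vector_mul_assoc matrix_inv_mult[OF assms])

lemma matrix_inv_transpose_sym:
  fixes A :: "real ^ 'n::finite ^ 'n"
  assumes "invertible A" "transpose A = A"
  shows "transpose (matrix_inv A) = matrix_inv A"
proof -
  have "transpose (matrix_inv A) ** A = mat 1"
    using arg_cong[OF matrix_inv_mult(1)[OF assms(1)], of transpose]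
    by (simp add: matrix_transpose_mul assms(2) transpose_mat)
  then have "(transpose (matrix_inv A) ** A) ** matrix_inv A = matrix_inv A" by simp
  then show ?thesis by (simp add: matrix_mul_assoc[symmetric] matrix_inv_mult[OF assms(1)])
qed

text \<open>Jacobi's formula. Multiplication by the fixed matrix \<open>matrix_inv (F x)\<close>
  normalises the value at x to the identity, and determinants are multiplicative.\<close>

lemma has_derivative_det:
  fixes F :: "'b::real_normed_vector \<Rightarrow> real ^ 'n::finite ^ 'n"
  assumes F: "(F has_derivative F') (at x)" and inv: "invertible (F x)"
  shows "((\<lambda>y. det (F y)) has_derivative (\<lambda>h. det (F x) * trace (matrix_inv (F x) ** F' h))) (at x)"
proof -
  let ?B = "matrix_inv (F x)"
  have "((\<lambda>y. det (?B ** F y)) has_derivative (\<lambda>h. trace (?B ** F' h))) (at x)"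
    by (rule has_derivative_det_id)
      (auto simp: matrix_inv_mult[OF inv] bounded_bilinear.zero_left[OF bounded_bilinear_matrix_mult]
        intro!: derivative_eq_intros F)
  from has_derivative_mult_right[OF this, of "det (F x)"]
  show ?thesis
    by (simp flip: det_mul add: matrix_mul_assoc matrix_inv_mult[OF inv])
qed

text \<open>Meant also for the numerators in Cramer's rule, whose matrices may be singular and are
  given entrywise.\<close>

lemma differentiable_det:
  fixes F :: "'b::real_normed_vector \<Rightarrow> real ^ 'n::finite ^ 'n"
  assumes "\<And>i j. (\<lambda>y. F y $ i $ j) differentiable (at x)"
  shows "(\<lambda>y. det (F y)) differentiable (at x)"
proof -
  have "((\<lambda>y. F y $ i $ j) has_derivative D (\<lambda>y. F y $ i $ j) x) (at x)" for i j
    by (rule D_works[OF assms])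
  then have "((\<lambda>y. det (F y)) has_derivative (\<lambda>h. \<Sum>p | p permutes UNIV. of_int (sign p) *
      (\<Sum>i\<in>UNIV. D (\<lambda>y. F y $ i $ p i) x h * (\<Prod>j\<in>UNIV - {i}. F x $ j $ p j)))) (at x)"
    unfolding det_def
    by (intro has_derivative_sum has_derivative_mult_right has_derivative_prod)
  then show ?thesis by (simp add: differentiable_def) blast
qed

lemma differentiable_vec_nth:
  "f differentiable (at x) \<Longrightarrow> (\<lambda>y. f y $ i) differentiable (at x)"
  unfolding differentiable_def by (auto intro: has_derivative_vec_nth)

lemma differentiable_vecI:
  fixes f :: "'b::real_normed_vector \<Rightarrow> real ^ 'n::finite"
  assumes "\<And>i. (\<lambda>y. f y $ i) differentiable (at x)"
  shows "f differentiable (at x)"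
  using assms differentiable_componentwise_within[of f x UNIV]
  by (auto simp: Basis_vec_def inner_axis)

text \<open>By Cramer's rule each component is a quotient of two determinants, so the inverse matrix
  itself is never differentiated.\<close>

lemma differentiable_matrix_inv_mult:
  fixes F :: "'b::real_normed_vector \<Rightarrow> real ^ 'n::finite ^ 'n"
  assumes F: "F differentiable (at x)" and b: "b differentiable (at x)"
    and S: "open S" "x \<in> S" "\<And>y. y \<in> S \<Longrightarrow> invertible (F y)"
  shows "(\<lambda>y. matrix_inv (F y) *v b y) differentiable (at x)"
proof (rule differentiable_vecI)
  fix k
  let ?M = "\<lambda>y. (\<chi> i j. if j = k then b y $ i else F y $ i $ j)"
  have "(\<lambda>y. ?M y $ i $ j) differentiable (at x)" for i j
    by (cases "j = k") (auto intro!: differentiable_vec_nth F b)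
  then have "(\<lambda>y. det (?M y)) differentiable (at x)" by (rule differentiable_det)
  moreover have "(\<lambda>y. det (F y)) differentiable (at x)"
    by (intro differentiable_det differentiable_vec_nth F)
  moreover have nz: "det (F y) \<noteq> 0" if "y \<in> S" for y
    using S(3)[OF that] invertible_det_nz by blast
  ultimately have "(\<lambda>y. det (?M y) / det (F y)) differentiable (at x)"
    using S by (intro differentiable_divide) auto
  moreover have "det (?M y) / det (F y) = (matrix_inv (F y) *v b y) $ k" if "y \<in> S" for y
  proof -
    have "F y *v (matrix_inv (F y) *v b y) = b y" by (rule matrix_inv_vec(1)[OF S(3)[OF that]])
    then show ?thesis unfolding cramer[OF nz[OF that]] by (simp add: vec_eq_iff)
  qed
  ultimately show "(\<lambda>y. (matrix_inv (F y) *v b y) $ k) differentiable (at x)"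
    by (rule differentiable_cong_open[OF S(1,2), rotated])
qed

section \<open>Linear algebra of a metric at a point\<close>

lemma bil_simps [simp]:
  "bil B (a + b) c = bil B a c + bil B b c" "bil B c (a + b) = bil B c a + bil B c b"
  "bil B (a - b) c = bil B a c - bil B b c" "bil B c (a - b) = bil B c a - bil B c b"
  "bil B (r *\<^sub>R a) c = r * bil B a c" "bil B c (r *\<^sub>R a) = r * bil B c a"
  "bil B (- a) c = - bil B a c" "bil B c (- a) = - bil B c a"
  "bil B 0 c = 0" "bil B c 0 = 0"
  by (simp_all add: bil_def inner_add matrix_vector_right_distrib inner_diff
      matrix_vector_mult_diff_distrib matrix_vector_mult_scaleR linear_neg[OF matrix_vector_mul_linear])

lemma bil_matrix_simps:
  "bil (A + B) a c = bil A a c + bil B a c" "bil (r *\<^sub>R A) a c = r * bil A a c"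
  by (simp_all add: bil_def matrix_vector_mult_add_rdistrib inner_add scaleR_matrix_vector_assoc[symmetric])

lemma bil_sum: "bil B (sum f I) c = (\<Sum>i\<in>I. bil B (f i) c)"
  by (simp add: bil_def inner_sum_left)

lemma bil_commute: "transpose B = B \<Longrightarrow> bil B u v = bil B v u"
  unfolding bil_def by (metis dot_lmul_matrix inner_commute transpose_matrix_vector)

lemma has_derivative_bil [derivative_intros]:
  assumes "(F has_derivative F') (at x within s)" "(a has_derivative a') (at x within s)"
    "(b has_derivative b') (at x within s)"
  shows "((\<lambda>y. bil (F y) (a y) (b y)) has_derivative
    (\<lambda>h. bil (F' h) (a x) (b x) + bil (F x) (a' h) (b x) + bil (F x) (a x) (b' h))) (at x within s)"
  unfolding bil_def using assms
  by (auto intro!: derivative_eq_intros simp: inner_add algebra_simps)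

lemma continuous_on_bil [continuous_intros]:
  assumes "continuous_on s F" "continuous_on s a" "continuous_on s b"
  shows "continuous_on s (\<lambda>y. bil (F y) (a y) (b y))"
  unfolding bil_def by (intro continuous_intros assms)

lemma vec_expansion: "(\<Sum>i\<in>UNIV. (w $ i) *\<^sub>R axis i 1) = (w :: real ^ 'm::finite)"
  using basis_expansion[of w] by (simp add: scalar_mult_eq_scaleR)

lemma linear_expansion:
  fixes f :: "real ^ 'm::finite \<Rightarrow> 'b::real_vector"
  assumes "linear f"
  shows "f w = (\<Sum>i\<in>UNIV. (w $ i) *\<^sub>R f (axis i 1))"
  using vec_expansion[of w] linear_sum[OF assms, of "\<lambda>i. (w $ i) *\<^sub>R axis i 1" UNIV]
  by (simp add: linear_scale[OF assms])

lemma inner_vec_lambda_linear: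
  fixes f :: "real ^ 'm::finite \<Rightarrow> real"
  assumes "linear f"
  shows "(\<chi> l. f (axis l 1)) \<bullet> w = f w"
  by (subst linear_expansion[OF assms, of w]) (simp add: inner_vec_def mult.commute)

text \<open>The trace of an endomorphism that is given as a function, so that compositions of
  covariant derivatives need not be turned into matrices.\<close>

definition tr :: "(real ^ 'm \<Rightarrow> real ^ 'm::finite) \<Rightarrow> real" where
  "tr f = (\<Sum>k\<in>UNIV. f (axis k 1) $ k)"

lemma tr_matrix: "trace M = tr (\<lambda>u. M *v u)"
  by (simp add: tr_def trace_def matrix_vector_mult_basis column_def)

lemma tr_simps:
  "tr (\<lambda>u. f u + g u) = tr f + tr g" "tr (\<lambda>u. f u - g u) = tr f - tr g"
  "tr (\<lambda>u. - f u) = - tr f" "tr (\<lambda>u. r *\<^sub>R f u) = r * tr f" "tr (\<lambda>u. 0) = 0"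
  "tr (\<lambda>u. u :: real ^ 'm::finite) = CARD('m)"
  by (simp_all add: tr_def sum.distrib sum_subtractf sum_negf sum_distrib_left axis_def)

lemma matrix_linear: "linear f \<Longrightarrow> matrix f *v u = f u" for f :: "real ^ 'n::finite \<Rightarrow> real ^ 'm::finite"
  using matrix_vector_mul by metis

lemma tr_eq_trace: "linear f \<Longrightarrow> tr f = trace (matrix f)"
  by (simp add: tr_matrix matrix_linear)

lemma tr_comp_commute:
  assumes "linear f" "linear g"
  shows "tr (\<lambda>u. f (g u)) = tr (\<lambda>u. g (f u))"
proof -
  have "tr (\<lambda>u. f (g u)) = trace (matrix f ** matrix g)" if "linear f" "linear g" for f g
    using that by (simp add: tr_matrix matrix_linear flip: matrix_vector_mul_assoc)
  then show ?thesis using assms by (metis trace_mul_sym)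
qed

lemma tr_rank_one:
  assumes "linear l"
  shows "tr (\<lambda>u. l u *\<^sub>R b) = l b"
  by (subst linear_expansion[OF assms, of b]) (simp add: tr_def mult.commute)

text \<open>A scalar product of arbitrary signature on a single tangent space. Its lemma
  \<open>nondegenerate\<close> is the means by which vector identities are proved below.\<close>

locale metric_tensor =
  fixes B :: "real ^ 'm ^ 'm::finite"
  assumes symB: "transpose B = B" and invB: "invertible B"
begin

lemma sym: "bil B u v = bil B v u"
  by (rule bil_commute[OF symB])

lemma bil_eq_inner: "bil B u v = (B *v u) \<bullet> v"
  by (subst sym) (simp add: bil_def inner_commute)

lemma nondegenerate:
  assumes "\<And>w. bil B a w = bil B b w"
  shows "a = b"
proof -
  have "\<forall>w. (B *v a) \<bullet> w = (B *v b) \<bullet> w" using assms by (auto simp: bil_eq_inner)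
  then have "B *v a = B *v b" by (simp only: vector_eq_rdot)
  then show ?thesis by (metis matrix_inv_vec(2)[OF invB])
qed

lemma bil_matrix_inv: "bil B (matrix_inv B *v a) w = a \<bullet> w"
  by (simp add: bil_eq_inner matrix_inv_vec[OF invB])

lemma matrix_inv_symmetric: "matrix_inv B $ i $ j = matrix_inv B $ j $ i"
  using arg_cong[OF matrix_inv_transpose_sym[OF invB symB], of "\<lambda>M. M $ j $ i"]
  by (simp add: transpose_def)

text \<open>Contraction with the inverse metric undoes the lowering of an index. This takes the
  place of sums over pseudo-orthonormal frames.\<close>

lemma metric_trace_bil:
  "metric_trace B (\<lambda>u v. bil B (f u) v) = tr f"
proof -
  have *: "(\<Sum>j\<in>UNIV. matrix_inv B $ i $ j * bil B a (axis j 1)) = a $ i" for a i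
  proof -
    have "(\<Sum>j\<in>UNIV. matrix_inv B $ i $ j * bil B a (axis j 1)) = (matrix_inv B *v (B *v a)) $ i"
      by (simp add: bil_eq_inner matrix_vector_mult_def[of "matrix_inv B"] inner_axis)
    then show ?thesis by (simp add: matrix_inv_vec[OF invB])
  qed
  show ?thesis unfolding metric_trace_def tr_def by (simp add: *)
qed

text \<open>In matrices, adjointness says that the transpose of \<open>f\<close> times
  \<open>B\<close> equals \<open>B\<close> times \<open>g\<close>; hence \<open>g\<close> is similar
  to the transpose of \<open>f\<close>.\<close>

lemma tr_adjoint:
  assumes "linear f" "linear g" "\<And>u w. bil B (f u) w = bil B u (g w)"
  shows "tr f = tr g"
proof -
  let ?f = "matrix f" and ?g = "matrix g"
  have "u \<bullet> (transpose ?f *v (B *v w)) = u \<bullet> (B *v (?g *v w))" for u w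
  proof -
    have "u \<bullet> (transpose ?f *v (B *v w)) = (?f *v u) \<bullet> (B *v w)"
      by (metis dot_lmul_matrix inner_commute transpose_matrix_vector)
    then show ?thesis
      using assms(3)[of u w] by (simp add: bil_def matrix_linear assms(1,2))
  qed
  then have "transpose ?f *v (B *v w) = B *v (?g *v w)" for w
    by (metis vector_eq_ldot)
  then have "transpose ?f ** B = B ** ?g"
    by (simp add: matrix_eq matrix_vector_mul_assoc[symmetric])
  then have "?g = matrix_inv B ** (transpose ?f ** B)"
    by (simp add: matrix_mul_assoc matrix_inv_mult[OF invB])
  then have "trace ?g = trace (transpose ?f)"
    by (metis trace_mul_sym matrix_mul_assoc matrix_mul_rid matrix_inv_mult(1)[OF invB])
  then show ?thesis
    by (simp add: tr_eq_trace assms(1,2)) (simp add: trace_def transpose_def)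
qed

text \<open>In the application \<open>S = \<nabla>\<xi>\<close> and \<open>N u v = (\<nabla>\<^sub>u S) v\<close>.\<close>

context
  fixes S :: "real ^ 'm \<Rightarrow> real ^ 'm" and N :: "real ^ 'm \<Rightarrow> real ^ 'm \<Rightarrow> real ^ 'm"
    and \<xi> :: "real ^ 'm"
  assumes linS: "linear S" and linN1: "\<And>v. linear (\<lambda>u. N u v)" and linN2: "\<And>u. linear (N u)"
    and unit: "bil B \<xi> \<xi> = 1"
    and skewS: "\<And>u v. bil B (S u) v = - bil B u (S v)"
    and S_S: "\<And>u. S (S u) = u - bil B \<xi> u *\<^sub>R \<xi>"
    and skewN: "\<And>u v w. bil B (N u v) w = - bil B v (N u w)"
    and N_S: "\<And>u v. N u (S v) + S (N u v) = - bil B (S u) v *\<^sub>R \<xi> - bil B \<xi> v *\<^sub>R S u"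
    and cyclic: "\<And>u v w. bil B (N u v) w + bil B (N v w) u + bil B (N w u) v = 0"
    and S_\<xi>: "S \<xi> = 0"
begin

lemma bil_xi_S: "bil B \<xi> (S u) = 0"
  using skewS[of \<xi> u] S_\<xi> by simp

lemma linear_bil: "linear (\<lambda>u. bil B a u)" "linear (\<lambda>u. bil B u a)"
  by (auto intro!: linearI)

lemma tr_S: "tr S = 0"
  using tr_adjoint[OF linS, of "\<lambda>u. - S u"] linear_compose_neg[OF linS] skewS
  by (simp add: tr_simps)

text \<open>By \<open>N_S\<close> the anticommutator of \<open>S\<close> and \<open>N v\<close> is a
  sum of two maps of rank one, with traces -g(S v, \<xi>) and -g(\<xi>, S v), both 0. Its two
  summands have equal traces by cyclicity.\<close>

lemma tr_S_N: "tr (\<lambda>u. S (N v u)) = 0"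
proof -
  have "tr (\<lambda>u. N v (S u)) + tr (\<lambda>u. S (N v u)) = tr (\<lambda>u. N v (S u) + S (N v u))"
    by (simp add: tr_simps)
  also have "\<dots> = - tr (\<lambda>u. bil B (S v) u *\<^sub>R \<xi>) - tr (\<lambda>u. bil B \<xi> u *\<^sub>R S v)"
    by (simp add: N_S tr_simps)
  also have "\<dots> = 0"
    by (simp add: tr_rank_one linear_bil bil_xi_S sym[of _ \<xi>])
  finally show ?thesis using tr_comp_commute[OF linS linN2, of v] by simp
qed

text \<open>The cyclic identity gives \<open>?A'\<close> as the adjoint of
  \<open>\<lambda>u. N u v\<close>. Taking adjoints reproduces the trace with the opposite sign plus
  the trace of \<open>tr_S_N\<close>, so twice the trace is 0.\<close>

lemma tr_S_N': "tr (\<lambda>u. S (N u v)) = 0"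
proof -
  let ?A' = "\<lambda>u. N u v - N v u"
  have linA': "linear ?A'" by (intro linear_compose_sub linN1 linN2)
  have adj: "bil B (N u v) w = bil B u (?A' w)" for u w
    using cyclic[of u v w] skewN[of w u v] skewN[of v w u] sym[of "N v w" u] by simp
  have "tr (\<lambda>u. S (N u v)) = tr (\<lambda>u. - ?A' (S u))"
    by (rule tr_adjoint)
      (auto intro!: linear_compose_neg linear_compose[OF linS linA', unfolded o_def]
        linear_compose[OF linN1 linS, unfolded o_def] simp only: adj skewS bil_simps)
  also have "\<dots> = - tr (\<lambda>u. ?A' (S u))" by (simp only: tr_simps)
  also have "\<dots> = - tr (\<lambda>u. S (?A' u))" using tr_comp_commute[OF linS linA'] by simp
  also have "\<dots> = - tr (\<lambda>u. S (N u v)) + tr (\<lambda>u. S (N v u))"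
    by (simp add: linear_diff[OF linS] tr_simps)
  finally show ?thesis using tr_S_N by simp
qed

lemma tr_N_S: "tr (\<lambda>u. N (S u) v) = 0"
  using tr_comp_commute[OF linS linN1] tr_S_N' by simp

text \<open>This is the divergence of \<nabla>\<xi> and the source of the Ricci curvature. It is
  linear in \<open>v\<close>, so it suffices to know it on the image of \<open>S\<close> and at
  \<open>\<xi>\<close>.\<close>

lemma tr_N: "tr (\<lambda>u. N u v) = - (CARD('m) - 1) * bil B \<xi> v"
proof -
  have lin: "linear (\<lambda>v. tr (\<lambda>u. N u v))"
    by (rule linearI) (simp_all add: linear_add[OF linN2] linear_scale[OF linN2] tr_simps)
  \<comment> \<open>\<open>N u \<xi>\<close> is recovered from its image under \<open>S\<close>
    together with its component along \<open>\<xi>\<close>, because \<open>S\<close> squared is the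
    identity up to a multiple of \<open>\<xi>\<close>.\<close>
  have "S (N u \<xi>) = - S u" for u
    using N_S[of u \<xi>] S_\<xi> linear_0[OF linN2] unit sym[of "S u" \<xi>] bil_xi_S by simp
  moreover have "bil B \<xi> (N u \<xi>) = 0" for u
    using skewN[of u \<xi> \<xi>] sym[of "N u \<xi>" \<xi>] by simp
  ultimately have "N u \<xi> = - (u - bil B \<xi> u *\<^sub>R \<xi>)" for u
    using S_S[of "N u \<xi>"] S_S[of u] linear_neg[OF linS] by simp
  then have xi: "tr (\<lambda>u. N u \<xi>) = - (CARD('m) - 1)"
    by (simp add: tr_simps tr_rank_one linear_bil unit del: minus_diff_eq)
  have S0: "tr (\<lambda>u. N u (S v)) = 0" for v
  proof -
    have "tr (\<lambda>u. N u (S v)) + tr (\<lambda>u. S (N u v)) = tr (\<lambda>u. N u (S v) + S (N u v))"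
      by (simp add: tr_simps)
    also have "\<dots> = - tr (\<lambda>u. bil B (S u) v *\<^sub>R \<xi>) - bil B \<xi> v * tr S"
      by (simp add: N_S tr_simps)
    also have "tr (\<lambda>u. bil B (S u) v *\<^sub>R \<xi>) = bil B (S \<xi>) v"
      by (rule tr_rank_one) (auto intro!: linearI simp: linear_add[OF linS] linear_scale[OF linS])
    finally show ?thesis by (simp add: S_\<xi> tr_S tr_S_N')
  qed
  \<comment> \<open>This splits \<open>v\<close> into a vector in the image of \<open>S\<close>,
    where the trace vanishes by \<open>S0\<close>, and a multiple of \<open>\<xi>\<close>.\<close>
  have "v = S (S v) + bil B \<xi> v *\<^sub>R \<xi>" by (simp add: S_S)
  then have "tr (\<lambda>u. N u v) = tr (\<lambda>u. N u (S (S v))) + bil B \<xi> v * tr (\<lambda>u. N u \<xi>)"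
    using linear_add[OF lin] linear_scale[OF lin] by (metis real_scaleR_def)
  then show ?thesis by (simp add: S0 xi)
qed

text \<open>Paired with \<open>w\<close>, the vector-valued trace becomes, by skewness of
  \<open>N\<close>, minus the ordinary trace of \<open>\<lambda>u. N (S u) w\<close>, which is
  \<open>tr_N_S\<close>.\<close>

lemma metric_trace_N_S: "metric_trace B (\<lambda>u v. N (S u) v) = 0"
proof (rule nondegenerate)
  fix w
  have "bil B (metric_trace B (\<lambda>u v. N (S u) v)) w
      = metric_trace B (\<lambda>u v. bil B (N (S u) v) w)"
    by (simp add: metric_trace_def bil_sum)
  also have "\<dots> = metric_trace B (\<lambda>u v. bil B (- N (S u) w) v)"
  proof -
    have "bil B (N (S u) v) w = bil B (- N (S u) w) v" for u v
      using skewN[of "S u" v w] sym[of v "N (S u) w"] by simp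
    then show ?thesis by (simp only:)
  qed
  also have "\<dots> = 0" by (simp only: metric_trace_bil tr_simps tr_N_S)
  finally show "bil B (metric_trace B (\<lambda>u v. N (S u) v)) w = bil B 0 w" by simp
qed

end

end

section \<open>Geometry in a chart\<close>

text \<open>\<open>smooth_on\<close> controls \<open>D f y v\<close> only for a fixed vector v. A
  direction that moves with y is therefore expanded in the standard basis.\<close>

lemma has_derivative_D_moving:
  fixes f :: "real ^ 'm::finite \<Rightarrow> 'b::real_normed_vector"
  assumes f: "smooth_on S f" and S: "open S" "x \<in> S" and X: "(X has_derivative X') (at x)"
  shows "((\<lambda>y. D f y (X y)) has_derivative (\<lambda>h. D (\<lambda>y. D f y (X x)) x h + D f x (X' h))) (at x)"
proof -
  have d1: "f differentiable (at y)" if "y \<in> S" for y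
    using smooth_on_differentiable f S(1) that by blast
  have d2: "(\<lambda>z. D f z v) differentiable (at x)" for v
    using smooth_on_differentiable smooth_on_D f S by blast
  have lin: "D f y v = (\<Sum>i\<in>UNIV. (v $ i) *\<^sub>R D f y (axis i 1))" if "y \<in> S" for y v
    by (rule linear_expansion[OF D_linear[OF d1[OF that]]])
  have main: "((\<lambda>y. D f y (Y y)) has_derivative (\<lambda>h. (\<Sum>i\<in>UNIV. (Y x $ i) *\<^sub>R D (\<lambda>y. D f y (axis i 1)) x h)
      + D f x (Y' h))) (at x)" if Y: "(Y has_derivative Y') (at x)" for Y Y'
  proof -
    have "((\<lambda>y. \<Sum>i\<in>UNIV. (Y y $ i) *\<^sub>R D f y (axis i 1)) has_derivative
        (\<lambda>h. \<Sum>i\<in>UNIV. (Y x $ i) *\<^sub>R D (\<lambda>y. D f y (axis i 1)) x h + (Y' h $ i) *\<^sub>R D f x (axis i 1))) (at x)"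
      by (intro has_derivative_sum has_derivative_scaleR has_derivative_vec_nth Y D_works d2)
    then have "((\<lambda>y. D f y (Y y)) has_derivative
        (\<lambda>h. \<Sum>i\<in>UNIV. (Y x $ i) *\<^sub>R D (\<lambda>y. D f y (axis i 1)) x h + (Y' h $ i) *\<^sub>R D f x (axis i 1))) (at x)"
      by (rule has_derivative_transform_within_open[OF _ S]) (simp add: lin)
    then show ?thesis by (simp add: lin[OF S(2), of "Y' _"] sum.distrib)
  qed
  have "D (\<lambda>y. D f y (X x)) x h = (\<Sum>i\<in>UNIV. (X x $ i) *\<^sub>R D (\<lambda>y. D f y (axis i 1)) x h)" for h
    using D_eqI[OF main[OF has_derivative_const[of "X x"]]] linear_0[OF D_linear[OF d1[OF S(2)]]] by simp
  then show ?thesis using main[OF X] by simp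
qed

section \<open>The Levi-Civita connection and the volume density in coordinates\<close>

locale chart_metric =
  fixes S :: "(real ^ 'm::finite) set" and G :: "real ^ 'm \<Rightarrow> real ^ 'm ^ 'm"
  assumes open_S: "open S" and smooth_G: "smooth_on S G"
    and sym_G: "x \<in> S \<Longrightarrow> transpose (G x) = G x" and inv_G: "x \<in> S \<Longrightarrow> invertible (G x)"
begin

lemma metric_tensor: "x \<in> S \<Longrightarrow> metric_tensor (G x)"
  by unfold_locales (auto simp: sym_G inv_G)

lemmas g_sym = metric_tensor.sym[OF metric_tensor]
lemmas g_nondegenerate = metric_tensor.nondegenerate[OF metric_tensor]

lemma G_works: "x \<in> S \<Longrightarrow> (G has_derivative D G x) (at x)"
  using D_works smooth_on_differentiable smooth_G open_S by blast

lemma DG_linear: "x \<in> S \<Longrightarrow> linear (D G x)"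
  using D_linear smooth_on_differentiable smooth_G open_S by blast

lemma DG_sym:
  assumes x: "x \<in> S"
  shows "bil (D G x u) v w = bil (D G x u) w v"
proof -
  have "D (\<lambda>y. bil (G y) v w) x u = D (\<lambda>y. bil (G y) w v) x u"
    by (rule D_cong_open[OF open_S x, THEN fun_cong]) (rule g_sym)
  moreover have "D (\<lambda>y. bil (G y) v w) x = (\<lambda>u. bil (D G x u) v w)" for v w
    by (rule D_eqI) (auto intro!: derivative_eq_intros G_works x)
  ultimately show ?thesis by metis
qed

lemma bil_DG_linear: "x \<in> S \<Longrightarrow> linear (\<lambda>w. bil (D G x w) u v)"
  by (rule linearI) (simp_all add: linear_add[OF DG_linear] linear_scale[OF DG_linear] bil_matrix_simps)

text \<open>Koszul's formula. Lowering the index removes the inverse matrix, so identities between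
  Christoffel symbols reduce to identities between derivatives of \<open>G\<close>.\<close>

lemma christoffel_lower:
  assumes x: "x \<in> S"
  shows "bil (G x) (christoffel G x u v) w
      = (bil (D G x u) v w + bil (D G x v) u w - bil (D G x w) u v) / 2"
proof -
  have "linear (\<lambda>w. (bil (D G x u) v w + bil (D G x v) u w - bil (D G x w) u v) / 2)"
    by (rule linearI) (simp_all add: linear_add[OF bil_DG_linear[OF x]]
      linear_scale[OF bil_DG_linear[OF x]] field_simps)
  from inner_vec_lambda_linear[OF this, of w] show ?thesis
    unfolding christoffel_def metric_tensor.bil_matrix_inv[OF metric_tensor[OF x]] .
qed

lemma christoffel_sym: "x \<in> S \<Longrightarrow> christoffel G x u v = christoffel G x v u"
  by (rule g_nondegenerate[of x]) (simp_all add: christoffel_lower DG_sym[of x _ u v])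

lemma christoffel_linear1: "x \<in> S \<Longrightarrow> linear (\<lambda>u. christoffel G x u v)"
  by (rule linearI; rule g_nondegenerate[of x])
    (simp_all add: christoffel_lower bil_DG_linear linear_add[OF bil_DG_linear]
      linear_scale[OF bil_DG_linear] algebra_simps add_divide_distrib diff_divide_distrib)

lemma christoffel_linear2: "x \<in> S \<Longrightarrow> linear (christoffel G x u)"
  using christoffel_linear1[of x u] christoffel_sym[of x] by presburger

lemma christoffel_expansion:
  assumes x: "x \<in> S"
  shows "christoffel G x u v = (\<Sum>i\<in>UNIV. \<Sum>j\<in>UNIV. (u $ i * v $ j) *\<^sub>R christoffel G x (axis i 1) (axis j 1))"
proof -
  have "christoffel G x u v = (\<Sum>i\<in>UNIV. (u $ i) *\<^sub>R christoffel G x (axis i 1) v)"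
    by (rule linear_expansion[OF christoffel_linear1[OF x]])
  also have "\<dots> = (\<Sum>i\<in>UNIV. (u $ i) *\<^sub>R (\<Sum>j\<in>UNIV. (v $ j) *\<^sub>R christoffel G x (axis i 1) (axis j 1)))"
    by (subst linear_expansion[OF christoffel_linear2[OF x], of _ v]) (rule refl)
  finally show ?thesis by (simp add: scaleR_sum_right)
qed

text \<open>In Koszul's formula added to itself with v and w exchanged, all but one derivative of
  the metric cancels.\<close>

lemma metric_compatible:
  "x \<in> S \<Longrightarrow> bil (D G x u) v w = bil (G x) (christoffel G x u v) w + bil (G x) v (christoffel G x u w)"
  using g_sym[of x v "christoffel G x u w"] DG_sym[of x u v w] DG_sym[of x w u v] DG_sym[of x v u w]
  by (simp add: christoffel_lower field_simps)

lemma differentiable_christoffel: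
  assumes x: "x \<in> S"
  shows "(\<lambda>y. christoffel G y u v) differentiable (at x)"
  unfolding christoffel_def
proof (rule differentiable_matrix_inv_mult[OF _ _ open_S x inv_G])
  show "G differentiable (at x)" using smooth_on_differentiable smooth_G open_S x by blast
  have DG: "((\<lambda>y. D G y w) has_derivative D (\<lambda>y. D G y w) x) (at x)" for w
    using D_works smooth_on_differentiable[OF smooth_on_D[OF smooth_G] open_S x] by blast
  have "(\<lambda>y. bil (D G y u) v (axis l 1) + bil (D G y v) u (axis l 1) - bil (D G y (axis l 1)) u v)
      differentiable (at x)" for l
    by (intro differentiable_add differentiable_diff)
       (auto intro!: derivative_eq_intros DG differentiableI)
  then show "(\<lambda>y. \<chi> l. (bil (D G y u) v (axis l 1) + bil (D G y v) u (axis l 1) - bil (D G y (axis l 1)) u v) / 2)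
      differentiable (at x)"
    by (intro differentiable_vecI) (auto intro!: differentiable_divide)
qed

lemma has_derivative_christoffel:
  assumes x: "x \<in> S" and X: "(X has_derivative X') (at x)" and V: "(V has_derivative V') (at x)"
  shows "((\<lambda>y. christoffel G y (X y) (V y)) has_derivative
    (\<lambda>h. D (\<lambda>y. christoffel G y (X x) (V x)) x h + christoffel G x (X' h) (V x)
      + christoffel G x (X x) (V' h))) (at x)"
proof -
  let ?C = "\<lambda>i j y. christoffel G y (axis i 1) (axis j 1)"
  have main: "((\<lambda>y. christoffel G y (X y) (V y)) has_derivative
     (\<lambda>h. (\<Sum>i\<in>UNIV. \<Sum>j\<in>UNIV. (X x $ i * V x $ j) *\<^sub>R D (?C i j) x h) + christoffel G x (X' h) (V x)
      + christoffel G x (X x) (V' h))) (at x)"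
    if X: "(X has_derivative X') (at x)" and V: "(V has_derivative V') (at x)" for X X' V V'
  proof -
    have "((\<lambda>y. \<Sum>i\<in>UNIV. \<Sum>j\<in>UNIV. (X y $ i * V y $ j) *\<^sub>R ?C i j y) has_derivative
       (\<lambda>h. \<Sum>i\<in>UNIV. \<Sum>j\<in>UNIV. (X x $ i * V x $ j) *\<^sub>R D (?C i j) x h
          + (X x $ i * V' h $ j + X' h $ i * V x $ j) *\<^sub>R ?C i j x)) (at x)"
      by (intro has_derivative_sum has_derivative_scaleR has_derivative_vec_nth has_derivative_mult X V
          D_works differentiable_christoffel x)
    then have "((\<lambda>y. christoffel G y (X y) (V y)) has_derivative
       (\<lambda>h. \<Sum>i\<in>UNIV. \<Sum>j\<in>UNIV. (X x $ i * V x $ j) *\<^sub>R D (?C i j) x h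
          + (X x $ i * V' h $ j + X' h $ i * V x $ j) *\<^sub>R ?C i j x)) (at x)"
      by (rule has_derivative_transform_within_open[OF _ open_S x]) (rule christoffel_expansion[symmetric])
    then show ?thesis
      by (simp add: christoffel_expansion[OF x, of "X' _"] christoffel_expansion[OF x, of "X x" "V' _"]
        sum.distrib scaleR_add_left algebra_simps)
  qed
  have "D (\<lambda>y. christoffel G y (X x) (V x)) x h
      = (\<Sum>i\<in>UNIV. \<Sum>j\<in>UNIV. (X x $ i * V x $ j) *\<^sub>R D (?C i j) x h)" for h
    using D_eqI[OF main[OF has_derivative_const[of "X x"] has_derivative_const[of "V x"]]]
      linear_0[OF christoffel_linear1[OF x]] linear_0[OF christoffel_linear2[OF x]] by simp
  then show ?thesis using main[OF X V] by simp
qed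

lemma continuous_on_christoffel: "continuous_on S (\<lambda>y. christoffel G y u v)"
  by (intro continuous_at_imp_continuous_on ballI differentiable_imp_continuous_within
      differentiable_christoffel)

text \<open>The derivatives of \<open>X\<close> and \<open>Y\<close> cancel against the Lie bracket.
  This tensoriality is needed because \<xi> and \<nabla>\<xi> occur as arguments with nonconstant
  components.\<close>

lemma curvature_constant:
  assumes x: "x \<in> S" and X: "X differentiable (at x)" and Y: "Y differentiable (at x)"
  shows "curvature G X Y (\<lambda>_. v) x =
    D (\<lambda>y. christoffel G y (X x) v) x (Y x) - D (\<lambda>y. christoffel G y (Y x) v) x (X x)
    + christoffel G x (Y x) (christoffel G x (X x) v) - christoffel G x (X x) (christoffel G x (Y x) v)"
proof -
  have e: "nabla G X (\<lambda>_. v) = (\<lambda>y. christoffel G y (X y) v)" for X by (simp add: nabla_def fun_eq_iff)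
  have d: "D (\<lambda>y. christoffel G y (X y) v) x h
      = D (\<lambda>y. christoffel G y (X x) v) x h + christoffel G x (D X x h) v"
    if "X differentiable (at x)" for X h
    using D_eqI[OF has_derivative_christoffel[OF x D_works[OF that] has_derivative_const]]
      linear_0[OF christoffel_linear2[OF x]] by simp
  show ?thesis
    unfolding curvature_def e
    by (simp add: nabla_def d[OF X] d[OF Y] lie_bracket_def linear_diff[OF christoffel_linear1[OF x]])
qed

text \<open>The first and the last term of Koszul's formula have equal contractions because the
  inverse metric is symmetric; what remains is half the logarithmic derivative of the
  determinant.\<close>

lemma tr_christoffel:
  assumes x: "x \<in> S"
  shows "tr (\<lambda>u. christoffel G x u z) = trace (matrix_inv (G x) ** D G x z) / 2"
proof -
  interpret metric_tensor "G x" by (rule metric_tensor[OF x])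
  have "tr (\<lambda>u. christoffel G x u z) = metric_trace (G x) (\<lambda>u v. bil (G x) (christoffel G x u z) v)"
    by (rule metric_trace_bil[symmetric])
  also have "\<dots> = metric_trace (G x) (\<lambda>u v. bil (D G x u) z v) / 2
      + metric_trace (G x) (\<lambda>u v. bil (D G x z) u v) / 2 - metric_trace (G x) (\<lambda>u v. bil (D G x v) u z) / 2"
    by (simp add: christoffel_lower[OF x] metric_trace_def sum.distrib sum_subtractf sum_divide_distrib
        add_divide_distrib diff_divide_distrib ring_distribs)
  also have "metric_trace (G x) (\<lambda>u v. bil (D G x v) u z) = metric_trace (G x) (\<lambda>u v. bil (D G x u) z v)"
  proof -
    have "matrix_inv (G x) $ i $ j *\<^sub>R bil (D G x (axis j 1)) (axis i 1) z
        = matrix_inv (G x) $ j $ i *\<^sub>R bil (D G x (axis j 1)) z (axis i 1)" for i j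
      using matrix_inv_symmetric[of i j] DG_sym[OF x, of "axis j 1" "axis i 1" z] by simp
    then show ?thesis unfolding metric_trace_def by (subst sum.swap) (simp only:)
  qed
  also have "metric_trace (G x) (\<lambda>u v. bil (D G x z) u v) = trace (matrix_inv (G x) ** D G x z)"
  proof -
    have "bil M (axis i 1) (axis j 1) = M $ i $ j" for M :: "real ^ 'm ^ 'm" and i j
      by (simp add: bil_def matrix_vector_mult_basis column_def inner_axis')
    then have "bil (D G x z) (axis i 1) (axis j 1) = D G x z $ j $ i" for i j
      using DG_sym[OF x, of z "axis i 1" "axis j 1"] by simp
    then show ?thesis
      by (simp add: metric_trace_def trace_def matrix_matrix_mult_def)
  qed
  finally show ?thesis by simp
qed

lemma volume_density_deriv:
  assumes x: "x \<in> S"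
  shows "((\<lambda>y. sqrt \<bar>det (G y)\<bar>) has_derivative
    (\<lambda>h. sqrt \<bar>det (G x)\<bar> * tr (\<lambda>u. christoffel G x u h))) (at x)"
proof -
  have nz: "det (G x) \<noteq> 0" using inv_G[OF x] invertible_det_nz by blast
  let ?d = "det (G x)" and ?t = "\<lambda>h. trace (matrix_inv (G x) ** D G x h)"
  \<comment> \<open>The absolute value of the determinant is treated as the root of its square,
    which avoids a distinction by sign: in indefinite signature the determinant may be
    negative.\<close>
  have "((\<lambda>y. (det (G y))\<^sup>2) has_derivative (\<lambda>h. 2 * ?d * (?d * ?t h))) (at x)"
    by (rule derivative_eq_intros has_derivative_det[OF G_works inv_G] x refl)+ (simp add: fun_eq_iff)
  then have "((\<lambda>y. sqrt (sqrt ((det (G y))\<^sup>2))) has_derivative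
      (\<lambda>h. 2 * ?d * (?d * ?t h) * (inverse (sqrt (?d\<^sup>2)) / 2) * (inverse (sqrt (sqrt (?d\<^sup>2))) / 2))) (at x)"
    using nz by (intro has_derivative_real_sqrt) auto
  moreover have e: "2 * ?d * (?d * t) * (inverse (sqrt (?d\<^sup>2)) / 2) * (inverse (sqrt (sqrt (?d\<^sup>2))) / 2)
      = sqrt \<bar>?d\<bar> * (t / 2)" for t
  proof -
    have "?d * ?d = \<bar>?d\<bar> * (sqrt \<bar>?d\<bar> * sqrt \<bar>?d\<bar>)" by simp
    then have "?d * ?d * (inverse \<bar>?d\<bar> * inverse (sqrt \<bar>?d\<bar>)) = sqrt \<bar>?d\<bar>" using nz by (simp add: field_simps)
    moreover have "2 * a * (a * t) * (u / 2) * (w / 2) = (a * a * (u * w)) * (t / 2)" for a u w :: real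
      by (simp add: algebra_simps)
    ultimately show ?thesis by (simp only: real_sqrt_abs)
  qed
  ultimately show ?thesis by (simp only: tr_christoffel[OF x] e) (simp only: real_sqrt_abs)
qed

end

section \<open>First and second covariant derivatives of a vector field\<close>

definition covd ::
    "(real ^ 'm \<Rightarrow> real ^ 'm ^ 'm) \<Rightarrow> (real ^ 'm \<Rightarrow> real ^ 'm) \<Rightarrow> real ^ 'm \<Rightarrow> real ^ 'm \<Rightarrow> real ^ 'm::finite" where
  "covd G V x u = D V x u + christoffel G x u (V x)"

text \<open>The tensor (\<nabla>_u \<nabla>V) v. The last term removes the contribution of the
  extension of v by constant components, whose covariant derivative along u is
  \<open>christoffel G x u v\<close>.\<close>

definition covd2 ::
    "(real ^ 'm \<Rightarrow> real ^ 'm ^ 'm) \<Rightarrow> (real ^ 'm \<Rightarrow> real ^ 'm) \<Rightarrow> real ^ 'm \<Rightarrow> real ^ 'm \<Rightarrow> real ^ 'm \<Rightarrow> real ^ 'm::finite" where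
  "covd2 G V x u v = D (\<lambda>y. covd G V y v) x u + christoffel G x u (covd G V x v)
     - covd G V x (christoffel G x u v)"

lemma nabla_covd: "nabla G X V x = covd G V x (X x)"
  by (simp add: nabla_def covd_def)

context chart_metric
begin

lemma covd_linear: "\<lbrakk>x \<in> S; V differentiable (at x)\<rbrakk> \<Longrightarrow> linear (covd G V x)"
  using linear_compose_add[OF D_linear christoffel_linear1] by (auto simp: covd_def[abs_def])

lemma has_derivative_covd:
  assumes x: "x \<in> S" and V: "smooth_on S V" and X: "(X has_derivative X') (at x)"
  shows "((\<lambda>y. covd G V y (X y)) has_derivative
    (\<lambda>h. D (\<lambda>y. covd G V y (X x)) x h + covd G V x (X' h))) (at x)"
proof -
  have dV: "V differentiable (at x)" by (rule smooth_on_differentiable[OF V open_S x])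
  have main: "((\<lambda>y. covd G V y (X y)) has_derivative
    (\<lambda>h. (D (\<lambda>y. D V y (X x)) x h + D V x (X' h)) +
      (D (\<lambda>y. christoffel G y (X x) (V x)) x h + christoffel G x (X' h) (V x)
      + christoffel G x (X x) (D V x h)))) (at x)"
    if X: "(X has_derivative X') (at x)" for X X'
    unfolding covd_def
    by (intro has_derivative_add has_derivative_D_moving[OF V open_S x]
        has_derivative_christoffel[OF x] X D_works dV)
  have "D (\<lambda>y. covd G V y (X x)) x h = D (\<lambda>y. D V y (X x)) x h +
      (D (\<lambda>y. christoffel G y (X x) (V x)) x h + christoffel G x (X x) (D V x h))" for h
    using D_eqI[OF main[OF has_derivative_const[of "X x"]]]
      linear_0[OF christoffel_linear1[OF x]] linear_0[OF D_linear[OF dV]] by simp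
  then show ?thesis using main[OF X] by (simp add: covd_def algebra_simps)
qed

lemma differentiable_covd: "\<lbrakk>x \<in> S; smooth_on S V; X differentiable (at x)\<rbrakk>
    \<Longrightarrow> (\<lambda>y. covd G V y (X y)) differentiable (at x)"
  by (rule differentiableI[OF has_derivative_covd[OF _ _ D_works]])

lemma covd2_eq:
  assumes x: "x \<in> S" and V: "smooth_on S V"
  shows "covd2 G V x u v = D (\<lambda>y. D V y v) x u + D (\<lambda>y. christoffel G y v (V x)) x u
    + christoffel G x v (D V x u) + christoffel G x u (D V x v + christoffel G x v (V x))
    - D V x (christoffel G x u v) - christoffel G x (christoffel G x u v) (V x)"
proof -
  have "((\<lambda>y. covd G V y v) has_derivative (\<lambda>h. D (\<lambda>y. D V y v) x h +
      (D (\<lambda>y. christoffel G y v (V x)) x h + christoffel G x 0 (V x) + christoffel G x v (D V x h)))) (at x)"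
    unfolding covd_def
    by (intro has_derivative_add D_works smooth_on_differentiable[OF smooth_on_D[OF V] open_S x]
        has_derivative_christoffel[OF x] has_derivative_const smooth_on_differentiable[OF V open_S x])
  from D_eqI[OF this] show ?thesis
    by (simp add: covd2_def covd_def linear_0[OF christoffel_linear1[OF x]])
qed

lemma covd2_linear1:
  assumes x: "x \<in> S" and V: "smooth_on S V"
  shows "linear (\<lambda>u. covd2 G V x u v)"
  unfolding covd2_def
  by (intro linear_compose_sub linear_compose_add D_linear differentiable_covd x V
      christoffel_linear1 differentiable_const linear_compose[OF christoffel_linear1 covd_linear, unfolded o_def]
      smooth_on_differentiable[OF V open_S x])

lemma covd2_linear2:
  assumes x: "x \<in> S" and V: "smooth_on S V"
  shows "linear (covd2 G V x u)"
proof -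
  have dV: "V differentiable (at y)" if "y \<in> S" for y by (rule smooth_on_differentiable[OF V open_S that])
  have d: "((\<lambda>y. covd G V y v) has_derivative D (\<lambda>y. covd G V y v) x) (at x)" for v
    by (intro D_works differentiable_covd x V differentiable_const)
  have "D (\<lambda>y. covd G V y (v + w)) x u = D (\<lambda>y. covd G V y v) x u + D (\<lambda>y. covd G V y w) x u" for v w
    by (subst D_cong_open[OF open_S x, of _ "\<lambda>y. covd G V y v + covd G V y w"])
      (auto simp: linear_add[OF covd_linear[OF _ dV]] D_eqI[OF has_derivative_add[OF d d]])
  moreover have "D (\<lambda>y. covd G V y (r *\<^sub>R v)) x u = r *\<^sub>R D (\<lambda>y. covd G V y v) x u" for r v
    by (subst D_cong_open[OF open_S x, of _ "\<lambda>y. r *\<^sub>R covd G V y v"])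
      (auto simp: linear_scale[OF covd_linear[OF _ dV]] D_eqI[OF has_derivative_scaleR_right[OF d]])
  ultimately show ?thesis
    unfolding covd2_def
    by (intro linearI) (simp_all add: linear_add[OF covd_linear[OF x dV[OF x]]] linear_scale[OF covd_linear[OF x dV[OF x]]]
      linear_add[OF christoffel_linear2[OF x]] linear_scale[OF christoffel_linear2[OF x]] algebra_simps)
qed

end

text \<open>The device by which identities are differentiated below: the difference of both sides is
  a constant function of the point, and the derivative computed by the rules must therefore
  vanish.\<close>

lemma D_eq_zero:
  assumes "open S" "x \<in> S" "\<And>y. y \<in> S \<Longrightarrow> f y = c" "(f has_derivative f') (at x)"
  shows "f' h = 0"
  using D_cong_open[OF assms(1,2), of f "\<lambda>_. c"] assms(3) D_eqI[OF assms(4)] by simp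

section \<open>Killing fields\<close>

locale chart_killing = chart_metric S G for S :: "(real ^ 'm::finite) set" and G +
  fixes \<xi> :: "real ^ 'm \<Rightarrow> real ^ 'm"
  assumes smooth_\<xi>: "smooth_on S \<xi>"
    and killing: "x \<in> S \<Longrightarrow> bil (D G x (\<xi> x)) u v + bil (G x) (D \<xi> x u) v + bil (G x) u (D \<xi> x v) = 0"
begin

abbreviation "\<Gamma> \<equiv> christoffel G"

lemma diff_\<xi>: "x \<in> S \<Longrightarrow> \<xi> differentiable (at x)"
  by (rule smooth_on_differentiable[OF smooth_\<xi> open_S])

text \<open>The flow of a Killing field preserves the Levi-Civita connection.\<close>

lemma lie_christoffel:
  assumes x: "x \<in> S"
  shows "D (\<lambda>y. D \<xi> y v) x u + D (\<lambda>y. \<Gamma> y u v) x (\<xi> x) + \<Gamma> x (D \<xi> x u) v + \<Gamma> x u (D \<xi> x v)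
    - D \<xi> x (\<Gamma> x u v) = 0"
proof (rule g_nondegenerate[OF x])
  fix w
  have D2G: "((\<lambda>y. D G y a) has_derivative D (\<lambda>y. D G y a) x) (at x)" for a
    by (rule D_works[OF smooth_on_differentiable[OF smooth_on_D[OF smooth_G] open_S x]])
  have D2\<xi>: "((\<lambda>y. D \<xi> y a) has_derivative D (\<lambda>y. D \<xi> y a) x) (at x)" for a
    by (rule D_works[OF smooth_on_differentiable[OF smooth_on_D[OF smooth_\<xi>] open_S x]])
  let ?H = "\<lambda>l. D (\<lambda>y. D G y (\<xi> x)) x l"
  \<comment> \<open>The Killing equation differentiated in direction l.\<close>
  have E: "bil (?H l) u v + bil (D G x (D \<xi> x l)) u v
      + bil (D G x l) (D \<xi> x u) v + bil (G x) (D (\<lambda>y. D \<xi> y u) x l) v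
      + bil (D G x l) u (D \<xi> x v) + bil (G x) u (D (\<lambda>y. D \<xi> y v) x l) = 0" for l u v
  proof -
    have "((\<lambda>y. bil (D G y (\<xi> y)) u v + bil (G y) (D \<xi> y u) v + bil (G y) u (D \<xi> y v)) has_derivative
      (\<lambda>l. (bil (?H l + D G x (D \<xi> x l)) u v + bil (D G x (\<xi> x)) 0 v + bil (D G x (\<xi> x)) u 0)
      + (bil (D G x l) (D \<xi> x u) v + bil (G x) (D (\<lambda>y. D \<xi> y u) x l) v + bil (G x) (D \<xi> x u) 0)
      + (bil (D G x l) u (D \<xi> x v) + bil (G x) 0 (D \<xi> x v) + bil (G x) u (D (\<lambda>y. D \<xi> y v) x l)))) (at x)"
      by (intro has_derivative_add has_derivative_bil has_derivative_D_moving[OF smooth_G open_S x]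
          has_derivative_const D_works diff_\<xi> x D2\<xi> G_works)
    from D_eq_zero[OF open_S x killing this, of l] show ?thesis by (simp add: bil_matrix_simps)
  qed
  \<comment> \<open>Since second derivatives of \<open>G\<close> commute, differentiating Koszul's
    formula along \<xi> produces the same terms \<open>?H\<close> as differentiating the Killing
    equation.\<close>
  have Hs: "D (\<lambda>y. D G y a) x (\<xi> x) = ?H a" for a
    by (rule smooth_on_D_D_symmetric[OF smooth_G open_S x])
  have Hsym: "bil (?H l) a b = bil (?H l) b a" for l a b
  proof -
    have "((\<lambda>y. bil (D G y (\<xi> x)) a b - bil (D G y (\<xi> x)) b a) has_derivative
       (\<lambda>l. (bil (?H l) a b + bil (D G x (\<xi> x)) 0 b + bil (D G x (\<xi> x)) a 0)
          - (bil (?H l) b a + bil (D G x (\<xi> x)) 0 a + bil (D G x (\<xi> x)) b 0))) (at x)"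
      by (intro has_derivative_diff has_derivative_bil D2G has_derivative_const)
    from D_eq_zero[OF open_S x _ this, of 0 l] show ?thesis
      using DG_sym[of _ "\<xi> x" a b] by simp
  qed
  have L: "bil (D G x (\<xi> x)) (\<Gamma> x u v) w + bil (G x) (D (\<lambda>y. \<Gamma> y u v) x (\<xi> x)) w
      = (bil (?H u) v w + bil (?H v) u w - bil (?H w) u v) / 2"
  proof -
    have "((\<lambda>y. 2 * bil (G y) (\<Gamma> y u v) w - (bil (D G y u) v w + bil (D G y v) u w - bil (D G y w) u v))
      has_derivative (\<lambda>h. 2 * (bil (D G x h) (\<Gamma> x u v) w + bil (G x) (D (\<lambda>y. \<Gamma> y u v) x h) w + bil (G x) (\<Gamma> x u v) 0)
       - ((bil (D (\<lambda>y. D G y u) x h) v w + bil (D G x u) 0 w + bil (D G x u) v 0)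
        + (bil (D (\<lambda>y. D G y v) x h) u w + bil (D G x v) 0 w + bil (D G x v) u 0)
        - (bil (D (\<lambda>y. D G y w) x h) u v + bil (D G x w) 0 v + bil (D G x w) u 0)))) (at x)"
      by (intro has_derivative_diff has_derivative_add has_derivative_mult_right has_derivative_bil D2G G_works x
          has_derivative_const D_works differentiable_christoffel)
    from D_eq_zero[OF open_S x _ this, of 0 "\<xi> x"] show ?thesis
      by (simp add: christoffel_lower Hs)
  qed
  have D2s: "D (\<lambda>y. D \<xi> y a) x b = D (\<lambda>y. D \<xi> y b) x a" for a b
    by (rule smooth_on_D_D_symmetric[OF smooth_\<xi> open_S x])
  note K = killing[OF x, of "\<Gamma> x u v" w]
  note cl = christoffel_lower[OF x]
  show "bil (G x) (D (\<lambda>y. D \<xi> y v) x u + D (\<lambda>y. \<Gamma> y u v) x (\<xi> x) + \<Gamma> x (D \<xi> x u) v + \<Gamma> x u (D \<xi> x v)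
      - D \<xi> x (\<Gamma> x u v)) w = bil (G x) 0 w"
    \<comment> \<open>Half of \<open>E\<close> at (u, v, w) plus \<open>E\<close> at (v, u, w) minus
      \<open>E\<close> at (w, u, v) is Koszul's combination. \<open>L\<close> rewrites its second
      derivatives of the metric, and \<open>K\<close> trades the derivative of the metric along
      \<xi> for derivatives of \<xi>.\<close>
    using E[of u v w] E[of v u w] E[of w u v] L K cl[of u v "D \<xi> x w"]
      cl[of "D \<xi> x u" v w] cl[of u "D \<xi> x v" w]
      g_sym[OF x, of u "D (\<lambda>y. D \<xi> y v) x w"] g_sym[OF x, of u "D (\<lambda>y. D \<xi> y w) x v"]
      g_sym[OF x, of v "D (\<lambda>y. D \<xi> y w) x u"]
      D2s[of v u] D2s[of u w] D2s[of v w]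
      DG_sym[OF x, of u v "D \<xi> x w"] DG_sym[OF x, of v "D \<xi> x u" w] DG_sym[OF x, of u "D \<xi> x v" w]
      DG_sym[OF x, of w "D \<xi> x u" v]
    by simp argo
qed

text \<open>The left side is R_{\<xi>u} v in coordinates. Invariance of the connection under the
  flow of \<xi> exchanges the derivative of \<Gamma> along \<xi> for second derivatives of \<xi>,
  which are those in \<open>covd2_eq\<close>.\<close>

lemma covd2_killing:
  assumes x: "x \<in> S"
  shows "D (\<lambda>y. \<Gamma> y (\<xi> x) v) x u - D (\<lambda>y. \<Gamma> y u v) x (\<xi> x)
    + \<Gamma> x u (\<Gamma> x (\<xi> x) v) - \<Gamma> x (\<xi> x) (\<Gamma> x u v) = covd2 G \<xi> x u v"
proof -
  have "D (\<lambda>y. \<Gamma> y (\<xi> x) v) x u = D (\<lambda>y. \<Gamma> y v (\<xi> x)) x u"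
    by (rule D_cong_open[OF open_S x, THEN fun_cong]) (rule christoffel_sym)
  then show ?thesis
    using lie_christoffel[OF x, of v u]
    unfolding covd2_eq[OF x smooth_\<xi>]
    by (simp add: linear_add[OF christoffel_linear2[OF x]] christoffel_sym[OF x, of "\<xi> x"]
        christoffel_sym[OF x, of "D \<xi> x u" v] algebra_simps)
qed

text \<open>The first form, with the field \<xi> in the second slot, serves the harmonic map
  condition; the second, with \<xi> frozen at x, matches the definition of
  \<open>ricci\<close>.\<close>

lemma curvature_killing:
  assumes x: "x \<in> S" and X: "X differentiable (at x)"
  shows "curvature G X \<xi> (\<lambda>_. v) x = - covd2 G \<xi> x (X x) v"
    and "curvature G (\<lambda>_. \<xi> x) X (\<lambda>_. v) x = covd2 G \<xi> x (X x) v"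
  unfolding curvature_constant[OF x X diff_\<xi>[OF x]] curvature_constant[OF x differentiable_const X]
    covd2_killing[OF x, of v "X x", symmetric] by simp_all

lemma covd_skew:
  assumes x: "x \<in> S"
  shows "bil (G x) (covd G \<xi> x u) v = - bil (G x) u (covd G \<xi> x v)"
  using killing[OF x, of u v] metric_compatible[OF x, of "\<xi> x" u v]
  by (simp add: covd_def christoffel_sym[OF x, of "\<xi> x"])

text \<open>The metric is parallel, so skewness of \<nabla>\<xi> passes to its covariant
  derivative.\<close>

lemma covd2_skew:
  assumes x: "x \<in> S"
  shows "bil (G x) (covd2 G \<xi> x u v) w = - bil (G x) v (covd2 G \<xi> x u w)"
proof -
  have dS: "((\<lambda>y. covd G \<xi> y a) has_derivative D (\<lambda>y. covd G \<xi> y a) x) (at x)" for a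
    by (intro D_works differentiable_covd x smooth_\<xi> differentiable_const)
  have "((\<lambda>y. bil (G y) (covd G \<xi> y v) w + bil (G y) v (covd G \<xi> y w)) has_derivative
     (\<lambda>h. (bil (D G x h) (covd G \<xi> x v) w + bil (G x) (D (\<lambda>y. covd G \<xi> y v) x h) w + bil (G x) (covd G \<xi> x v) 0)
       + (bil (D G x h) v (covd G \<xi> x w) + bil (G x) 0 (covd G \<xi> x w) + bil (G x) v (D (\<lambda>y. covd G \<xi> y w) x h)))) (at x)"
    by (intro has_derivative_add has_derivative_bil dS has_derivative_const G_works x)
  from D_eq_zero[OF open_S x _ this, of 0 u]
  have "bil (D G x u) (covd G \<xi> x v) w + bil (G x) (D (\<lambda>y. covd G \<xi> y v) x u) w
      + bil (D G x u) v (covd G \<xi> x w) + bil (G x) v (D (\<lambda>y. covd G \<xi> y w) x u) = 0"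
    using covd_skew by simp
  then show ?thesis
    using covd_skew[OF x, of v "\<Gamma> x u w"] covd_skew[OF x, of "\<Gamma> x u v" w]
    by (simp add: covd2_def metric_compatible[OF x])
qed

end

section \<open>K-paracontact structures in a chart\<close>

locale chart_K_paracontact = chart_killing S G \<xi> for S :: "(real ^ 'm::finite) set" and G \<xi> +
  fixes \<eta> :: "real ^ 'm \<Rightarrow> real ^ 'm" and \<phi> :: "real ^ 'm \<Rightarrow> real ^ 'm ^ 'm"
  assumes smooth_\<eta>: "smooth_on S \<eta>"
    and unit: "x \<in> S \<Longrightarrow> bil (G x) (\<xi> x) (\<xi> x) = 1"
    and dual: "x \<in> S \<Longrightarrow> \<eta> x \<bullet> u = bil (G x) (\<xi> x) u"
    and d_\<eta>: "x \<in> S \<Longrightarrow> ext_d \<eta> (\<lambda>_. u) (\<lambda>_. v) x = bil (G x) u (\<phi> x *v v)"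
    and \<phi>_\<phi>: "x \<in> S \<Longrightarrow> \<phi> x *v (\<phi> x *v u) = u - (\<eta> x \<bullet> u) *\<^sub>R \<xi> x"
begin

lemma diff_\<eta>: "x \<in> S \<Longrightarrow> \<eta> differentiable (at x)"
  by (rule smooth_on_differentiable[OF smooth_\<eta> open_S])

lemma D_\<eta>:
  assumes x: "x \<in> S"
  shows "D \<eta> x u \<bullet> v = bil (G x) (covd G \<xi> x u) v + \<eta> x \<bullet> \<Gamma> x u v"
proof -
  have "((\<lambda>y. \<eta> y \<bullet> v - bil (G y) (\<xi> y) v) has_derivative
     (\<lambda>h. D \<eta> x h \<bullet> v - (bil (D G x h) (\<xi> x) v + bil (G x) (D \<xi> x h) v + bil (G x) (\<xi> x) 0))) (at x)"
    by (intro has_derivative_diff has_derivative_inner_left has_derivative_bil D_works diff_\<eta> diff_\<xi> x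
        G_works has_derivative_const)
  from D_eq_zero[OF open_S x _ this, of 0 u] show ?thesis
    by (simp add: dual x covd_def metric_compatible[OF x])
qed

lemma ext_d_\<eta>: "ext_d \<eta> (\<lambda>_. u) (\<lambda>_. v) x = (D \<eta> x u \<bullet> v - D \<eta> x v \<bullet> u) / 2" if x: "x \<in> S"
  by (simp add: ext_d_def lie_bracket_def D_inner_left[OF diff_\<eta>[OF x]])

lemma covd_\<eta>: "D \<eta> x u \<bullet> v - D \<eta> x v \<bullet> u = 2 * bil (G x) (covd G \<xi> x u) v" if x: "x \<in> S"
  using covd_skew[OF x, of u v] g_sym[OF x, of "covd G \<xi> x v" u]
  by (simp add: D_\<eta>[OF x] christoffel_sym[OF x, of v u])

text \<open>The factor 1/2 in \<open>ext_d\<close> cancels the 2 in \<open>covd_\<eta>\<close>,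
  whence g(w, \<phi> v) = g(\<nabla>_w \<xi>, v) = -g(w, \<nabla>_v \<xi>).\<close>

lemma covd_\<xi>: "covd G \<xi> x v = - (\<phi> x *v v)" if x: "x \<in> S"
proof (rule g_nondegenerate[OF x])
  fix w
  show "bil (G x) (covd G \<xi> x v) w = bil (G x) (- (\<phi> x *v v)) w"
    using d_\<eta>[OF x, of w v] covd_\<eta>[OF x, of w v] covd_skew[OF x, of w v]
      g_sym[OF x, of w "covd G \<xi> x v"] g_sym[OF x, of w "\<phi> x *v v"]
    by (simp add: ext_d_\<eta>[OF x])
qed

lemma covd_covd: "covd G \<xi> x (covd G \<xi> x u) = u - bil (G x) (\<xi> x) u *\<^sub>R \<xi> x" if x: "x \<in> S"
  using \<phi>_\<phi>[OF x, of u] by (simp add: covd_\<xi>[OF x] dual[OF x] linear_neg[OF matrix_vector_mul_linear])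

text \<open>Unit length makes every \<nabla>_w \<xi> orthogonal to \<xi>; by skewness \<nabla>_\<xi>
  \<xi> is then orthogonal to every w.\<close>

lemma covd_along_\<xi>: "covd G \<xi> x (\<xi> x) = 0" if x: "x \<in> S"
proof (rule g_nondegenerate[OF x])
  fix w
  have "((\<lambda>y. bil (G y) (\<xi> y) (\<xi> y)) has_derivative
     (\<lambda>h. bil (D G x h) (\<xi> x) (\<xi> x) + bil (G x) (D \<xi> x h) (\<xi> x) + bil (G x) (\<xi> x) (D \<xi> x h))) (at x)"
    by (intro has_derivative_bil G_works x D_works diff_\<xi>)
  from D_eq_zero[OF open_S x unit this, of w]
  have "bil (G x) (covd G \<xi> x w) (\<xi> x) = 0"
    using g_sym[OF x, of "\<xi> x" "D \<xi> x w"] g_sym[OF x, of "\<xi> x" "\<Gamma> x w (\<xi> x)"]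
    by (simp add: metric_compatible[OF x] covd_def)
  then show "bil (G x) (covd G \<xi> x (\<xi> x)) w = bil (G x) 0 w"
    using covd_skew[OF x, of w "\<xi> x"] g_sym[OF x, of w "covd G \<xi> x (\<xi> x)"] by simp
qed

lemma covd2_covd:
  assumes x: "x \<in> S"
  shows "covd2 G \<xi> x u (covd G \<xi> x v) + covd G \<xi> x (covd2 G \<xi> x u v)
    = - bil (G x) (covd G \<xi> x u) v *\<^sub>R \<xi> x - bil (G x) (\<xi> x) v *\<^sub>R covd G \<xi> x u"
proof -
  have dS: "((\<lambda>y. covd G \<xi> y a) has_derivative D (\<lambda>y. covd G \<xi> y a) x) (at x)" for a
    by (intro D_works differentiable_covd x smooth_\<xi> differentiable_const)
  have "((\<lambda>y. covd G \<xi> y (covd G \<xi> y v) - (v - (\<eta> y \<bullet> v) *\<^sub>R \<xi> y)) has_derivative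
     (\<lambda>h. (D (\<lambda>y. covd G \<xi> y (covd G \<xi> x v)) x h + covd G \<xi> x (D (\<lambda>y. covd G \<xi> y v) x h))
        - (0 - ((\<eta> x \<bullet> v) *\<^sub>R D \<xi> x h + (D \<eta> x h \<bullet> v) *\<^sub>R \<xi> x)))) (at x)"
    by (intro has_derivative_diff has_derivative_covd[OF x smooth_\<xi>] dS has_derivative_const
        has_derivative_scaleR has_derivative_inner_left D_works diff_\<eta> diff_\<xi> x)
  from D_eq_zero[OF open_S x _ this, of 0 u]
  have 1: "D (\<lambda>y. covd G \<xi> y (covd G \<xi> x v)) x u + covd G \<xi> x (D (\<lambda>y. covd G \<xi> y v) x u)
      + (\<eta> x \<bullet> v) *\<^sub>R D \<xi> x u + (D \<eta> x u \<bullet> v) *\<^sub>R \<xi> x = 0"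
    by (simp add: covd_covd dual)
  note lin = covd_linear[OF x diff_\<xi>[OF x]]
  \<comment> \<open>\<open>1\<close> relates partial derivatives only. In the sum of
    \<open>2\<close> and \<open>3\<close> the terms in
    \<open>\<Gamma> x u (covd G \<xi> x v)\<close> and \<open>\<Gamma> x u v\<close> cancel, and the
    remaining Christoffel terms complete the derivatives of \<xi> and \<eta> to covariant
    ones.\<close>
  have 2: "covd G \<xi> x (covd2 G \<xi> x u v) = covd G \<xi> x (D (\<lambda>y. covd G \<xi> y v) x u)
      + covd G \<xi> x (\<Gamma> x u (covd G \<xi> x v)) - (\<Gamma> x u v - (\<eta> x \<bullet> \<Gamma> x u v) *\<^sub>R \<xi> x)"
    by (simp add: covd2_def linear_add[OF lin] linear_diff[OF lin] covd_covd[OF x] dual[OF x])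
  have 3: "covd2 G \<xi> x u (covd G \<xi> x v) = D (\<lambda>y. covd G \<xi> y (covd G \<xi> x v)) x u
      + (\<Gamma> x u v - (\<eta> x \<bullet> v) *\<^sub>R \<Gamma> x u (\<xi> x)) - covd G \<xi> x (\<Gamma> x u (covd G \<xi> x v))"
    unfolding covd2_def covd_covd[OF x] dual[OF x]
    by (simp add: linear_diff[OF christoffel_linear2[OF x]] linear_scale[OF christoffel_linear2[OF x]])
  have 4: "covd G \<xi> x u = D \<xi> x u + \<Gamma> x u (\<xi> x)" by (simp add: covd_def)
  have "covd2 G \<xi> x u (covd G \<xi> x v) + covd G \<xi> x (covd2 G \<xi> x u v)
      = - ((\<eta> x \<bullet> v) *\<^sub>R D \<xi> x u + (D \<eta> x u \<bullet> v) *\<^sub>R \<xi> x) - (\<eta> x \<bullet> v) *\<^sub>R \<Gamma> x u (\<xi> x) + (\<eta> x \<bullet> \<Gamma> x u v) *\<^sub>R \<xi> x"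
    using 1 unfolding 2 3 by (simp add: algebra_simps eq_neg_iff_add_eq_0)
  also have "\<dots> = - bil (G x) (covd G \<xi> x u) v *\<^sub>R \<xi> x - (\<eta> x \<bullet> v) *\<^sub>R covd G \<xi> x u"
    unfolding D_\<eta>[OF x] by (simp add: 4 algebra_simps)
  finally show ?thesis by (simp only: dual[OF x])
qed

text \<open>This is d(d\<eta>) = 0 for d\<eta>(v, w) = g(\<nabla>_v \<xi>, w). In the cyclic sum of
  \<open>E\<close> the second derivatives of \<eta> cancel by symmetry, the Christoffel terms by
  symmetry of \<Gamma> and skewness of \<nabla>\<xi>.\<close>

lemma covd2_cyclic:
  assumes x: "x \<in> S"
  shows "bil (G x) (covd2 G \<xi> x u v) w + bil (G x) (covd2 G \<xi> x v w) u + bil (G x) (covd2 G \<xi> x w u) v = 0"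
proof -
  have dS: "((\<lambda>y. covd G \<xi> y a) has_derivative D (\<lambda>y. covd G \<xi> y a) x) (at x)" for a
    by (intro D_works differentiable_covd x smooth_\<xi> differentiable_const)
  have d\<eta>: "((\<lambda>y. D \<eta> y a) has_derivative D (\<lambda>y. D \<eta> y a) x) (at x)" for a
    by (rule D_works[OF smooth_on_differentiable[OF smooth_on_D[OF smooth_\<eta>] open_S x]])
  have E: "D (\<lambda>y. D \<eta> y v) x u \<bullet> w - D (\<lambda>y. D \<eta> y w) x u \<bullet> v
     = 2 * (bil (G x) (covd2 G \<xi> x u v) w + bil (G x) (covd G \<xi> x (\<Gamma> x u v)) w
            + bil (G x) (covd G \<xi> x v) (\<Gamma> x u w))" for u v w
  proof -
    have "((\<lambda>y. (D \<eta> y v \<bullet> w - D \<eta> y w \<bullet> v) - 2 * bil (G y) (covd G \<xi> y v) w) has_derivative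
       (\<lambda>h. (D (\<lambda>y. D \<eta> y v) x h \<bullet> w - D (\<lambda>y. D \<eta> y w) x h \<bullet> v)
          - 2 * (bil (D G x h) (covd G \<xi> x v) w + bil (G x) (D (\<lambda>y. covd G \<xi> y v) x h) w
            + bil (G x) (covd G \<xi> x v) 0))) (at x)"
      by (intro has_derivative_diff has_derivative_mult_right has_derivative_inner_left has_derivative_bil
          d\<eta> dS has_derivative_const G_works x)
    from D_eq_zero[OF open_S x _ this, of 0 u] show ?thesis
      by (simp add: covd_\<eta> covd2_def metric_compatible[OF x])
  qed
  have Q: "D (\<lambda>y. D \<eta> y a) x b = D (\<lambda>y. D \<eta> y b) x a" for a b
    by (rule smooth_on_D_D_symmetric[OF smooth_\<eta> open_S x])
  show ?thesis
    using E[where u = u and v = v and w = w] E[where u = v and v = w and w = u]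
      E[where u = w and v = u and w = v] Q[of u v] Q[of v w] Q[of u w]
      covd_skew[OF x, of "\<Gamma> x u v" w] covd_skew[OF x, of "\<Gamma> x v w" u] covd_skew[OF x, of "\<Gamma> x u w" v]
      g_sym[OF x, of "\<Gamma> x u v" "covd G \<xi> x w"] g_sym[OF x, of "\<Gamma> x v w" "covd G \<xi> x u"]
      g_sym[OF x, of "\<Gamma> x u w" "covd G \<xi> x v"]
      christoffel_sym[OF x, of u v] christoffel_sym[OF x, of v w] christoffel_sym[OF x, of u w]
    by simp
qed

lemma traces_covd2:
  assumes x: "x \<in> S"
  shows "tr (\<lambda>u. covd2 G \<xi> x u v) = - (CARD('m) - 1) * bil (G x) (\<xi> x) v"
    and "metric_trace (G x) (\<lambda>u v. covd2 G \<xi> x (covd G \<xi> x u) v) = 0"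
proof -
  interpret metric_tensor "G x" by (rule metric_tensor[OF x])
  note facts = covd_linear[OF x diff_\<xi>[OF x]] covd2_linear1[OF x smooth_\<xi>] covd2_linear2[OF x smooth_\<xi>]
    unit[OF x] covd_skew[OF x] covd_covd[OF x] covd2_skew[OF x] covd2_covd[OF x] covd2_cyclic[OF x]
    covd_along_\<xi>[OF x]
  show "tr (\<lambda>u. covd2 G \<xi> x u v) = - (CARD('m) - 1) * bil (G x) (\<xi> x) v"
    by (rule tr_N[OF facts])
  show "metric_trace (G x) (\<lambda>u v. covd2 G \<xi> x (covd G \<xi> x u) v) = 0"
    by (rule metric_trace_N_S[OF facts])
qed

text \<open>For u = \<xi> the curvature in \<open>ricci\<close> is \<nabla>^2 \<xi>, so
  \<open>ricci\<close> is the first trace of \<open>traces_covd2\<close>; the factor 2n is the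
  dimension minus one.\<close>

lemma ricci_op_\<xi>:
  assumes x: "x \<in> S" and n: "CARD('m) = 2 * n + 1"
  shows "ricci_op G x (\<xi> x) = - (2 * real n) *\<^sub>R \<xi> x"
proof -
  interpret metric_tensor "G x" by (rule metric_tensor[OF x])
  have "ricci G x (\<xi> x) v = - (2 * real n) * bil (G x) (\<xi> x) v" for v
    using traces_covd2(1)[OF x, of v] n
    by (simp add: ricci_def curvature_killing(2)[OF x differentiable_const] tr_def)
  then have "(\<chi> j. ricci G x (\<xi> x) (axis j 1)) = - (2 * real n) *\<^sub>R (G x *v \<xi> x)"
    by (simp add: vec_eq_iff bil_eq_inner inner_axis)
  then show ?thesis
    unfolding ricci_op_def by (simp add: matrix_vector_mult_scaleR matrix_inv_vec[OF invB]
      linear_neg[OF matrix_vector_mul_linear])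
qed

text \<open>Putting X = \<nabla>_u \<xi> into the curvature identity gives minus the second trace of
  \<open>traces_covd2\<close>.\<close>

lemma harmonic_map_trace:
  assumes x: "x \<in> S"
  shows "metric_trace (G x) (\<lambda>u v. curvature G (nabla G (\<lambda>_. u) \<xi>) \<xi> (\<lambda>_. v) x) = 0"
proof -
  have "nabla G (\<lambda>_. u) \<xi> = (\<lambda>y. covd G \<xi> y u)" for u by (simp add: nabla_covd fun_eq_iff)
  moreover have "(\<lambda>y. covd G \<xi> y u) differentiable (at x)" for u
    by (intro differentiable_covd x smooth_\<xi> differentiable_const)
  ultimately have "metric_trace (G x) (\<lambda>u v. curvature G (nabla G (\<lambda>_. u) \<xi>) \<xi> (\<lambda>_. v) x)
     = - metric_trace (G x) (\<lambda>u v. covd2 G \<xi> x (covd G \<xi> x u) v)"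
    by (simp add: curvature_killing(1)[OF x] metric_trace_def sum_negf)
  then show ?thesis using traces_covd2(2)[OF x] by simp
qed

text \<open>The first variation of the energy density in the direction \<open>U \<bottom> \<xi>\<close> is a divergence, because
  \<open>tr \<nabla>\<^sup>2\<xi>\<close> is collinear to \<open>\<xi>\<close>.\<close>

lemma first_variation_divergence:
  assumes x: "x \<in> S" and U: "U differentiable (at x)" and perp: "bil (G x) (U x) (\<xi> x) = 0"
  shows "sqrt \<bar>det (G x)\<bar> * metric_trace (G x) (\<lambda>u v. bil (G x) (covd G U x u) (covd G \<xi> x v))
    = - tr (D (\<lambda>y. sqrt \<bar>det (G y)\<bar> *\<^sub>R covd G \<xi> y (U y)) x)"
proof -
  interpret metric_tensor "G x" by (rule metric_tensor[OF x])
  let ?\<omega> = "sqrt \<bar>det (G x)\<bar>" and ?Z = "covd G \<xi> x (U x)"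
  note lin = covd_linear[OF x diff_\<xi>[OF x]]
  have 1: "metric_trace (G x) (\<lambda>u v. bil (G x) (covd G U x u) (covd G \<xi> x v))
      = - tr (\<lambda>u. covd G \<xi> x (covd G U x u))"
  proof -
    have "bil (G x) (covd G U x u) (covd G \<xi> x v) = bil (G x) (- covd G \<xi> x (covd G U x u)) v" for u v
      using covd_skew[OF x, of "covd G U x u" v] by simp
    then show ?thesis by (simp only: metric_trace_bil tr_simps)
  qed
  have "((\<lambda>y. sqrt \<bar>det (G y)\<bar> *\<^sub>R covd G \<xi> y (U y)) has_derivative
      (\<lambda>h. ?\<omega> *\<^sub>R (D (\<lambda>y. covd G \<xi> y (U x)) x h + covd G \<xi> x (D U x h))
         + (?\<omega> * tr (\<lambda>u. \<Gamma> x u h)) *\<^sub>R ?Z)) (at x)"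
    by (intro has_derivative_scaleR volume_density_deriv x has_derivative_covd smooth_\<xi> D_works U)
  from D_eqI[OF this]
  have 2: "tr (D (\<lambda>y. sqrt \<bar>det (G y)\<bar> *\<^sub>R covd G \<xi> y (U y)) x)
     = ?\<omega> * (tr (\<lambda>h. D (\<lambda>y. covd G \<xi> y (U x)) x h) + tr (\<lambda>h. covd G \<xi> x (D U x h)))
       + tr (\<lambda>h. (?\<omega> * tr (\<lambda>u. \<Gamma> x u h)) *\<^sub>R ?Z)"
    by (simp only: tr_simps)
  \<comment> \<open>The derivative of the volume density contributes the trace of the Christoffel
    symbols that turns a coordinate divergence into a covariant one.\<close>
  have 3: "tr (\<lambda>h. (?\<omega> * tr (\<lambda>u. \<Gamma> x u h)) *\<^sub>R ?Z) = ?\<omega> * tr (\<lambda>u. \<Gamma> x u ?Z)"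
    by (rule tr_rank_one)
      (auto intro!: linearI simp: linear_add[OF christoffel_linear2[OF x]] linear_scale[OF christoffel_linear2[OF x]]
        tr_simps algebra_simps)
  have 4: "tr (\<lambda>u. covd2 G \<xi> x u (U x)) = tr (\<lambda>h. D (\<lambda>y. covd G \<xi> y (U x)) x h) + tr (\<lambda>u. \<Gamma> x u ?Z)
      - tr (\<lambda>u. covd G \<xi> x (\<Gamma> x u (U x)))"
    unfolding covd2_def by (simp only: tr_simps)
  \<comment> \<open>Collinearity enters here: this trace is a multiple of g(\<xi>, U), which is
    0.\<close>
  have 5: "tr (\<lambda>u. covd2 G \<xi> x u (U x)) = 0"
    using traces_covd2(1)[OF x, of "U x"] perp sym[of "\<xi> x" "U x"] by simp
  have 6: "tr (\<lambda>u. covd G \<xi> x (covd G U x u))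
      = tr (\<lambda>h. covd G \<xi> x (D U x h)) + tr (\<lambda>u. covd G \<xi> x (\<Gamma> x u (U x)))"
    unfolding covd_def[of G U] by (simp only: linear_add[OF lin] tr_simps)
  have "tr (D (\<lambda>y. sqrt \<bar>det (G y)\<bar> *\<^sub>R covd G \<xi> y (U y)) x)
      = ?\<omega> * tr (\<lambda>u. covd G \<xi> x (covd G U x u))"
    unfolding 2 3 6 using 4 5 by (simp add: algebra_simps)
  then show ?thesis unfolding 1 by simp
qed

end

text \<open>\<phi> is skew because d\<eta> is, and \<phi>\<xi> = 0 by the Reeb condition.
  Differentiating the latter gives -\<phi>(\<nabla>_u \<xi>) = (\<nabla>_u \<phi>)\<xi> = u -
  \<eta>(u)\<xi> = \<phi>(\<phi> u). So \<nabla>_u \<xi> + \<phi> u lies in the kernel of \<phi>,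
  which is spanned by \<xi>, and it is orthogonal to \<xi>; hence \<nabla>\<xi> = -\<phi> is
  skew.\<close>

lemma (in chart_metric) paraSasakian_killing:
  assumes \<xi>: "smooth_on S \<xi>" and \<phi>: "smooth_on S \<phi>" and \<eta>: "smooth_on S \<eta>"
    and unit: "\<And>x. x \<in> S \<Longrightarrow> \<eta> x \<bullet> \<xi> x = 1"
    and dual: "\<And>x u. x \<in> S \<Longrightarrow> \<eta> x \<bullet> u = bil (G x) (\<xi> x) u"
    and d_\<eta>: "\<And>x u v. x \<in> S \<Longrightarrow> ext_d \<eta> (\<lambda>_. u) (\<lambda>_. v) x = bil (G x) u (\<phi> x *v v)"
    and \<phi>_\<phi>: "\<And>x u. x \<in> S \<Longrightarrow> \<phi> x *v (\<phi> x *v u) = u - (\<eta> x \<bullet> u) *\<^sub>R \<xi> x"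
    and reeb: "\<And>x u. x \<in> S \<Longrightarrow> ext_d \<eta> \<xi> (\<lambda>_. u) x = 0"
    and sas: "\<And>x u v. x \<in> S \<Longrightarrow> nabla_endo G (\<lambda>_. u) \<phi> (\<lambda>_. v) x
          = - bil (G x) u v *\<^sub>R \<xi> x + (\<eta> x \<bullet> v) *\<^sub>R u"
    and x: "x \<in> S"
  shows "bil (D G x (\<xi> x)) u v + bil (G x) (D \<xi> x u) v + bil (G x) u (D \<xi> x v) = 0"
proof -
  have d\<xi>: "\<xi> differentiable (at y)" and d\<eta>: "\<eta> differentiable (at y)" and d\<phi>: "\<phi> differentiable (at y)"
    if "y \<in> S" for y using smooth_on_differentiable[OF _ open_S that] \<xi> \<eta> \<phi> by blast+
  have ext: "ext_d \<eta> (\<lambda>_. u) (\<lambda>_. v) y = (D \<eta> y u \<bullet> v - D \<eta> y v \<bullet> u) / 2" if y: "y \<in> S" for y u v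
    by (simp add: ext_d_def lie_bracket_def D_inner_left[OF d\<eta>[OF y]])
  have skew: "bil (G y) (\<phi> y *v u) v = - bil (G y) u (\<phi> y *v v)" if y: "y \<in> S" for y u v
    using d_\<eta>[OF y, of u v] d_\<eta>[OF y, of v u] g_sym[OF y, of v "\<phi> y *v u"] by (simp add: ext[OF y])
  have \<phi>\<xi>: "\<phi> y *v \<xi> y = 0" if y: "y \<in> S" for y
  proof (rule g_nondegenerate[OF y])
    fix w
    \<comment> \<open>The Reeb condition is stated for the field \<xi>. Differentiating
      \<eta>(\<xi>) = 1 transfers it to the vector \<xi> y extended with constant components, to
      which \<open>d_\<eta>\<close> applies.\<close>
    have h: "((\<lambda>y. \<eta> y \<bullet> \<xi> y) has_derivative (\<lambda>h. \<eta> y \<bullet> D \<xi> y h + D \<eta> y h \<bullet> \<xi> y)) (at y)"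
      by (intro has_derivative_inner D_works d\<eta> d\<xi> y)
    from D_eq_zero[OF open_S y unit this, of w] have 1: "\<eta> y \<bullet> D \<xi> y w + D \<eta> y w \<bullet> \<xi> y = 0" .
    have "((\<lambda>y. \<eta> y \<bullet> w) has_derivative (\<lambda>h. D \<eta> y h \<bullet> w)) (at y)"
      by (intro has_derivative_inner_left D_works d\<eta> y)
    then have "D \<eta> y (\<xi> y) \<bullet> w + \<eta> y \<bullet> D \<xi> y w = 0"
      using reeb[OF y, of w] 1
      by (simp add: ext_d_def lie_bracket_def D_eqI[OF h] D_inner_left[OF d\<eta>[OF y]])
    with 1 have "ext_d \<eta> (\<lambda>_. \<xi> y) (\<lambda>_. w) y = 0" by (simp add: ext[OF y])
    then show "bil (G y) (\<phi> y *v \<xi> y) w = bil (G y) 0 w"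
      using d_\<eta>[OF y, of "\<xi> y" w] skew[OF y, of "\<xi> y" w] by simp
  qed
  have S\<phi>: "covd G \<xi> x u = - (\<phi> x *v u)" for u
  proof -
    have "((\<lambda>y. \<phi> y *v \<xi> y) has_derivative (\<lambda>h. \<phi> x *v D \<xi> x h + D \<phi> x h *v \<xi> x)) (at x)"
      by (intro has_derivative_matrix_vector_mult D_works d\<phi> d\<xi> x)
    from D_eq_zero[OF open_S x \<phi>\<xi> this, of u] have 1: "D \<phi> x u *v \<xi> x = - (\<phi> x *v D \<xi> x u)"
      by (simp add: eq_neg_iff_add_eq_0 add.commute)
    have "((\<lambda>y. \<phi> y *v \<xi> x) has_derivative (\<lambda>h. \<phi> x *v 0 + D \<phi> x h *v \<xi> x)) (at x)"
      by (intro has_derivative_matrix_vector_mult D_works d\<phi> x has_derivative_const)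
    then have "nabla_endo G (\<lambda>_. u) \<phi> (\<lambda>_. \<xi> x) x
       = D \<phi> x u *v \<xi> x + christoffel G x u (\<phi> x *v \<xi> x) - \<phi> x *v christoffel G x u (\<xi> x)"
      by (simp add: nabla_endo_def nabla_def D_eqI)
    also have "\<dots> = - (\<phi> x *v covd G \<xi> x u)"
      by (simp add: 1 \<phi>\<xi>[OF x] linear_0[OF christoffel_linear2[OF x]] covd_def matrix_vector_right_distrib)
    finally have "- (\<phi> x *v covd G \<xi> x u) = - (\<eta> x \<bullet> u) *\<^sub>R \<xi> x + u"
      using sas[OF x, of u "\<xi> x"] unit[OF x] g_sym[OF x, of u "\<xi> x"] dual[OF x] by simp
    then have "\<phi> x *v (covd G \<xi> x u + \<phi> x *v u) = 0"
      using \<phi>_\<phi>[OF x, of u] by (simp add: matrix_vector_right_distrib algebra_simps eq_neg_iff_add_eq_0 neg_eq_iff_add_eq_0)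
    then have "\<phi> x *v (\<phi> x *v (covd G \<xi> x u + \<phi> x *v u)) = 0" by simp
    then have 2: "covd G \<xi> x u + \<phi> x *v u = (\<eta> x \<bullet> (covd G \<xi> x u + \<phi> x *v u)) *\<^sub>R \<xi> x"
      unfolding \<phi>_\<phi>[OF x] by simp
    have "((\<lambda>y. bil (G y) (\<xi> y) (\<xi> y)) has_derivative
       (\<lambda>h. bil (D G x h) (\<xi> x) (\<xi> x) + bil (G x) (D \<xi> x h) (\<xi> x) + bil (G x) (\<xi> x) (D \<xi> x h))) (at x)"
      by (intro has_derivative_bil G_works x D_works d\<xi>)
    from D_eq_zero[OF open_S x _ this, of 1 u]
    have "bil (G x) (\<xi> x) (covd G \<xi> x u) = 0"
      using unit dual g_sym[OF x, of "\<xi> x" "D \<xi> x u"] g_sym[OF x, of "\<xi> x" "christoffel G x u (\<xi> x)"]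
      by (simp add: metric_compatible[OF x] covd_def)
    moreover have "bil (G x) (\<xi> x) (\<phi> x *v u) = 0" using skew[OF x, of "\<xi> x" u] \<phi>\<xi>[OF x] by simp
    ultimately have "\<eta> x \<bullet> (covd G \<xi> x u + \<phi> x *v u) = 0" by (simp add: dual[OF x])
    with 2 show ?thesis by (simp add: eq_neg_iff_add_eq_0)
  qed
  show ?thesis
    using skew[OF x, of u v] metric_compatible[OF x, of "\<xi> x" u v]
      christoffel_sym[OF x, of "\<xi> x" u] christoffel_sym[OF x, of "\<xi> x" v]
      arg_cong[OF S\<phi>[of u], of "\<lambda>a. bil (G x) a v"] arg_cong[OF S\<phi>[of v], of "\<lambda>a. bil (G x) u a"]
    by (simp add: covd_def)
qed

section \<open>Functions of class \<open>C\<^sup>1\<close>\<close>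

text \<open>The regularity at which the localisation argument runs: fields multiplied by bump
  functions are of class C^1 only.\<close>

abbreviation C1 :: "'b::real_normed_vector set \<Rightarrow> ('b \<Rightarrow> 'c::real_normed_vector) \<Rightarrow> bool" where
  "C1 \<equiv> Ck (Suc 0)"

lemma C1_iff: "open S \<Longrightarrow> C1 S f \<longleftrightarrow> (\<forall>x\<in>S. f differentiable (at x)) \<and> (\<forall>v. continuous_on S (\<lambda>x. D f x v))"
  by (subst Ck_Suc_open) simp_all

lemma C1_differentiable: "\<lbrakk>C1 S f; open S; x \<in> S\<rbrakk> \<Longrightarrow> f differentiable (at x)"
  by (simp only: C1_iff)

lemma C1_continuous_D: "\<lbrakk>C1 S f; open S\<rbrakk> \<Longrightarrow> continuous_on S (\<lambda>x. D f x v)"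
  by (simp only: C1_iff)

lemma smooth_on_C1: "smooth_on S f \<Longrightarrow> C1 S f"
  unfolding smooth_on_def by blast

lemma C1I:
  assumes "open S" "\<And>x. x \<in> S \<Longrightarrow> (f has_derivative f' x) (at x)" "\<And>v. continuous_on S (\<lambda>x. f' x v)"
  shows "C1 S f"
proof -
  have "continuous_on S (\<lambda>x. D f x v)" for v
    using assms(3)[of v] by (rule continuous_on_eq) (simp add: D_eqI[OF assms(2)])
  then show ?thesis
    unfolding C1_iff[OF assms(1)] using assms(2) by (auto simp: differentiable_def)
qed

lemma C1_cong:
  assumes "open S" "C1 S f" "\<And>y. y \<in> S \<Longrightarrow> f y = g y"
  shows "C1 S g"
proof (rule C1I[OF assms(1), where f' = "D f"])
  show "(g has_derivative D f x) (at x)" if "x \<in> S" for x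
    using has_derivative_transform_within_open[OF D_works[OF C1_differentiable[OF assms(2,1) that]] assms(1) that]
      assms(3) by blast
  show "continuous_on S (\<lambda>x. D f x v)" for v by (rule C1_continuous_D[OF assms(2,1)])
qed

lemma C1_local:
  assumes S: "open S" and loc: "\<And>y. y \<in> S \<Longrightarrow> \<exists>T. open T \<and> y \<in> T \<and> C1 T f"
  shows "C1 S f"
proof -
  have "f differentiable (at y)" if "y \<in> S" for y
    using loc[OF that] C1_differentiable by blast
  moreover have "isCont (\<lambda>x. D f x v) y" if "y \<in> S" for y v
    using loc[OF that] C1_continuous_D continuous_on_eq_continuous_at by blast
  ultimately show ?thesis
    unfolding C1_iff[OF S] by (auto intro: continuous_at_imp_continuous_on)
qed

lemma C1_subset: "\<lbrakk>C1 S f; open S; open T; T \<subseteq> S\<rbrakk> \<Longrightarrow> C1 T f"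
  by (simp only: C1_iff) (meson continuous_on_subset subsetD)

lemma C1_const: "open S \<Longrightarrow> C1 S (\<lambda>_. a)"
  by (rule C1I[where f' = "\<lambda>_ _. 0"]) auto

lemma C1_bilinear:
  assumes P: "bounded_bilinear P" and S: "open S" and f: "C1 S f" and g: "C1 S g"
  shows "C1 S (\<lambda>x. P (f x) (g x))"
proof (rule C1I[OF S])
  show "((\<lambda>x. P (f x) (g x)) has_derivative (\<lambda>h. P (f x) (D g x h) + P (D f x h) (g x))) (at x)"
    if "x \<in> S" for x
    by (intro bounded_bilinear.FDERIV[OF P] D_works C1_differentiable[OF f S that] C1_differentiable[OF g S that])
  show "continuous_on S (\<lambda>x. P (f x) (D g x v) + P (D f x v) (g x))" for v
    by (intro continuous_on_add bounded_bilinear.continuous_on[OF P] C1_continuous_D[OF f S]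
        C1_continuous_D[OF g S] Ck_continuous_on[OF f] Ck_continuous_on[OF g])
qed

lemmas C1_scaleR = C1_bilinear[OF bounded_bilinear_scaleR]
lemmas C1_matrix_vector_mult = C1_bilinear[OF bounded_bilinear_matrix_vector_mult]

lemma C1_sum:
  assumes S: "open S" and f: "\<And>i. i \<in> I \<Longrightarrow> C1 S (f i)"
  shows "C1 S (\<lambda>x. \<Sum>i\<in>I. f i x)"
  by (rule C1I[OF S, where f' = "\<lambda>x h. \<Sum>i\<in>I. D (f i) x h"])
    (auto intro!: has_derivative_sum D_works continuous_on_sum C1_differentiable C1_continuous_D f S)

lemma C1_inverse:
  fixes f :: "'b::real_normed_vector \<Rightarrow> real"
  assumes S: "open S" and f: "C1 S f" and nz: "\<And>x. x \<in> S \<Longrightarrow> f x \<noteq> 0"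
  shows "C1 S (\<lambda>x. inverse (f x))"
proof (rule C1I[OF S])
  show "((\<lambda>x. inverse (f x)) has_derivative (\<lambda>h. - (inverse (f x) * D f x h * inverse (f x)))) (at x)"
    if "x \<in> S" for x
    by (rule Deriv.has_derivative_inverse[OF nz[OF that] D_works[OF C1_differentiable[OF f S that]]])
  show "continuous_on S (\<lambda>x. - (inverse (f x) * D f x v * inverse (f x)))" for v
    using nz by (intro continuous_intros C1_continuous_D[OF f S] Ck_continuous_on[OF f]) auto
qed

section \<open>Change of charts\<close>

text \<open>Represent \<beta>(u, v) as g'(f u, v). Pulling back along the isometry \<open>J\<close>,
  which is injective by nondegeneracy, conjugates \<open>f\<close>, and conjugation preserves the
  trace.\<close>

lemma metric_trace_transform:
  fixes B B' :: "real ^ 'm ^ 'm::finite" and \<beta> :: "real ^ 'm \<Rightarrow> real ^ 'm \<Rightarrow> real"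
  assumes B: "metric_tensor B" and B': "metric_tensor B'" and J: "linear J"
    and iso: "\<And>u v. bil B u v = bil B' (J u) (J v)"
    and \<beta>: "\<And>v. linear (\<lambda>u. \<beta> u v)" "\<And>u. linear (\<beta> u)"
  shows "metric_trace B (\<lambda>u v. \<beta> (J u) (J v)) = metric_trace B' \<beta>"
proof -
  have "inj J"
  proof (rule injI)
    fix a b assume "J a = J b"
    then show "a = b" by (intro metric_tensor.nondegenerate[OF B]) (simp add: iso)
  qed
  then obtain K where K: "linear K" "\<And>x. K (J x) = x" "\<And>x. J (K x) = x"
    using linear_injective_isomorphism[OF J] by blast
  define f where "f u = matrix_inv B' *v (\<chi> j. \<beta> u (axis j 1))" for u
  have f: "\<beta> u v = bil B' (f u) v" for u v
    unfolding f_def metric_tensor.bil_matrix_inv[OF B'] by (simp add: inner_vec_lambda_linear \<beta>)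
  have lf: "linear f"
    by (rule linearI; rule metric_tensor.nondegenerate[OF B'])
      (simp_all add: linear_add[OF \<beta>(1)] linear_scale[OF \<beta>(1)] flip: f)
  have "metric_trace B (\<lambda>u v. \<beta> (J u) (J v)) = metric_trace B (\<lambda>u v. bil B (K (f (J u))) v)"
    by (simp add: f iso K)
  also have "\<dots> = tr (\<lambda>u. K (f (J u)))" by (rule metric_tensor.metric_trace_bil[OF B])
  also have "\<dots> = tr (\<lambda>u. f (J (K u)))"
    using tr_comp_commute[OF K(1) linear_compose[OF J lf]] by (simp add: o_def)
  also have "\<dots> = metric_trace B' \<beta>"
    by (simp add: K f[abs_def] metric_tensor.metric_trace_bil[OF B'])
  finally show ?thesis .
qed

text \<open>The scalar product of \<nabla>U and \<nabla>V induced by the metric; its quadratic form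
  gives the nonconstant part of the energy density. It need not be definite.\<close>

definition dirichlet ::
    "(real ^ 'm \<Rightarrow> real ^ 'm ^ 'm) \<Rightarrow> (real ^ 'm \<Rightarrow> real ^ 'm) \<Rightarrow> (real ^ 'm \<Rightarrow> real ^ 'm)
       \<Rightarrow> real ^ 'm::finite \<Rightarrow> real" where
  "dirichlet G U V x = metric_trace (G x) (\<lambda>u v. bil (G x) (covd G U x u) (covd G V x v))"

context chart_metric
begin

lemma C1_volume_density: "C1 S (\<lambda>x. sqrt \<bar>det (G x)\<bar>)"
proof (rule C1I[OF open_S volume_density_deriv])
  have "continuous_on S (\<lambda>x. sqrt \<bar>det (G x)\<bar>)"
    using has_derivative_continuous[OF volume_density_deriv] by (blast intro: continuous_at_imp_continuous_on)
  moreover have "continuous_on S (\<lambda>x. tr (\<lambda>u. christoffel G x u v))" for v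
    unfolding tr_def by (intro continuous_intros continuous_on_christoffel)
  ultimately show "continuous_on S (\<lambda>x. sqrt \<bar>det (G x)\<bar> * tr (\<lambda>u. christoffel G x u v))" for v
    by (rule continuous_on_mult)
qed

lemma dirichlet_commute: "x \<in> S \<Longrightarrow> dirichlet G U V x = dirichlet G V U x"
proof -
  assume x: "x \<in> S"
  interpret metric_tensor "G x" by (rule metric_tensor[OF x])
  have "matrix_inv (G x) $ i $ j *\<^sub>R bil (G x) (covd G U x (axis i 1)) (covd G V x (axis j 1))
      = matrix_inv (G x) $ j $ i *\<^sub>R bil (G x) (covd G V x (axis j 1)) (covd G U x (axis i 1))" for i j
    by (simp add: matrix_inv_symmetric[of i j] sym[of "covd G U x (axis i 1)"])
  then show ?thesis unfolding dirichlet_def metric_trace_def by (subst sum.swap) (simp only:)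
qed

text \<open>The horizontal part of dV is the identity and contributes the trace of the metric, which
  is the dimension; the connection map sends dV(u) to \<nabla>_u V.\<close>

lemma local_energy_density_dirichlet:
  assumes x: "x \<in> S" and V: "V differentiable (at x)"
  shows "local_energy_density G V x = (CARD('m) + dirichlet G V V x) / 2"
proof -
  interpret metric_tensor "G x" by (rule metric_tensor[OF x])
  have "((\<lambda>y. (y, V y)) has_derivative (\<lambda>h. (h, D V x h))) (at x)"
    by (intro has_derivative_Pair has_derivative_ident D_works V)
  then have e: "D (\<lambda>y. (y, V y)) x = (\<lambda>h. (h, D V x h))" by (rule D_eqI)
  have "metric_trace (G x) (\<lambda>u v. bil (G x) u v) = CARD('m)"
    using metric_trace_bil[of "\<lambda>u. u"] by (simp add: tr_simps)
  then show ?thesis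
    unfolding local_energy_density_def Let_def e sasaki_def dirichlet_def
    by (simp add: metric_trace_def covd_def ring_distribs sum.distrib)
qed

text \<open>The parameter space \<open>Z\<close> is left general because two cases are needed: a
  chart with fixed fields, and the product of a time interval with a chart for variations.\<close>

lemma continuous_on_dirichlet_family:
  fixes \<sigma> :: "'z::topological_space \<Rightarrow> real ^ 'm"
  assumes \<sigma>: "continuous_on Z \<sigma>" "\<sigma> ` Z \<subseteq> S"
    and U: "continuous_on Z (\<lambda>z. U z (\<sigma> z))" "\<And>v. continuous_on Z (\<lambda>z. D (U z) (\<sigma> z) v)"
    and V: "continuous_on Z (\<lambda>z. V z (\<sigma> z))" "\<And>v. continuous_on Z (\<lambda>z. D (V z) (\<sigma> z) v)"
  shows "continuous_on Z (\<lambda>z. dirichlet G (U z) (V z) (\<sigma> z))"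
proof -
  have comp: "continuous_on Z (\<lambda>z. f (\<sigma> z))" if "continuous_on S f" for f :: "real ^ 'm \<Rightarrow> 'c::topological_space"
    using continuous_on_compose2[OF that \<sigma>] .
  have "(\<lambda>y. (matrix_inv (G y) *v axis j 1) $ i) differentiable (at x)" if "x \<in> S" for x i j
    by (intro differentiable_vec_nth differentiable_matrix_inv_mult[OF _ _ open_S that inv_G] differentiable_const
        smooth_on_differentiable[OF smooth_G open_S that])
  then have Gi: "continuous_on S (\<lambda>y. matrix_inv (G y) $ i $ j)" for i j
    by (intro continuous_at_imp_continuous_on ballI differentiable_imp_continuous_within)
      (simp add: matrix_vector_mult_basis column_def)
  have "continuous_on Z (\<lambda>z. christoffel G (\<sigma> z) u (W z))" if "continuous_on Z W" for u W
  proof -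
    have e: "christoffel G (\<sigma> z) u (W z) = (\<Sum>j\<in>UNIV. (W z $ j) *\<^sub>R christoffel G (\<sigma> z) u (axis j 1))"
      if "z \<in> Z" for z using \<sigma>(2) that by (intro linear_expansion christoffel_linear2) auto
    have "continuous_on Z (\<lambda>z. \<Sum>j\<in>UNIV. (W z $ j) *\<^sub>R christoffel G (\<sigma> z) u (axis j 1))"
      by (intro continuous_intros comp continuous_on_christoffel that)
    then show ?thesis by (rule continuous_on_eq) (simp add: e)
  qed
  note cc = this
  show ?thesis
    unfolding dirichlet_def metric_trace_def covd_def
    by (intro continuous_intros comp[OF Gi] comp[OF smooth_on_continuous[OF smooth_G]] cc U V)
qed

lemma continuous_on_dirichlet:
  assumes "C1 S U" "C1 S V"
  shows "continuous_on S (dirichlet G U V)"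
  using continuous_on_dirichlet_family[of S "\<lambda>x. x" "\<lambda>_. U" "\<lambda>_. V"] assms
  by (simp add: C1_continuous_D open_S Ck_continuous_on continuous_on_id del: Ck.simps)

end

section \<open>Isometric changes of coordinates\<close>

locale chart_change = P: chart_metric S G + Q: chart_metric S' G'
  for S :: "(real ^ 'm::finite) set" and G and S' :: "(real ^ 'm) set" and G' +
  fixes T :: "(real ^ 'm) set" and F :: "real ^ 'm \<Rightarrow> real ^ 'm"
  assumes open_T: "open T" and T_S: "T \<subseteq> S" and F_T: "F ` T \<subseteq> S'" and smooth_F: "smooth_on T F"
    and isometry: "x \<in> T \<Longrightarrow> bil (G x) u v = bil (G' (F x)) (D F x u) (D F x v)"
begin

lemma TS: "x \<in> T \<Longrightarrow> x \<in> S" and TS': "x \<in> T \<Longrightarrow> F x \<in> S'"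
  using T_S F_T by auto

lemma F_works: "x \<in> T \<Longrightarrow> (F has_derivative D F x) (at x)"
  by (intro D_works smooth_on_differentiable[OF smooth_F open_T])

lemma DF_linear: "x \<in> T \<Longrightarrow> linear (D F x)"
  by (intro D_linear smooth_on_differentiable[OF smooth_F open_T])

lemma DF_surj:
  assumes x: "x \<in> T"
  shows "\<exists>u. D F x u = w"
proof -
  have "inj (D F x)"
  proof (rule injI)
    fix a b assume "D F x a = D F x b"
    then show "a = b" by (intro P.g_nondegenerate[OF TS[OF x]]) (simp add: isometry[OF x])
  qed
  then have "surj (D F x)" by (rule linear_injective_imp_surjective[OF DF_linear[OF x] _ refl])
  then show ?thesis by (metis surjD)
qed

text \<open>Since the differential of \<open>F\<close> is onto, testing against images
  \<open>D F x w\<close> suffices. In Koszul's formula for the pulled back metric all second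
  derivatives of \<open>F\<close> cancel except those in the directions u and v.\<close>

lemma christoffel_transform:
  assumes x: "x \<in> T"
  shows "D F x (christoffel G x u v) = christoffel G' (F x) (D F x u) (D F x v) + D (\<lambda>y. D F y v) x u"
proof (rule Q.g_nondegenerate[OF TS'[OF x]])
  fix w'
  obtain w where w: "w' = D F x w" using DF_surj[OF x] by metis
  have d2: "((\<lambda>y. D F y a) has_derivative D (\<lambda>y. D F y a) x) (at x)" for a
    by (intro D_works smooth_on_differentiable[OF smooth_on_D[OF smooth_F] open_T x])
  have sym2: "D (\<lambda>y. D F y a) x b = D (\<lambda>y. D F y b) x a" for a b
    by (rule smooth_on_D_D_symmetric[OF smooth_F open_T x])
  have G'F: "((\<lambda>y. G' (F y)) has_derivative (\<lambda>h. D G' (F x) (D F x h))) (at x)"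
    by (rule has_derivative_compose[where f = F, OF F_works[OF x] Q.G_works[OF TS'[OF x]]])
  have DG: "bil (D G x h) a b = bil (D G' (F x) (D F x h)) (D F x a) (D F x b)
     + bil (G' (F x)) (D (\<lambda>y. D F y a) x h) (D F x b) + bil (G' (F x)) (D F x a) (D (\<lambda>y. D F y b) x h)" for h a b
  proof -
    have "((\<lambda>y. bil (G y) a b - bil (G' (F y)) (D F y a) (D F y b)) has_derivative
      (\<lambda>h. (bil (D G x h) a b + bil (G x) 0 b + bil (G x) a 0) - (bil (D G' (F x) (D F x h)) (D F x a) (D F x b)
     + bil (G' (F x)) (D (\<lambda>y. D F y a) x h) (D F x b) + bil (G' (F x)) (D F x a) (D (\<lambda>y. D F y b) x h)))) (at x)"
      by (intro has_derivative_diff has_derivative_bil P.G_works TS x has_derivative_const d2 G'F)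
    from D_eq_zero[OF open_T x _ this, of 0 h] show ?thesis by (simp add: isometry)
  qed
  have "bil (G' (F x)) (D F x (christoffel G x u v)) (D F x w) = bil (G x) (christoffel G x u v) w"
    by (simp add: isometry[OF x])
  also have "\<dots> = (bil (D G x u) v w + bil (D G x v) u w - bil (D G x w) u v) / 2"
    by (rule P.christoffel_lower[OF TS[OF x]])
  also have "\<dots> = bil (G' (F x)) (christoffel G' (F x) (D F x u) (D F x v) + D (\<lambda>y. D F y v) x u) (D F x w)"
    using Q.g_sym[OF TS'[OF x], of "D F x v" "D (\<lambda>y. D F y w) x u"]
      Q.g_sym[OF TS'[OF x], of "D F x u" "D (\<lambda>y. D F y w) x v"]
      sym2[of u v] sym2[of u w] sym2[of v w]
      Q.g_sym[OF TS'[OF x], of "D F x u" "D (\<lambda>y. D F y v) x w"]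
    by (simp add: DG Q.christoffel_lower[OF TS'[OF x]] field_simps)
  finally show "bil (G' (F x)) (D F x (christoffel G x u v)) w' =
      bil (G' (F x)) (christoffel G' (F x) (D F x u) (D F x v) + D (\<lambda>y. D F y v) x u) w'"
    unfolding w .
qed

lemma covd_transform:
  assumes x: "x \<in> T" and V: "V differentiable (at x)" and V': "V' differentiable (at (F x))"
    and law: "\<And>y. y \<in> T \<Longrightarrow> V' (F y) = D F y (V y)"
  shows "covd G' V' (F x) (D F x u) = D F x (covd G V x u)"
proof -
  have "((\<lambda>y. V' (F y) - D F y (V y)) has_derivative
    (\<lambda>h. D V' (F x) (D F x h) - (D (\<lambda>y. D F y (V x)) x h + D F x (D V x h)))) (at x)"
    by (intro has_derivative_diff has_derivative_compose[where f = F, OF F_works[OF x] D_works[OF V']]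
        has_derivative_D_moving[OF smooth_F open_T x] D_works V)
  from D_eq_zero[OF open_T x _ this, of 0 u]
  have "D V' (F x) (D F x u) = D (\<lambda>y. D F y (V x)) x u + D F x (D V x u)" by (simp add: law)
  then show ?thesis
    by (simp add: covd_def linear_add[OF DF_linear[OF x]] christoffel_transform[OF x] law[OF x])
qed

lemma dirichlet_transform:
  assumes x: "x \<in> T" and U: "U differentiable (at x)" and U': "U' differentiable (at (F x))"
    and lawU: "\<And>y. y \<in> T \<Longrightarrow> U' (F y) = D F y (U y)"
    and V: "V differentiable (at x)" and V': "V' differentiable (at (F x))"
    and lawV: "\<And>y. y \<in> T \<Longrightarrow> V' (F y) = D F y (V y)"
  shows "dirichlet G' U' V' (F x) = dirichlet G U V x"
proof -
  have "dirichlet G U V x = metric_trace (G x) (\<lambda>u v. bil (G' (F x)) (covd G' U' (F x) (D F x u))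
      (covd G' V' (F x) (D F x v)))"
    unfolding dirichlet_def
    by (simp add: isometry[OF x] covd_transform[OF x U U' lawU] covd_transform[OF x V V' lawV])
  also have "\<dots> = dirichlet G' U' V' (F x)"
    unfolding dirichlet_def
    by (rule metric_trace_transform[OF P.metric_tensor[OF TS[OF x]] Q.metric_tensor[OF TS'[OF x]] DF_linear[OF x] isometry[OF x]])
      (auto intro!: linearI simp: linear_add[OF Q.covd_linear[OF TS'[OF x] U']] linear_add[OF Q.covd_linear[OF TS'[OF x] V']]
        linear_scale[OF Q.covd_linear[OF TS'[OF x] U']] linear_scale[OF Q.covd_linear[OF TS'[OF x] V']])
  finally show ?thesis by simp
qed

end

text \<open>\<open>vector_field\<close> with smoothness weakened to C^1, so as to be closed under
  multiplication by the partition of unity.\<close>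

definition C1_field ::
    "('a, 'm::finite) chart set \<Rightarrow> ('a, 'm, real ^ 'm) field \<Rightarrow> bool" where
  "C1_field A X \<longleftrightarrow>
     (\<forall>c\<in>A. C1 (cdom c) (X c)) \<and>
     (\<forall>c\<in>A. \<forall>d\<in>A. \<forall>x\<in>overlap c d.
        X d (transition c d x) = jacobian (transition c d) (at x) *v X c x)"

lemma vector_field_C1: "vector_field A X \<Longrightarrow> C1_field A X"
  unfolding vector_field_def C1_field_def using smooth_on_C1 by blast

section \<open>Energy density on the manifold\<close>

locale metric_manifold =
  fixes A :: "('a::{t2_space,second_countable_topology}, 'm::finite) chart set"
    and g :: "('a, 'm, real ^ 'm ^ 'm) field"
  assumes manifold: "smooth_manifold A" and metric: "semi_riemannian_metric A g"
begin

lemma open_chart: "c \<in> A \<Longrightarrow> open (fst c)" and open_cdom: "c \<in> A \<Longrightarrow> open (cdom c)"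
  and homeo: "c \<in> A \<Longrightarrow> homeomorphism (fst c) (cdom c) (snd c) (cinv c)"
  and smooth_transition: "\<lbrakk>c \<in> A; d \<in> A\<rbrakk> \<Longrightarrow> smooth_on (overlap c d) (transition c d)"
  using manifold unfolding smooth_manifold_def by auto

lemma cinv_chart [simp]: "\<lbrakk>c \<in> A; p \<in> fst c\<rbrakk> \<Longrightarrow> cinv c (snd c p) = p"
  and chart_cinv [simp]: "\<lbrakk>c \<in> A; x \<in> cdom c\<rbrakk> \<Longrightarrow> snd c (cinv c x) = x"
  and cinv_in [simp]: "\<lbrakk>c \<in> A; x \<in> cdom c\<rbrakk> \<Longrightarrow> cinv c x \<in> fst c"
  using homeo[of c] unfolding homeomorphism_def by auto

lemma chart_in [simp]: "p \<in> fst c \<Longrightarrow> snd c p \<in> cdom c"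
  by (auto simp: cdom_def)

lemma chart_at: "chart_at A p \<in> A" "p \<in> fst (chart_at A p)"
proof -
  have "\<exists>c. c \<in> A \<and> p \<in> fst c" using manifold unfolding smooth_manifold_def by blast
  from someI_ex[OF this] show "chart_at A p \<in> A" "p \<in> fst (chart_at A p)"
    unfolding chart_at_def by auto
qed

lemma overlap_eq: "\<lbrakk>c \<in> A; d \<in> A\<rbrakk> \<Longrightarrow> overlap c d = {x \<in> cdom c. cinv c x \<in> fst d}"
  unfolding overlap_def cdom_def by (force simp: image_iff)

lemma open_overlap: "\<lbrakk>c \<in> A; d \<in> A\<rbrakk> \<Longrightarrow> open (overlap c d)"
  using continuous_open_preimage[of "cdom c" "cinv c" "fst d"] homeo[of c] open_cdom[of c] open_chart[of d]
  by (auto simp: overlap_eq homeomorphism_def Int_def vimage_def)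

lemma chart_metric: "c \<in> A \<Longrightarrow> chart_metric (cdom c) (g c)"
  using metric open_cdom unfolding semi_riemannian_metric_def chart_metric_def by auto

lemma jacobian_D:
  "\<lbrakk>c \<in> A; d \<in> A; x \<in> overlap c d\<rbrakk> \<Longrightarrow> jacobian (transition c d) (at x) *v u = D (transition c d) x u"
  unfolding jacobian_def
  by (intro matrix_linear D_linear smooth_on_differentiable[OF smooth_transition open_overlap])

lemma chart_change:
  assumes c: "c \<in> A" and d: "d \<in> A"
  shows "chart_change (cdom c) (g c) (cdom d) (g d) (overlap c d) (transition c d)"
proof -
  interpret P: chart_metric "cdom c" "g c" by (rule chart_metric[OF c])
  interpret Q: chart_metric "cdom d" "g d" by (rule chart_metric[OF d])
  show ?thesis
  proof
    show "open (overlap c d)" by (rule open_overlap[OF c d])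
    show "overlap c d \<subseteq> cdom c" "transition c d ` overlap c d \<subseteq> cdom d"
      by (auto simp: overlap_eq[OF c d] transition_def)
    show "smooth_on (overlap c d) (transition c d)" by (rule smooth_transition[OF c d])
    fix x u v assume x: "x \<in> overlap c d"
    let ?J = "jacobian (transition c d) (at x)"
    have "g c x = transpose ?J ** g d (transition c d x) ** ?J"
      using metric c d x unfolding semi_riemannian_metric_def by blast
    then have "bil (g c x) u v = u \<bullet> (transpose ?J *v (g d (transition c d x) *v (?J *v v)))"
      by (simp add: bil_def flip: matrix_vector_mul_assoc)
    also have "\<dots> = bil (g d (transition c d x)) (?J *v u) (?J *v v)"
      by (simp add: bil_def dot_lmul_matrix transpose_matrix_vector inner_commute)
        (metis dot_lmul_matrix inner_commute)
    finally show "bil (g c x) u v = bil (g d (transition c d x)) (D (transition c d) x u) (D (transition c d) x v)"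
      by (simp add: jacobian_D[OF c d x])
  qed
qed

text \<open>Allows the chart picked by \<open>chart_at\<close>, which jumps from point to point, to
  be replaced by a fixed one when continuity or integrals are at stake.\<close>

lemma dirichlet_invariant:
  assumes U: "C1_field A U" and V: "C1_field A V"
    and c: "c \<in> A" "p \<in> fst c" and d: "d \<in> A" "p \<in> fst d"
  shows "dirichlet (g d) (U d) (V d) (snd d p) = dirichlet (g c) (U c) (V c) (snd c p)"
proof -
  interpret chart_change "cdom c" "g c" "cdom d" "g d" "overlap c d" "transition c d"
    by (rule chart_change[OF c(1) d(1)])
  have x: "snd c p \<in> overlap c d" using c d by (auto simp: overlap_def)
  have F: "transition c d (snd c p) = snd d p" using c by (simp add: transition_def)
  have law: "X d (transition c d y) = D (transition c d) y (X c y)" if "C1_field A X" "y \<in> overlap c d" for X y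
    using that c d unfolding C1_field_def by (simp add: jacobian_D)
  have diff: "X e differentiable (at (snd e p))" if "C1_field A X" "e \<in> A" "p \<in> fst e" for X e
    using that C1_differentiable[OF _ open_cdom, of e "X e"] unfolding C1_field_def by simp
  show ?thesis
    using dirichlet_transform[OF x diff[OF U c] _ law[OF U] diff[OF V c] _ law[OF V]]
      diff[OF U d] diff[OF V d] unfolding F by simp
qed

definition dirichlet_at :: "('a, 'm, real ^ 'm) field \<Rightarrow> ('a, 'm, real ^ 'm) field \<Rightarrow> 'a \<Rightarrow> real" where
  "dirichlet_at U V p = dirichlet (g (chart_at A p)) (U (chart_at A p)) (V (chart_at A p)) (snd (chart_at A p) p)"

lemma dirichlet_at_eq:
  "\<lbrakk>C1_field A U; C1_field A V; c \<in> A; p \<in> fst c\<rbrakk>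
    \<Longrightarrow> dirichlet_at U V p = dirichlet (g c) (U c) (V c) (snd c p)"
  unfolding dirichlet_at_def by (rule dirichlet_invariant) (auto simp: chart_at)

lemma energy_density_dirichlet:
  assumes V: "C1_field A V"
  shows "energy_density A g V p = (CARD('m) + dirichlet_at V V p) / 2"
proof -
  let ?c = "chart_at A p"
  interpret chart_metric "cdom ?c" "g ?c" by (rule chart_metric[OF chart_at(1)])
  have "V ?c differentiable (at (snd ?c p))"
    using V chart_at[of p] C1_differentiable[OF _ open_cdom, of ?c "V ?c"] unfolding C1_field_def by simp
  then show ?thesis
    unfolding energy_density_def Let_def dirichlet_at_def
    by (intro local_energy_density_dirichlet) (simp add: chart_at)
qed

lemma continuous_in_charts:
  fixes f :: "'a \<Rightarrow> 'b::topological_space"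
  assumes "\<And>c. c \<in> A \<Longrightarrow> continuous_on (cdom c) (\<lambda>x. f (cinv c x))"
  shows "continuous_on UNIV f"
proof -
  have "continuous_on (fst c) f" if c: "c \<in> A" for c
  proof -
    have "continuous_on (fst c) (\<lambda>p. f (cinv c (snd c p)))"
      using continuous_on_compose2[OF assms[OF c], of "fst c" "snd c"] homeo[OF c]
      by (auto simp: homeomorphism_def)
    then show ?thesis by (rule continuous_on_eq) (simp add: c)
  qed
  then have "continuous (at p) f" for p
    using chart_at[of p] open_chart continuous_on_eq_continuous_at by blast
  then show ?thesis by (simp add: continuous_at_imp_continuous_on)
qed

lemma continuous_on_dirichlet_at:
  assumes U: "C1_field A U" and V: "C1_field A V"
  shows "continuous_on UNIV (dirichlet_at U V)"
proof (rule continuous_in_charts)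
  fix c assume c: "c \<in> A"
  interpret chart_metric "cdom c" "g c" by (rule chart_metric[OF c])
  have "continuous_on (cdom c) (dirichlet (g c) (U c) (V c))"
    by (rule continuous_on_dirichlet) (use U V c in \<open>auto simp: C1_field_def simp del: Ck.simps\<close>)
  then show "continuous_on (cdom c) (\<lambda>x. dirichlet_at U V (cinv c x))"
    by (rule continuous_on_eq) (simp add: dirichlet_at_eq[OF U V c] c)
qed

end

section \<open>Integration\<close>

lemma compact_real_bound:
  fixes f :: "'b::topological_space \<Rightarrow> real"
  assumes "continuous_on K f" "compact K"
  shows "\<exists>B. \<forall>x\<in>K. \<bar>f x\<bar> \<le> B"
  using compact_imp_bounded[OF compact_continuous_image[OF assms]] by (auto simp: bounded_iff)

lemma integrable_difference:
  fixes f h w :: "'b \<Rightarrow> real"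
  assumes "integrable M w" "f \<in> borel_measurable M" "h \<in> borel_measurable M"
    and "\<And>x. x \<in> space M \<Longrightarrow> \<bar>f x - h x\<bar> \<le> \<bar>a\<bar> * w x"
  shows "integrable M (\<lambda>x. f x - h x)"
  by (rule Bochner_Integration.integrable_bound[OF integrable_mult_right[OF assms(1), of "\<bar>a\<bar>"]])
    (use assms in \<open>fastforce+\<close>)

text \<open>Dominated convergence for the difference quotients. The bound concerns only increments
  from t = 0, so integrability of \<open>e t\<close> is inherited from \<open>e 0\<close>.\<close>

lemma derivative_under_integral:
  fixes e :: "real \<Rightarrow> 'b \<Rightarrow> real"
  assumes \<epsilon>: "\<epsilon> > 0" and w: "integrable M w"
    and meas: "\<And>t. \<bar>t\<bar> < \<epsilon> \<Longrightarrow> e t \<in> borel_measurable M"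
    and bound: "\<And>t x. \<lbrakk>x \<in> space M; \<bar>t\<bar> < \<epsilon>\<rbrakk> \<Longrightarrow> \<bar>e t x - e 0 x\<bar> \<le> \<bar>t\<bar> * w x"
    and der: "\<And>x. x \<in> space M \<Longrightarrow> ((\<lambda>t. e t x) has_real_derivative f x) (at 0)"
  shows "integrable M (e 0) \<Longrightarrow> ((\<lambda>t. \<integral>x. e t x \<partial>M) has_real_derivative (\<integral>x. f x \<partial>M)) (at 0)"
proof -
  have lim: "(\<lambda>n. (e (X n) x - e 0 x) / X n) \<longlonglongrightarrow> f x"
    if "X \<longlonglongrightarrow> 0" "\<And>n. X n \<noteq> 0" "x \<in> space M" for X x
    using der[OF that(3)] that(1,2)
    unfolding has_field_derivative_iff tendsto_at_iff_sequentially by (auto simp: o_def)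
  have bd: "\<bar>(e t x - e 0 x) / t\<bar> \<le> w x" if "x \<in> space M" "\<bar>t\<bar> < \<epsilon>" "t \<noteq> 0" for t x
    using bound[OF that(1,2)] that(3) by (simp add: abs_divide field_simps)
  have m: "(\<lambda>x. (e t x - e 0 x) / t) \<in> borel_measurable M" if "\<bar>t\<bar> < \<epsilon>" for t
    using meas[OF that] meas[of 0] \<epsilon> by auto
  have f_meas: "f \<in> borel_measurable M"
  proof (rule borel_measurable_LIMSEQ_real)
    \<comment> \<open>Any null sequence without zeros shows that \<open>f\<close> is measurable; the
      factor \<epsilon> / 2 keeps this one strictly inside the range of \<open>meas\<close>.\<close>
    let ?X = "\<lambda>n. (\<epsilon> / 2) * inverse (real (Suc n))"
    have X0: "?X \<longlonglongrightarrow> 0" using tendsto_mult_right_zero[OF LIMSEQ_inverse_real_of_nat] .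
    show "(\<lambda>n. (e (?X n) x - e 0 x) / ?X n) \<longlonglongrightarrow> f x" if "x \<in> space M" for x
      by (rule lim[OF X0 _ that]) (use \<epsilon> in auto)
    have "\<bar>?X n\<bar> < \<epsilon>" for n
    proof -
      have "inverse (real (Suc n)) \<le> 1" "0 \<le> inverse (real (Suc n))" by (auto simp: field_simps)
      then have "0 \<le> ?X n" "?X n \<le> \<epsilon> / 2" using \<epsilon> mult_left_le[of "inverse (real (Suc n))" "\<epsilon> / 2"] by auto
      then show ?thesis using \<epsilon> by linarith
    qed
    then show "(\<lambda>x. (e (?X n) x - e 0 x) / ?X n) \<in> borel_measurable M" for n by (rule m)
  qed
  assume i0: "integrable M (e 0)"
  have int: "integrable M (e t)" if "\<bar>t\<bar> < \<epsilon>" for t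
  proof -
    have "integrable M (\<lambda>x. e t x - e 0 x)"
      by (rule integrable_difference[OF w meas[OF that] meas bound[OF _ that]]) (use \<epsilon> in auto)
    from Bochner_Integration.integrable_add[OF this i0] show ?thesis by simp
  qed
  show ?thesis
    unfolding has_field_derivative_iff tendsto_at_iff_sequentially
  proof (intro allI impI)
    fix X :: "nat \<Rightarrow> real" assume X: "\<forall>i. X i \<in> UNIV - {0}" "X \<longlonglongrightarrow> 0"
    obtain N where N: "\<And>n. n \<ge> N \<Longrightarrow> \<bar>X n\<bar> < \<epsilon>"
      using X(2) \<epsilon> unfolding LIMSEQ_def by (auto simp: dist_real_def)
    let ?Y = "\<lambda>n. X (n + N)"
    have Y0: "?Y \<longlonglongrightarrow> 0" by (rule LIMSEQ_ignore_initial_segment[OF X(2)])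
    have Y: "?Y n \<noteq> 0" "\<bar>?Y n\<bar> < \<epsilon>" for n using X(1) N by auto
    have "(\<lambda>n. \<integral>x. (e (?Y n) x - e 0 x) / ?Y n \<partial>M) \<longlonglongrightarrow> (\<integral>x. f x \<partial>M)"
      by (rule integral_dominated_convergence[OF f_meas m w])
        (use Y lim[OF Y0] bd in auto)
    moreover have "(\<integral>x. (e (?Y n) x - e 0 x) / ?Y n \<partial>M) = ((\<integral>x. e (?Y n) x \<partial>M) - (\<integral>x. e 0 x \<partial>M)) / (?Y n - 0)" for n
      using int[OF Y(2)] i0 by simp
    ultimately have "(\<lambda>n. ((\<integral>x. e (?Y n) x \<partial>M) - (\<integral>x. e 0 x \<partial>M)) / (?Y n - 0)) \<longlonglongrightarrow> (\<integral>x. f x \<partial>M)"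
      by (simp only:)
    then show "((\<lambda>t. ((\<integral>x. e t x \<partial>M) - (\<integral>x. e 0 x \<partial>M)) / (t - 0)) \<circ> X) \<longlonglongrightarrow> (\<integral>x. f x \<partial>M)"
      unfolding o_def by (rule LIMSEQ_offset[of "\<lambda>n. ((\<integral>x. e (X n) x \<partial>M) - (\<integral>x. e 0 x \<partial>M)) / (X n - 0)" N])
  qed
qed

text \<open>The integral of \<open>h (x + t *\<^sub>R v)\<close> does not depend on t by translation
  invariance; its derivative at 0, taken under the integral, is the integral in question.\<close>

lemma integral_directional_derivative:
  fixes h :: "'b::euclidean_space \<Rightarrow> real"
  assumes der: "\<And>x. (h has_derivative h' x) (at x)" and cont: "continuous_on UNIV (\<lambda>x. h' x v)"
    and K: "compact K" and zero: "\<And>x. x \<notin> K \<Longrightarrow> h x = 0"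
  shows "(\<integral>x. h' x v \<partial>lborel) = 0" and "integrable lborel (\<lambda>x. h' x v)"
proof -
  have h'0: "h' x v = 0" if "x \<notin> K" for x
    by (rule D_eq_zero[OF open_Compl[OF compact_imp_closed[OF K]] _ _ der, of x 0]) (use that zero in auto)
  obtain B0 where B0: "\<And>x. x \<in> K \<Longrightarrow> \<bar>h' x v\<bar> \<le> B0"
    using compact_real_bound[OF continuous_on_subset[OF cont subset_UNIV] K] by blast
  define B where "B = max 0 B0"
  have B: "\<bar>h' x v\<bar> \<le> B" "B \<ge> 0" for x using B0[of x] h'0[of x] by (cases "x \<in> K"; simp add: B_def)+
  obtain R0 where R0: "\<And>x. x \<in> K \<Longrightarrow> norm x \<le> R0" using compact_imp_bounded[OF K] by (auto simp: bounded_iff)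
  \<comment> \<open>The ball contains \<open>K\<close> and all its translates by -t v with t of
    modulus below 1, so outside it the increment vanishes.\<close>
  define w where "w = (\<lambda>x. B * indicator (cball (0::'b) (R0 + norm v)) x)"
  have hc: "continuous_on UNIV h"
    using der by (auto intro!: continuous_at_imp_continuous_on has_derivative_continuous)
  have line: "((\<lambda>s. h (x + s *\<^sub>R v)) has_real_derivative h' (x + t *\<^sub>R v) v) (at t)" for x t
  proof -
    have "((\<lambda>s. h (x + s *\<^sub>R v)) has_derivative (\<lambda>a. h' (x + t *\<^sub>R v) (a *\<^sub>R v))) (at t)"
      by (rule has_derivative_compose[where f = "\<lambda>s. x + s *\<^sub>R v", OF _ der]) (auto intro!: derivative_eq_intros)
    then show ?thesis
      by (simp add: has_field_derivative_def linear_scale[OF has_derivative_linear[OF der]] mult_commute_abs)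
  qed
  have bound: "\<bar>h (x + t *\<^sub>R v) - h x\<bar> \<le> \<bar>t\<bar> * w x" if t: "\<bar>t\<bar> < 1" for x t
  proof (cases "norm x \<le> R0 + norm v")
    case True
    have "norm (h (x + t *\<^sub>R v) - h (x + 0 *\<^sub>R v)) \<le> B * norm (t - 0)"
      by (rule field_differentiable_bound[of UNIV "\<lambda>s. h (x + s *\<^sub>R v)" "\<lambda>s. h' (x + s *\<^sub>R v) v"])
        (use line B in auto)
    then show ?thesis using True by (simp add: w_def mult.commute)
  next
    case False
    have "norm (t *\<^sub>R v) \<le> norm v" using t mult_right_mono[of "\<bar>t\<bar>" 1 "norm v"] by simp
    then have "norm (x + t *\<^sub>R v) > R0" using False norm_triangle_ineq4[of "x + t *\<^sub>R v" "t *\<^sub>R v"] by simp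
    then have "x + t *\<^sub>R v \<notin> K" "x \<notin> K" using R0[of "x + t *\<^sub>R v"] R0[of x] False norm_ge_zero[of v] by force+
    then show ?thesis using False by (simp add: zero w_def)
  qed
  have w: "integrable lborel w"
    unfolding w_def by (intro integrable_mult_right integrable_real_indicator) (auto simp: emeasure_lborel_cball_finite[unfolded infinity_ennreal_def])
  have int_h: "integrable lborel h"
  proof -
    have "integrable lborel (\<lambda>x. indicator K x *\<^sub>R h x)"
      by (rule borel_integrable_compact[OF K continuous_on_subset[OF hc]]) simp
    moreover have "(\<lambda>x. indicator K x *\<^sub>R h x) = h" by (auto simp: fun_eq_iff zero indicator_def)
    ultimately show ?thesis by simp
  qed
  have trans: "(\<integral>x. h (x + t *\<^sub>R v) \<partial>lborel) = (\<integral>x. h x \<partial>lborel)" for t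
  proof -
    have "(\<integral>x. h x \<partial>lborel) = (\<integral>x. h x \<partial>distr lborel borel ((+) (t *\<^sub>R v)))" by (simp add: lborel_distr_plus)
    also have "\<dots> = (\<integral>x. h (t *\<^sub>R v + x) \<partial>lborel)"
      by (rule integral_distr) (use hc in \<open>auto intro: borel_measurable_continuous_onI\<close>)
    finally show ?thesis by (simp add: add.commute)
  qed
  have "((\<lambda>t. \<integral>x. h (x + t *\<^sub>R v) \<partial>lborel) has_real_derivative (\<integral>x. h' x v \<partial>lborel)) (at 0)"
  proof (rule derivative_under_integral[OF zero_less_one w])
    show "(\<lambda>x. h (x + t *\<^sub>R v)) \<in> borel_measurable lborel" for t
      by (simp, intro borel_measurable_continuous_onI continuous_on_compose2[OF hc] continuous_intros) simp
    show "((\<lambda>t. h (x + t *\<^sub>R v)) has_real_derivative h' x v) (at 0)" for x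
      using line[of x 0] by simp
  qed (use bound int_h in auto)
  then show "(\<integral>x. h' x v \<partial>lborel) = 0"
    unfolding trans using DERIV_unique DERIV_const by blast
  show "integrable lborel (\<lambda>x. h' x v)"
  proof -
    have "integrable lborel (\<lambda>x. indicator K x *\<^sub>R h' x v)"
      by (rule borel_integrable_compact[OF K continuous_on_subset[OF cont]]) simp
    moreover have "(\<lambda>x. indicator K x *\<^sub>R h' x v) = (\<lambda>x. h' x v)" by (auto simp: fun_eq_iff h'0 indicator_def)
    ultimately show ?thesis by simp
  qed
qed

text \<open>Extension by zero is C^1 on the whole space, because the compact support stays inside
  \<open>S\<close>. Each component is then differentiated along its own axis.\<close>

lemma integral_divergence:
  fixes W :: "real ^ 'm::finite \<Rightarrow> real ^ 'm"
  assumes S: "open S" and W: "C1 S W" and K: "compact K" "K \<subseteq> S" and zero: "\<And>x. x \<in> S - K \<Longrightarrow> W x = 0"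
  shows "(\<integral>x. indicator S x * tr (D W x) \<partial>lborel) = 0"
proof -
  define h where "h = (\<lambda>k x. if x \<in> S then W x $ k else 0)"
  define h' where "h' = (\<lambda>k x v. if x \<in> S then D W x v $ k else 0)"
  have opK: "open (- K)" using K by (simp add: compact_imp_closed open_Compl)
  have DW0: "D W y v = 0" if "y \<in> S - K" for y v
    by (rule D_eq_zero[OF _ that zero D_works[OF C1_differentiable[OF W S]]])
      (use S opK that in \<open>auto simp: Diff_eq\<close>)
  have der: "(h k has_derivative h' k x) (at x)" for k x
  proof (cases "x \<in> S")
    case True
    have "((\<lambda>x. W x $ k) has_derivative (\<lambda>v. D W x v $ k)) (at x)"
      by (intro has_derivative_vec_nth D_works C1_differentiable[OF W S True])
    then have "(h k has_derivative (\<lambda>v. D W x v $ k)) (at x)"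
      by (rule has_derivative_transform_within_open[OF _ S True]) (simp add: h_def)
    then show ?thesis using True by (simp add: h'_def[abs_def])
  next
    case False
    have "((\<lambda>_. 0) has_derivative (\<lambda>_. 0)) (at x)" by simp
    then have "(h k has_derivative (\<lambda>_. 0)) (at x)"
      by (rule has_derivative_transform_within_open[OF _ opK]) (use False K zero in \<open>auto simp: h_def\<close>)
    then show ?thesis using False by (simp add: h'_def[abs_def])
  qed
  have cont: "continuous_on UNIV (\<lambda>x. h' k x v)" for k v
  proof -
    have "continuous_on S (\<lambda>x. D W x v $ k)"
      by (intro continuous_intros C1_continuous_D[OF W S])
    then have "continuous_on S (\<lambda>x. h' k x v)" by (rule continuous_on_eq) (simp add: h'_def)
    moreover have "continuous_on (- K) (\<lambda>x. h' k x v)"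
      by (rule continuous_on_eq[OF continuous_on_const[of _ 0]]) (auto simp: h'_def DW0)
    ultimately have "continuous_on (S \<union> - K) (\<lambda>x. h' k x v)"
      using S opK by (intro continuous_on_open_Un)
    moreover have "S \<union> - K = UNIV" using K by auto
    ultimately show ?thesis by simp
  qed
  have z: "h k x = 0" if "x \<notin> K" for k x using that zero by (auto simp: h_def)
  have "(\<integral>x. indicator S x * tr (D W x) \<partial>lborel) = (\<integral>x. (\<Sum>k\<in>UNIV. h' k x (axis k 1)) \<partial>lborel)"
    by (rule Bochner_Integration.integral_cong) (auto simp: h'_def tr_def indicator_def)
  also have "\<dots> = 0"
    by (subst Bochner_Integration.integral_sum)
      (auto simp: integral_directional_derivative[OF der cont K(1) z])
  finally show ?thesis .
qed

section \<open>Bump functions supported in coordinate balls\<close>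

lemma has_real_derivative_max0_square:
  "((\<lambda>s. (max 0 s)\<^sup>2) has_real_derivative 2 * max 0 (s::real)) (at s)"
proof -
  consider "s > 0" | "s < 0" | "s = 0" by linarith
  then show ?thesis
  proof cases
    case 1
    have "((\<lambda>s. s\<^sup>2) has_real_derivative 2 * s) (at s)" by (auto intro!: derivative_eq_intros)
    then have "((\<lambda>s. (max 0 s)\<^sup>2) has_real_derivative 2 * s) (at s)"
      by (rule has_field_derivative_transform_within_open[where S = "{0<..}"]) (use 1 in auto)
    then show ?thesis using 1 by simp
  next
    case 2
    have "((\<lambda>s. (max 0 s)\<^sup>2) has_real_derivative 0) (at s)"
      by (rule has_field_derivative_transform_within_open[OF DERIV_const[of 0], where S = "{..<0}"]) (use 2 in auto)
    then show ?thesis using 2 by simp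
  next
    case 3
    have "((\<lambda>s::real. (max 0 s)\<^sup>2 / s) \<longlongrightarrow> 0) (at 0)"
    proof (rule Lim_null_comparison)
      show "\<forall>\<^sub>F s::real in at 0. norm ((max 0 s)\<^sup>2 / s) \<le> \<bar>s\<bar>"
        by (auto simp: eventually_at_filter max_def power2_eq_square)
      show "((\<lambda>s::real. \<bar>s\<bar>) \<longlongrightarrow> 0) (at 0)" by (rule tendsto_eq_intros refl | simp)+
    qed
    then show ?thesis using 3 by (simp add: has_field_derivative_iff)
  qed
qed

text \<open>Squaring the positive part removes its corner at 0, so this is C^1. It is positive on
  \<open>chart_ball\<close> and vanishes off \<open>chart_cball\<close>.\<close>

definition bump :: "('a, 'm::finite) chart \<Rightarrow> real ^ 'm \<Rightarrow> real \<Rightarrow> 'a \<Rightarrow> real" where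
  "bump c x r p = (if p \<in> fst c then (max 0 (r\<^sup>2 - (snd c p - x) \<bullet> (snd c p - x)))\<^sup>2 else 0)"

definition chart_ball :: "('a, 'm::finite) chart \<Rightarrow> real ^ 'm \<Rightarrow> real \<Rightarrow> 'a set" where
  "chart_ball c x r = {p \<in> fst c. snd c p \<in> ball x r}"

definition chart_cball :: "('a, 'm::finite) chart \<Rightarrow> real ^ 'm \<Rightarrow> real \<Rightarrow> 'a set" where
  "chart_cball c x r = {p \<in> fst c. snd c p \<in> cball x r}"

lemma bump_nonneg: "bump c x r p \<ge> 0"
  by (simp add: bump_def)

lemma bump_pos: "p \<in> chart_ball c x r \<Longrightarrow> bump c x r p > 0"
proof -
  assume p: "p \<in> chart_ball c x r"
  then have "norm (snd c p - x) < r" by (simp add: chart_ball_def dist_norm norm_minus_commute)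
  then have "(norm (snd c p - x))\<^sup>2 < r\<^sup>2" by (intro power_strict_mono) auto
  then show ?thesis using p by (simp add: bump_def chart_ball_def power2_norm_eq_inner max_def)
qed

lemma bump_zero: "\<lbrakk>r > 0; p \<notin> chart_cball c x r\<rbrakk> \<Longrightarrow> bump c x r p = 0"
proof -
  assume r: "r > 0" and p: "p \<notin> chart_cball c x r"
  show ?thesis
  proof (cases "p \<in> fst c")
    case True
    then have "norm (snd c p - x) > r" using p by (simp add: chart_cball_def dist_norm norm_minus_commute)
    then have "(norm (snd c p - x))\<^sup>2 > r\<^sup>2" using r by (intro power_strict_mono) auto
    then show ?thesis by (simp add: bump_def power2_norm_eq_inner max_def)
  qed (simp add: bump_def)
qed

lemma C1_bump_function:
  fixes F :: "real ^ 'm::finite \<Rightarrow> real ^ 'm"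
  assumes S: "open S" and F: "C1 S F"
  shows "C1 S (\<lambda>y. (max 0 (r\<^sup>2 - (F y - x) \<bullet> (F y - x)))\<^sup>2)"
proof (rule C1I[OF S])
  fix y assume y: "y \<in> S"
  let ?q = "\<lambda>y. r\<^sup>2 - (F y - x) \<bullet> (F y - x)"
  have "(?q has_derivative (\<lambda>h. - (2 * ((F y - x) \<bullet> D F y h)))) (at y)"
    by (rule derivative_eq_intros D_works C1_differentiable[OF F S y] refl)+ (simp add: fun_eq_iff inner_commute)
  from DERIV_compose_FDERIV[OF has_real_derivative_max0_square this]
  show "((\<lambda>y. (max 0 (?q y))\<^sup>2) has_derivative (\<lambda>h. - (2 * ((F y - x) \<bullet> D F y h)) * (2 * max 0 (?q y)))) (at y)" .
next
  show "continuous_on S (\<lambda>y. - (2 * ((F y - x) \<bullet> D F y h)) * (2 * max 0 (r\<^sup>2 - (F y - x) \<bullet> (F y - x))))" for h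
    by (intro continuous_intros C1_continuous_D[OF F S] Ck_continuous_on[OF F])
qed

lemma dirichlet_cong:
  assumes "open T" "x \<in> T" "\<And>y. y \<in> T \<Longrightarrow> U y = U' y" "\<And>y. y \<in> T \<Longrightarrow> V y = V' y"
  shows "dirichlet G U V x = dirichlet G U' V' x"
  using D_cong_open[of T x U U'] D_cong_open[of T x V V'] assms by (simp add: dirichlet_def covd_def)

lemma dirichlet_zero: "chart_metric S G \<Longrightarrow> x \<in> S \<Longrightarrow> dirichlet G (\<lambda>_. 0) V x = 0"
  by (simp add: dirichlet_def covd_def metric_trace_def linear_0[OF chart_metric.christoffel_linear2])

lemma (in chart_metric) dirichlet_sum:
  assumes x: "x \<in> S" and U: "\<And>i. i \<in> I \<Longrightarrow> U i differentiable (at x)"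
  shows "dirichlet G (\<lambda>y. \<Sum>i\<in>I. U i y) V x = (\<Sum>i\<in>I. dirichlet G (U i) V x)"
proof -
  have "((\<lambda>y. \<Sum>i\<in>I. U i y) has_derivative (\<lambda>h. \<Sum>i\<in>I. D (U i) x h)) (at x)"
    by (intro has_derivative_sum D_works U)
  from D_eqI[OF this] have "covd G (\<lambda>y. \<Sum>i\<in>I. U i y) x u = (\<Sum>i\<in>I. covd G (U i) x u)" for u
    by (simp add: covd_def linear_sum[OF christoffel_linear2[OF x]] sum.distrib)
  then have "dirichlet G (\<lambda>y. \<Sum>i\<in>I. U i y) V x = (\<Sum>a\<in>UNIV. \<Sum>b\<in>UNIV. \<Sum>i\<in>I.
      matrix_inv (G x) $ a $ b * bil (G x) (covd G (U i) x (axis a 1)) (covd G V x (axis b 1)))"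
    by (simp add: dirichlet_def metric_trace_def bil_sum sum_distrib_left)
  also have "\<dots> = (\<Sum>i\<in>I. dirichlet G (U i) V x)"
    unfolding dirichlet_def metric_trace_def
    by (subst sum.swap[of _ I], subst sum.swap[of _ I]) (simp add: sum.swap[of _ I])
  finally show ?thesis .
qed

context metric_manifold
begin

lemma chart_cball_eq: "\<lbrakk>c \<in> A; cball x r \<subseteq> cdom c\<rbrakk> \<Longrightarrow> chart_cball c x r = cinv c ` cball x r"
  unfolding chart_cball_def by (force simp: image_iff)

lemma compact_chart_cball: "\<lbrakk>c \<in> A; cball x r \<subseteq> cdom c\<rbrakk> \<Longrightarrow> compact (chart_cball c x r)"
  using homeo[of c] unfolding homeomorphism_def
  by (simp add: chart_cball_eq) (metis compact_cball compact_continuous_image continuous_on_subset)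

lemma open_chart_ball: "c \<in> A \<Longrightarrow> open (chart_ball c x r)"
  using continuous_open_preimage[of "fst c" "snd c" "ball x r"] homeo[of c] open_chart[of c]
  by (auto simp: chart_ball_def homeomorphism_def Int_def vimage_def)

lemma image_chart_cball: "\<lbrakk>c \<in> A; cball x r \<subseteq> cdom c\<rbrakk> \<Longrightarrow> snd c ` chart_cball c x r = cball x r"
  by (auto simp: chart_cball_eq image_image subset_iff image_iff)

text \<open>Requiring the closed coordinate balls to lie in the image of the chart makes the sets
  \<open>chart_cball\<close>, which carry the bumps, compact.\<close>

lemma finite_ball_cover:
  assumes "compact K"
  obtains P where "finite P" "\<And>c x r. (c, x, r) \<in> P \<Longrightarrow> c \<in> A \<and> r > 0 \<and> cball x r \<subseteq> cdom c"
    "K \<subseteq> (\<Union>(c, x, r)\<in>P. chart_ball c x r)"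
proof -
  define Q where "Q = {(c, x, r). c \<in> A \<and> r > 0 \<and> cball x r \<subseteq> cdom c}"
  have "p \<in> (\<Union>(c, x, r)\<in>Q. chart_ball c x r)" for p
  proof -
    let ?c = "chart_at A p"
    obtain r where "r > 0" "cball (snd ?c p) r \<subseteq> cdom ?c"
      using open_cdom[OF chart_at(1)] chart_in[OF chart_at(2)] open_contains_cball by metis
    then show ?thesis
      using chart_at[of p] by (intro UN_I[of "(?c, snd ?c p, r)"]) (auto simp: Q_def chart_ball_def)
  qed
  moreover have "open (case q of (c, x, r) \<Rightarrow> chart_ball c x r)" if "q \<in> Q" for q
    using that by (auto simp: Q_def open_chart_ball)
  ultimately obtain P where "P \<subseteq> Q" "finite P" "K \<subseteq> (\<Union>(c, x, r)\<in>P. chart_ball c x r)"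
    using compactE_image[OF assms, of Q "\<lambda>(c, x, r). chart_ball c x r"] by (metis UNIV_I subsetI)
  then show ?thesis by (intro that[of P]) (auto simp: Q_def)
qed

lemma continuous_on_volume_density: "c \<in> A \<Longrightarrow> continuous_on (cdom c) (\<lambda>x. sqrt \<bar>det (g c x)\<bar>)"
  by (rule Ck_continuous_on[OF chart_metric.C1_volume_density[OF chart_metric]])

section \<open>The volume measure\<close>

context
  fixes \<mu> :: "'a measure"
  assumes vol: "volume_measure A g \<mu>"
begin

lemma sets_\<mu> [measurable_cong]: "sets \<mu> = sets borel"
  using vol unfolding volume_measure_def by blast

lemma emeasure_\<mu>: "\<lbrakk>c \<in> A; B \<in> sets borel; B \<subseteq> fst c\<rbrakk> \<Longrightarrow>
    emeasure \<mu> B = (\<integral>\<^sup>+x\<in>snd c ` B. ennreal (sqrt \<bar>det (g c x)\<bar>) \<partial>lborel)"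
  using vol unfolding volume_measure_def by blast

lemma emeasure_chart_cball:
  assumes c: "c \<in> A" and r: "cball x r \<subseteq> cdom c"
  shows "emeasure \<mu> (chart_cball c x r) < \<infinity>"
proof -
  obtain B where "\<forall>y\<in>cball x r. \<bar>sqrt \<bar>det (g c y)\<bar>\<bar> \<le> B"
    using compact_real_bound[OF continuous_on_subset[OF continuous_on_volume_density[OF c] r] compact_cball] by blast
  then have B: "sqrt \<bar>det (g c y)\<bar> \<le> B" if "y \<in> cball x r" for y using that by force
  have "emeasure \<mu> (chart_cball c x r) = (\<integral>\<^sup>+y\<in>cball x r. ennreal (sqrt \<bar>det (g c y)\<bar>) \<partial>lborel)"
    unfolding image_chart_cball[OF c r, symmetric]
    by (rule emeasure_\<mu>[OF c]) (auto intro: borel_closed compact_imp_closed compact_chart_cball[OF c r],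
      simp add: chart_cball_def)
  also have "\<dots> \<le> (\<integral>\<^sup>+y. ennreal B * indicator (cball x r) y \<partial>lborel)"
    by (rule nn_integral_mono) (auto simp: B indicator_def intro!: ennreal_leI)
  also have "\<dots> = ennreal B * emeasure lborel (cball x r)"
    by (rule nn_integral_cmult_indicator) simp
  also have "\<dots> < \<infinity>" by (simp add: ennreal_mult_less_top emeasure_lborel_cball_finite[unfolded infinity_ennreal_def])
  finally show ?thesis .
qed

lemma emeasure_compact:
  assumes K: "compact K"
  shows "emeasure \<mu> K < \<infinity>"
proof -
  obtain P where P: "finite P" "\<And>c x r. (c, x, r) \<in> P \<Longrightarrow> c \<in> A \<and> r > 0 \<and> cball x r \<subseteq> cdom c"
    "K \<subseteq> (\<Union>(c, x, r)\<in>P. chart_ball c x r)" using finite_ball_cover[OF K] by blast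
  let ?C = "\<lambda>(c, x, r). chart_cball c x r"
  have C: "?C q \<in> sets \<mu>" if "q \<in> P" for q
    using P(2) that compact_chart_cball by (auto simp: sets_\<mu> intro!: borel_closed compact_imp_closed split: prod.split)
  have "K \<subseteq> (\<Union>q\<in>P. ?C q)"
  proof
    fix p assume p: "p \<in> K"
    obtain q where q: "q \<in> P" "p \<in> (case q of (c, x, r) \<Rightarrow> chart_ball c x r)"
      using subsetD[OF P(3) p] unfolding UN_iff by blast
    then have "p \<in> ?C q" by (cases q) (auto simp: chart_ball_def chart_cball_def)
    with q(1) show "p \<in> (\<Union>q\<in>P. ?C q)" by (rule UN_I)
  qed
  then have "emeasure \<mu> K \<le> emeasure \<mu> (\<Union>q\<in>P. ?C q)"
    using C P(1) by (intro emeasure_mono) auto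
  also have "\<dots> \<le> (\<Sum>q\<in>P. emeasure \<mu> (?C q))"
    using C P(1) by (intro emeasure_subadditive_finite) auto
  also have "\<dots> < \<infinity>" using P(1,2) emeasure_chart_cball by (auto split: prod.split)
  finally show ?thesis .
qed

lemma borel_measurable_\<mu>: "continuous_on UNIV f \<Longrightarrow> f \<in> borel_measurable \<mu>" for f :: "'a \<Rightarrow> real"
  using borel_measurable_continuous_onI[of f] by (simp add: measurable_cong_sets[OF sets_\<mu> refl])

lemma integrable_compact_support:
  fixes f :: "'a \<Rightarrow> real"
  assumes f: "continuous_on UNIV f" and K: "compact K" and zero: "\<And>p. p \<notin> K \<Longrightarrow> f p = 0"
  shows "integrable \<mu> f"
proof -
  obtain B where B: "\<And>p. p \<in> K \<Longrightarrow> \<bar>f p\<bar> \<le> B"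
    using compact_real_bound[OF continuous_on_subset[OF f subset_UNIV] K] by blast
  have "integrable \<mu> (\<lambda>p. B * indicator K p)"
    using emeasure_compact[OF K] K by (intro integrable_mult_right integrable_real_indicator)
      (auto simp: sets_\<mu> compact_imp_closed)
  then show ?thesis
  proof (rule Bochner_Integration.integrable_bound)
    show "f \<in> borel_measurable \<mu>" by (rule borel_measurable_\<mu>[OF f])
    have "norm (f p) \<le> norm (B * indicator K p)" for p
      using B[of p] zero[of p] by (cases "p \<in> K") auto
    then show "AE p in \<mu>. norm (f p) \<le> norm (B * indicator K p)" by simp
  qed
qed

text \<open>\<open>volume_measure\<close> speaks about sets only. It is recast as an equality of
  measures, between the restriction of \<mu> to the chart domain and the image under the inverse
  chart of Lebesgue measure with the volume density; integrals then transform by the general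
  rules.\<close>

lemma integral_chart:
  fixes f :: "'a \<Rightarrow> real"
  assumes c: "c \<in> A" and f: "f \<in> borel_measurable borel" and zero: "\<And>p. p \<notin> fst c \<Longrightarrow> f p = 0"
  shows "(\<integral>p. f p \<partial>\<mu>) = (\<integral>x. indicator (cdom c) x * (sqrt \<bar>det (g c x)\<bar> * f (cinv c x)) \<partial>lborel)"
proof -
  \<comment> \<open>A measurable total version of the inverse chart. Its value outside the image of
    the chart is harmless, since the density \<open>\<rho>\<close> is 0 there.\<close>
  define T where "T = (\<lambda>x. if x \<in> cdom c then cinv c x else undefined)"
  define \<rho> where "\<rho> = (\<lambda>x. indicator (cdom c) x *\<^sub>R sqrt \<bar>det (g c x)\<bar>)"
  have T: "T \<in> borel_measurable borel"
    unfolding T_def using open_cdom[OF c] homeo[OF c]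
    by (intro borel_measurable_continuous_on_if) (auto simp: homeomorphism_def)
  have \<rho>: "\<rho> \<in> borel_measurable borel"
    unfolding \<rho>_def using open_cdom[OF c]
    by (intro borel_measurable_continuous_on_indicator continuous_on_volume_density[OF c]) auto
  have fc: "fst c \<in> sets \<mu>" using open_chart[OF c] by (simp add: sets_\<mu>)
  have eq: "density \<mu> (indicator (fst c)) = distr (density lborel \<rho>) borel T"
  proof (rule measure_eqI)
    show "sets (density \<mu> (indicator (fst c))) = sets (distr (density lborel \<rho>) borel T)" by (simp add: sets_\<mu>)
    fix B assume "B \<in> sets (density \<mu> (indicator (fst c)))"
    then have B: "B \<in> sets borel" by (simp add: sets_\<mu>)
    have TB: "T -` B \<in> sets borel" using measurable_sets[OF T B] by simp
    have "emeasure (density \<mu> (indicator (fst c))) B = emeasure \<mu> (fst c \<inter> B)"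
      by (rule emeasure_restricted) (use fc B in \<open>auto simp: sets_\<mu>\<close>)
    also have "\<dots> = (\<integral>\<^sup>+x\<in>snd c ` (fst c \<inter> B). ennreal (sqrt \<bar>det (g c x)\<bar>) \<partial>lborel)"
      by (rule emeasure_\<mu>[OF c]) (use fc B in \<open>auto simp: sets_\<mu>\<close>)
    also have "\<dots> = (\<integral>\<^sup>+x. ennreal (\<rho> x) * indicator (T -` B) x \<partial>lborel)"
    proof (rule nn_integral_cong)
      fix x
      have "x \<in> snd c ` (fst c \<inter> B) \<longleftrightarrow> x \<in> cdom c \<and> cinv c x \<in> B"
        using c by (force simp: image_iff)
      then show "ennreal (sqrt \<bar>det (g c x)\<bar>) * indicator (snd c ` (fst c \<inter> B)) x = ennreal (\<rho> x) * indicator (T -` B) x"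
        by (auto simp: \<rho>_def T_def indicator_def)
    qed
    also have "\<dots> = emeasure (density lborel \<rho>) (T -` B)"
      by (rule emeasure_density[symmetric]) (use \<rho> TB in auto)
    also have "\<dots> = emeasure (distr (density lborel \<rho>) borel T) B"
      by (subst emeasure_distr) (use T B in \<open>auto simp: measurable_def\<close>)
    finally show "emeasure (density \<mu> (indicator (fst c))) B = emeasure (distr (density lborel \<rho>) borel T) B" .
  qed
  have f\<mu>: "f \<in> borel_measurable \<mu>" using f by (simp add: measurable_cong_sets[OF sets_\<mu> refl])
  have "(\<integral>p. f p \<partial>\<mu>) = (\<integral>p. indicator (fst c) p *\<^sub>R f p \<partial>\<mu>)"
    by (rule Bochner_Integration.integral_cong) (auto simp: zero indicator_def)
  also have "\<dots> = (\<integral>p. f p \<partial>density \<mu> (\<lambda>p. ennreal (indicator (fst c) p)))"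
    by (rule integral_density[symmetric]) (use f\<mu> fc in auto)
  also have "density \<mu> (\<lambda>p. ennreal (indicator (fst c) p)) = distr (density lborel \<rho>) borel T"
    unfolding ennreal_indicator using eq by simp
  also have "(\<integral>p. f p \<partial>distr (density lborel \<rho>) borel T) = (\<integral>x. f (T x) \<partial>density lborel \<rho>)"
    by (rule integral_distr) (use T f in auto)
  also have "\<dots> = (\<integral>x. \<rho> x *\<^sub>R f (T x) \<partial>lborel)"
    by (rule integral_density) (use \<rho> measurable_compose[OF T f] in \<open>auto simp: \<rho>_def\<close>)
  also have "\<dots> = (\<integral>x. indicator (cdom c) x * (sqrt \<bar>det (g c x)\<bar> * f (cinv c x)) \<partial>lborel)"
    by (rule Bochner_Integration.integral_cong) (auto simp: \<rho>_def T_def indicator_def)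
  finally show ?thesis .
qed

end

section \<open>Partition of unity\<close>

lemma cinv_transition: "\<lbrakk>c \<in> A; d \<in> A; x \<in> overlap c d\<rbrakk> \<Longrightarrow> cinv d (transition c d x) = cinv c x"
  by (auto simp: overlap_eq transition_def)

text \<open>In another chart two open sets cover everything: the overlap, where the bump is an
  explicit function of the transition map, and the complement of the closed coordinate ball, where
  it is 0. The ball is closed since it is compact in a Hausdorff space.\<close>

lemma C1_bump:
  assumes c: "c \<in> A" and d: "d \<in> A" and r: "r > 0" "cball x r \<subseteq> cdom c"
  shows "C1 (cdom d) (\<lambda>y. bump c x r (cinv d y))"
proof (rule C1_local[OF open_cdom[OF d]])
  fix y assume y: "y \<in> cdom d"
  let ?O = "overlap d c" and ?N = "{y \<in> cdom d. cinv d y \<in> - chart_cball c x r}"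
  have "closed (chart_cball c x r)" by (intro compact_imp_closed compact_chart_cball c r)
  then have N: "open ?N"
    using continuous_open_preimage[of "cdom d" "cinv d" "- chart_cball c x r"] homeo[OF d] open_cdom[OF d]
    by (auto simp: homeomorphism_def Int_def vimage_def)
  show "\<exists>T. open T \<and> y \<in> T \<and> C1 T (\<lambda>y. bump c x r (cinv d y))"
  proof (cases "cinv d y \<in> fst c")
    case True
    have "C1 ?O (\<lambda>y. (max 0 (r\<^sup>2 - (transition d c y - x) \<bullet> (transition d c y - x)))\<^sup>2)"
      by (intro C1_bump_function open_overlap c d smooth_on_C1 smooth_transition)
    then have "C1 ?O (\<lambda>y. bump c x r (cinv d y))"
      by (rule C1_cong[OF open_overlap[OF d c]]) (use c d in \<open>auto simp: overlap_eq bump_def transition_def\<close>)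
    then show ?thesis using True y open_overlap[OF d c] by (intro exI[of _ ?O]) (simp add: overlap_eq c d)
  next
    case False
    have "C1 ?N (\<lambda>y. bump c x r (cinv d y))"
      by (rule C1_cong[OF N C1_const[OF N, of 0]]) (simp add: bump_zero r)
    then show ?thesis using False y N by (intro exI[of _ ?N]) (auto simp: chart_cball_def)
  qed
qed

definition vanishes_outside :: "'a set \<Rightarrow> ('a, 'm, real ^ 'm) field \<Rightarrow> bool" where
  "vanishes_outside K U \<longleftrightarrow> (\<forall>c\<in>A. \<forall>p\<in>fst c - K. U c (snd c p) = 0)"

lemma open_complement_in_chart:
  assumes c: "c \<in> A" and K: "compact K"
  shows "open {y \<in> cdom c. cinv c y \<notin> K}"
  using continuous_open_preimage[of "cdom c" "cinv c" "- K"] homeo[OF c] open_cdom[OF c] K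
  by (auto simp: homeomorphism_def Int_def vimage_def compact_imp_closed open_Compl)

text \<open>The density involves derivatives of \<open>U\<close>, so \<open>U\<close> has to vanish
  near p; it does, because the complement of a compact set is open.\<close>

lemma dirichlet_at_vanishes:
  assumes K: "compact K" and U: "vanishes_outside K U" and p: "p \<notin> K"
  shows "dirichlet_at U V p = 0"
proof -
  let ?c = "chart_at A p"
  have "dirichlet (g ?c) (U ?c) (V ?c) (snd ?c p) = dirichlet (g ?c) (\<lambda>_. 0) (V ?c) (snd ?c p)"
  proof (rule dirichlet_cong[OF open_complement_in_chart[OF chart_at(1) K]])
    show "snd ?c p \<in> {y \<in> cdom ?c. cinv ?c y \<notin> K}" using p chart_at[of p] by simp
    fix y assume y: "y \<in> {y \<in> cdom ?c. cinv ?c y \<notin> K}"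
    have "U ?c (snd ?c (cinv ?c y)) = 0"
      using U y chart_at[of p] unfolding vanishes_outside_def by fastforce
    then show "U ?c y = 0" using y chart_at[of p] by simp
  qed simp
  then show ?thesis
    using dirichlet_zero[OF chart_metric[OF chart_at(1)] chart_in[OF chart_at(2)]] by (simp add: dirichlet_at_def)
qed

lemma C1_field_diff: "\<lbrakk>C1_field A U; c \<in> A; x \<in> cdom c\<rbrakk> \<Longrightarrow> U c differentiable (at x)"
  unfolding C1_field_def using C1_differentiable open_cdom by blast

text \<open>A partition of unity reduces the integral to fields supported in a single chart.\<close>

lemma integral_dirichlet_localize:
  assumes vol: "volume_measure A g \<mu>" and U: "C1_field A U" and V: "C1_field A V"
    and K: "compact K" and UK: "vanishes_outside K U"
    and local: "\<And>U' c C. \<lbrakk>C1_field A U'; \<And>d x. \<lbrakk>d \<in> A; x \<in> cdom d\<rbrakk> \<Longrightarrow> \<exists>a. U' d x = a *\<^sub>R U d x; c \<in> A;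
       compact C; C \<subseteq> fst c; vanishes_outside C U'\<rbrakk> \<Longrightarrow> (\<integral>p. dirichlet_at U' V p \<partial>\<mu>) = 0"
  shows "(\<integral>p. dirichlet_at U V p \<partial>\<mu>) = 0"
proof -
  obtain P where P: "finite P" "\<And>c x r. (c, x, r) \<in> P \<Longrightarrow> c \<in> A \<and> r > 0 \<and> cball x r \<subseteq> cdom c"
    "K \<subseteq> (\<Union>(c, x, r)\<in>P. chart_ball c x r)" using finite_ball_cover[OF K] by blast
  define b :: "('a, 'm) chart \<times> (real ^ 'm) \<times> real \<Rightarrow> 'a \<Rightarrow> real"
    where "b = (\<lambda>(c, x, r). bump c x r)"
  define s where "s p = (\<Sum>q\<in>P. b q p)" for p
  have sK: "s p > 0" if pK: "p \<in> K" for p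
  proof -
    obtain q where q: "q \<in> P" "p \<in> (case q of (c, x, r) \<Rightarrow> chart_ball c x r)"
      using subsetD[OF P(3) pK] unfolding UN_iff by blast
    then have "b q p > 0" by (auto simp: b_def bump_pos split: prod.splits)
    then show ?thesis unfolding s_def using P(1) q(1)
      by (intro sum_pos2[of _ q]) (auto simp: b_def bump_nonneg split: prod.splits)
  qed
  have bC1: "C1 (cdom d) (\<lambda>y. b q (cinv d y))" if "q \<in> P" "d \<in> A" for q d
    using P(2) that by (auto simp: b_def C1_bump simp del: Ck.simps split: prod.splits)
  have sC1: "C1 (cdom d) (\<lambda>y. s (cinv d y))" if "d \<in> A" for d
    unfolding s_def by (intro C1_sum open_cdom that bC1)
  \<comment> \<open>Normalised bumps times \<open>U\<close>. Where \<open>s\<close> is 0 the inverse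
    has the default value 0, but there \<open>U\<close> is 0 as well: \<open>s\<close> is positive
    on \<open>K\<close>. Regularity is checked on the two open sets given by positivity of
    \<open>s\<close> and by the complement of \<open>K\<close>.\<close>
  define W where "W q d y = (inverse (s (cinv d y)) * b q (cinv d y)) *\<^sub>R U d y" for q d y
  have U0: "U d y = 0" if "d \<in> A" "y \<in> cdom d" "cinv d y \<notin> K" for d y
  proof -
    have "U d (snd d (cinv d y)) = 0" using UK that unfolding vanishes_outside_def by (meson DiffI cinv_in)
    then show ?thesis using that by simp
  qed
  have W: "C1_field A (W q)" if q: "q \<in> P" for q
    unfolding C1_field_def
  proof (intro conjI ballI)
    fix d assume d: "d \<in> A"
    note od = open_cdom[OF d]
    show "C1 (cdom d) (W q d)"
    proof (rule C1_local[OF od])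
      fix y assume y: "y \<in> cdom d"
      show "\<exists>T. open T \<and> y \<in> T \<and> C1 T (W q d)"
      proof (cases "cinv d y \<in> K")
        case True
        let ?T = "{z \<in> cdom d. s (cinv d z) \<in> {0<..}}"
        have T: "open ?T"
          using continuous_open_preimage[OF Ck_continuous_on[OF sC1[OF d]] od, of "{0<..}"]
          by (auto simp: Int_def vimage_def)
        have sub: "C1 ?T f" if "C1 (cdom d) f" for f :: "real ^ 'm \<Rightarrow> 'c::real_normed_vector"
          by (rule C1_subset[OF that od T]) auto
        have "C1 ?T (\<lambda>z. inverse (s (cinv d z)) *\<^sub>R (b q (cinv d z) *\<^sub>R U d z))"
          by (intro C1_scaleR T C1_inverse sub sC1 bC1 q d) (use U d in \<open>auto simp: C1_field_def simp del: Ck.simps\<close>)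
        then have "C1 ?T (W q d)" by (rule C1_cong[OF T]) (simp add: W_def)
        then show ?thesis using T True y sK by (intro exI[of _ ?T]) auto
      next
        case False
        let ?T = "{z \<in> cdom d. cinv d z \<notin> K}"
        have T: "open ?T" by (rule open_complement_in_chart[OF d K])
        have "C1 ?T (W q d)"
          by (rule C1_cong[OF T C1_const[OF T, of 0]]) (simp add: W_def U0 d)
        then show ?thesis using T False y by (intro exI[of _ ?T]) auto
      qed
    qed
  next
    fix c d x assume c: "c \<in> A" and d: "d \<in> A" and x: "x \<in> overlap c d"
    have "U d (transition c d x) = jacobian (transition c d) (at x) *v U c x"
      using U c d x unfolding C1_field_def by blast
    then show "W q d (transition c d x) = jacobian (transition c d) (at x) *v W q c x"
      by (simp add: W_def cinv_transition[OF c d x] matrix_vector_mult_scaleR)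
  qed
  have sumW: "U d y = (\<Sum>q\<in>P. W q d y)" if "d \<in> A" "y \<in> cdom d" for d y
  proof -
    have "(\<Sum>q\<in>P. W q d y) = (inverse (s (cinv d y)) * s (cinv d y)) *\<^sub>R U d y"
      by (simp add: W_def s_def flip: sum_distrib_left scaleR_left.sum)
    then show ?thesis using U0[OF that] sK[of "cinv d y"] by (cases "cinv d y \<in> K") auto
  qed
  have WK: "vanishes_outside K (W q)" for q
    unfolding vanishes_outside_def by (auto simp: W_def U0)
  have int: "integrable \<mu> (dirichlet_at (W q) V)" if "q \<in> P" for q
    by (rule integrable_compact_support[OF vol continuous_on_dirichlet_at[OF W[OF that] V] K])
      (rule dirichlet_at_vanishes[OF K WK])
  have "dirichlet_at U V p = (\<Sum>q\<in>P. dirichlet_at (W q) V p)" for p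
  proof -
    let ?c = "chart_at A p"
    interpret chart_metric "cdom ?c" "g ?c" by (rule chart_metric[OF chart_at(1)])
    have x: "snd ?c p \<in> cdom ?c" by (rule chart_in[OF chart_at(2)])
    have "dirichlet (g ?c) (U ?c) (V ?c) (snd ?c p) = dirichlet (g ?c) (\<lambda>y. \<Sum>q\<in>P. W q ?c y) (V ?c) (snd ?c p)"
      by (rule dirichlet_cong[OF open_S x]) (rule sumW[OF chart_at(1)], assumption, rule refl)
    then show ?thesis unfolding dirichlet_at_def
      using dirichlet_sum[OF x, of P "\<lambda>q. W q ?c"] C1_field_diff[OF W chart_at(1) x] by simp
  qed
  then have "(\<integral>p. dirichlet_at U V p \<partial>\<mu>) = (\<Sum>q\<in>P. \<integral>p. dirichlet_at (W q) V p \<partial>\<mu>)"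
    using int by simp
  also have "\<dots> = 0"
  proof (rule sum.neutral, rule ballI)
    fix q assume q: "q \<in> P"
    obtain c x r where qe: "q = (c, x, r)" by (cases q)
    have cr: "c \<in> A" "r > 0" "cball x r \<subseteq> cdom c" using P(2) q qe by auto
    show "(\<integral>p. dirichlet_at (W q) V p \<partial>\<mu>) = 0"
    proof (rule local[OF W[OF q] _ cr(1) compact_chart_cball[OF cr(1,3)]])
      show "chart_cball c x r \<subseteq> fst c" by (auto simp: chart_cball_def)
      \<comment> \<open>Pointwise multiples of \<open>U\<close> inherit its orthogonality to \<xi>,
        which the argument inside one chart requires.\<close>
      show "\<exists>a. W q d x = a *\<^sub>R U d x" for d x unfolding W_def by blast
      show "vanishes_outside (chart_cball c x r) (W q)"
        unfolding vanishes_outside_def W_def qe b_def using bump_zero[OF cr(2), of _ c x] by auto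
    qed
  qed
  finally show ?thesis .
qed

end

section \<open>The first variation of the energy\<close>

text \<open>Increments from t = 0 are integrable, so all the \<open>e t\<close> fail to be
  integrable together with \<open>e 0\<close>, and their integrals have the default value 0.\<close>

lemma derivative_under_nonexistent_integral:
  fixes e :: "real \<Rightarrow> 'b \<Rightarrow> real"
  assumes \<epsilon>: "\<epsilon> > 0" and w: "integrable M w"
    and meas: "\<And>t. \<bar>t\<bar> < \<epsilon> \<Longrightarrow> e t \<in> borel_measurable M"
    and bound: "\<And>t x. \<lbrakk>x \<in> space M; \<bar>t\<bar> < \<epsilon>\<rbrakk> \<Longrightarrow> \<bar>e t x - e 0 x\<bar> \<le> \<bar>t\<bar> * w x"
    and non: "\<not> integrable M (e 0)"
  shows "((\<lambda>t. \<integral>x. e t x \<partial>M) has_real_derivative 0) (at 0)"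
proof -
  have "\<not> integrable M (e t)" if "\<bar>t\<bar> < \<epsilon>" for t
  proof
    assume i: "integrable M (e t)"
    have "integrable M (\<lambda>x. e t x - e 0 x)"
      by (rule integrable_difference[OF w meas[OF that] meas bound[OF _ that]]) (use \<epsilon> in auto)
    from Bochner_Integration.integrable_diff[OF i this] non show False by simp
  qed
  then have z: "(\<integral>x. e t x \<partial>M) = 0" if "\<bar>t\<bar> < \<epsilon>" for t
    using that by (simp add: not_integrable_integral_eq)
  show ?thesis
    by (rule has_field_derivative_transform_within_open[OF DERIV_const[of 0], where S = "{-\<epsilon><..<\<epsilon>}"])
      (use \<epsilon> z in auto)
qed

lemma has_derivative_slice:
  assumes "f differentiable (at (t, x))"
  shows "((\<lambda>y. f (t, y)) has_derivative (\<lambda>h. D f (t, x) (0, h))) (at x)"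
    and "((\<lambda>s. f (s, x)) has_derivative (\<lambda>h. h *\<^sub>R D f (t, x) (1, 0))) (at t)"
proof -
  show "((\<lambda>y. f (t, y)) has_derivative (\<lambda>h. D f (t, x) (0, h))) (at x)"
    by (rule has_derivative_compose[where f = "\<lambda>y. (t, y)", OF _ D_works[OF assms]])
      (intro has_derivative_Pair has_derivative_const has_derivative_ident)
  have "((\<lambda>s. f (s, x)) has_derivative (\<lambda>h. D f (t, x) (h, 0))) (at t)"
    by (rule has_derivative_compose[where f = "\<lambda>s. (s, x)", OF _ D_works[OF assms]])
      (intro has_derivative_Pair has_derivative_const has_derivative_ident)
  moreover have "(\<lambda>h. D f (t, x) (h, 0)) = (\<lambda>h. h *\<^sub>R D f (t, x) (1, 0))"
  proof
    fix h
    have "D f (t, x) (h *\<^sub>R (1, 0)) = h *\<^sub>R D f (t, x) (1, 0)"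
      by (rule linear_scale[OF D_linear[OF assms]])
    then show "D f (t, x) (h, 0) = h *\<^sub>R D f (t, x) (1, 0)"
      by (simp only: scaleR_Pair real_scaleR_def mult_1_right scaleR_zero_right)
  qed
  ultimately show "((\<lambda>s. f (s, x)) has_derivative (\<lambda>h. h *\<^sub>R D f (t, x) (1, 0))) (at t)" by (rule subst[rotated])
qed

section \<open>One-parameter families of fields in a chart\<close>

locale chart_variation = chart_metric S G for S :: "(real ^ 'm::finite) set" and G +
  fixes \<epsilon> :: real and W :: "real \<Rightarrow> real ^ 'm \<Rightarrow> real ^ 'm"
  assumes smooth_W: "smooth_on ({-\<epsilon><..<\<epsilon>} \<times> S) (\<lambda>(t, x). W t x)"
begin

abbreviation "Z \<equiv> {-\<epsilon><..<\<epsilon>} \<times> S"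
abbreviation "\<W> \<equiv> (\<lambda>(t, x). W t x)"

definition "W' t x = D \<W> (t, x) (1, 0)"

lemma open_Z: "open Z"
  by (intro open_Times open_S) simp

lemma diff_\<W>: "z \<in> Z \<Longrightarrow> \<W> differentiable (at z)"
  by (rule smooth_on_differentiable[OF smooth_W open_Z])

lemma diff_D\<W>: "z \<in> Z \<Longrightarrow> (\<lambda>z. D \<W> z v) differentiable (at z)"
  by (rule smooth_on_differentiable[OF smooth_on_D[OF smooth_W] open_Z])

lemma W_space: "(t, x) \<in> Z \<Longrightarrow> (W t has_derivative (\<lambda>h. D \<W> (t, x) (0, h))) (at x)"
  using has_derivative_slice(1)[OF diff_\<W>] by simp

lemma W_time: "(t, x) \<in> Z \<Longrightarrow> ((\<lambda>s. W s x) has_derivative (\<lambda>h. h *\<^sub>R W' t x)) (at t)"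
  using has_derivative_slice(2)[OF diff_\<W>] by (simp add: W'_def)

lemma W'_space: "(t, x) \<in> Z \<Longrightarrow> (W' t has_derivative (\<lambda>h. D (\<lambda>z. D \<W> z (1, 0)) (t, x) (0, h))) (at x)"
  unfolding W'_def[abs_def] by (rule has_derivative_slice(1)[OF diff_D\<W>])

text \<open>The metric does not depend on time and mixed second derivatives of \<open>\<W>\<close>
  commute, so covariant differentiation commutes with the time derivative.\<close>

lemma covd_W_time:
  assumes z: "(t, x) \<in> Z"
  shows "((\<lambda>s. covd G (W s) x u) has_derivative (\<lambda>h. h *\<^sub>R covd G (W' t) x u)) (at t)"
proof -
  have x: "x \<in> S" and t: "t \<in> {-\<epsilon><..<\<epsilon>}" using z by auto
  have "bounded_linear (christoffel G x u)"
    using christoffel_linear2[OF x] by (simp add: linear_conv_bounded_linear)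
  from has_derivative_add[OF has_derivative_slice(2)[OF diff_D\<W>[OF z, of "(0, u)"]]
      bounded_linear.has_derivative[OF this W_time[OF z]]]
  have "((\<lambda>s. D \<W> (s, x) (0, u) + christoffel G x u (W s x)) has_derivative
     (\<lambda>h. h *\<^sub>R D (\<lambda>z. D \<W> z (0, u)) (t, x) (1, 0) + christoffel G x u (h *\<^sub>R W' t x))) (at t)" .
  moreover have "D (\<lambda>z. D \<W> z (0, u)) (t, x) (1, 0) = D (W' t) x u"
    using smooth_on_D_D_symmetric[OF smooth_W open_Z z] D_eqI[OF W'_space[OF z]] by simp
  ultimately have "((\<lambda>s. D \<W> (s, x) (0, u) + christoffel G x u (W s x)) has_derivative
     (\<lambda>h. h *\<^sub>R covd G (W' t) x u)) (at t)"
    by (simp add: covd_def linear_scale[OF christoffel_linear2[OF x]] scaleR_add_right)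
  then show ?thesis
    by (rule has_derivative_transform_within_open[OF _ open_greaterThanLessThan t])
      (use x in \<open>simp add: covd_def D_eqI[OF W_space]\<close>)
qed

lemma dirichlet_W_time:
  assumes z: "(t, x) \<in> Z"
  shows "((\<lambda>s. dirichlet G (W s) (W s) x) has_real_derivative 2 * dirichlet G (W' t) (W t) x) (at t)"
proof -
  have x: "x \<in> S" using z by auto
  let ?P = "\<lambda>s i. covd G (W s) x (axis i 1)" and ?P' = "\<lambda>i. covd G (W' t) x (axis i 1)"
  have "((\<lambda>s. dirichlet G (W s) (W s) x) has_derivative (\<lambda>h. \<Sum>i\<in>UNIV. \<Sum>j\<in>UNIV. matrix_inv (G x) $ i $ j *\<^sub>R
     (bil 0 (?P t i) (?P t j) + bil (G x) (h *\<^sub>R ?P' i) (?P t j) + bil (G x) (?P t i) (h *\<^sub>R ?P' j)))) (at t)"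
    unfolding dirichlet_def metric_trace_def
    by (intro has_derivative_sum has_derivative_scaleR_right has_derivative_bil has_derivative_const
        covd_W_time z)
  moreover have "(\<Sum>i\<in>UNIV. \<Sum>j\<in>UNIV. matrix_inv (G x) $ i $ j *\<^sub>R
     (bil 0 (?P t i) (?P t j) + bil (G x) (h *\<^sub>R ?P' i) (?P t j) + bil (G x) (?P t i) (h *\<^sub>R ?P' j)))
     = 2 * dirichlet G (W' t) (W t) x * h" for h
  proof -
    have "(\<Sum>i\<in>UNIV. \<Sum>j\<in>UNIV. matrix_inv (G x) $ i $ j *\<^sub>R
      (bil 0 (?P t i) (?P t j) + bil (G x) (h *\<^sub>R ?P' i) (?P t j) + bil (G x) (?P t i) (h *\<^sub>R ?P' j)))
      = h * dirichlet G (W' t) (W t) x + h * dirichlet G (W t) (W' t) x"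
      by (simp add: dirichlet_def metric_trace_def sum_distrib_left sum.distrib bil_def[of 0] algebra_simps)
    then show ?thesis by (simp add: dirichlet_commute[OF x, of "W t"])
  qed
  ultimately show ?thesis by (simp add: has_field_derivative_def)
qed

text \<open>Joint continuity in time and space gives a bound on compact products, which supplies the
  dominating function for the energy.\<close>

lemma continuous_on_dirichlet_W:
  "continuous_on Z (\<lambda>z. dirichlet G (W' (fst z)) (W (fst z)) (snd z))"
proof (rule continuous_on_dirichlet_family)
  note sm = smooth_on_continuous[OF smooth_W] smooth_on_continuous[OF smooth_on_D[OF smooth_W]]
    smooth_on_continuous[OF smooth_on_D[OF smooth_on_D[OF smooth_W]]]
  show "continuous_on Z snd" by (intro continuous_intros)
  show "snd ` Z \<subseteq> S" by auto
  show "continuous_on Z (\<lambda>z. W (fst z) (snd z))"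
    using sm(1) by (simp add: case_prod_beta')
  show "continuous_on Z (\<lambda>z. W' (fst z) (snd z))"
    using sm(2) by (simp add: W'_def)
  show "continuous_on Z (\<lambda>z. D (W (fst z)) (snd z) v)" for v
    by (rule continuous_on_eq[OF sm(2)[of "(0, v)"]]) (auto simp: D_eqI[OF W_space])
  show "continuous_on Z (\<lambda>z. D (W' (fst z)) (snd z) v)" for v
    by (rule continuous_on_eq[OF sm(3)[of "(1, 0)" "(0, v)"]]) (auto simp: D_eqI[OF W'_space])
qed

lemma C1_W':
  assumes "t \<in> {-\<epsilon><..<\<epsilon>}"
  shows "C1 S (W' t)"
proof (rule C1I[OF open_S])
  show "(W' t has_derivative (\<lambda>h. D (\<lambda>z. D \<W> z (1, 0)) (t, x) (0, h))) (at x)" if "x \<in> S" for x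
    by (rule W'_space) (use that assms in auto)
  show "continuous_on S (\<lambda>x. D (\<lambda>z. D \<W> z (1, 0)) (t, x) (0, v))" for v
    by (rule continuous_on_compose2[OF smooth_on_continuous[OF smooth_on_D[OF smooth_on_D[OF smooth_W]]]])
      (use assms in \<open>auto intro!: continuous_intros\<close>)
qed

end

lemma (in chart_metric) lie_metric_eq:
  assumes x: "x \<in> S"
  shows "lie_metric G V (\<lambda>_. u) (\<lambda>_. v) x
    = bil (D G x (V x)) u v + bil (G x) (D V x u) v + bil (G x) u (D V x v)"
proof -
  have "((\<lambda>y. bil (G y) u v) has_derivative (\<lambda>h. bil (D G x h) u v + bil (G x) 0 v + bil (G x) u 0)) (at x)"
    by (intro has_derivative_bil G_works x has_derivative_const)
  from D_eqI[OF this] show ?thesis by (simp add: lie_metric_def lie_bracket_def)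
qed

section \<open>From the manifold to its charts\<close>

lemma paracontact_manifold: "paracontact_metric_manifold A n \<phi> \<xi> \<eta> g \<Longrightarrow> metric_manifold A g"
  by (simp add: paracontact_metric_manifold_def metric_manifold_def)

lemma paracontact_smooth:
  assumes "paracontact_metric_manifold A n \<phi> \<xi> \<eta> g" "c \<in> A"
  shows "smooth_on (cdom c) (\<xi> c)" "smooth_on (cdom c) (\<eta> c)" "smooth_on (cdom c) (\<phi> c)"
  using assms unfolding paracontact_metric_manifold_def reeb_field_def vector_field_def
    contact_form_def one_form_def endo_field_def by blast+

lemma paracontact_chart:
  assumes "paracontact_metric_manifold A n \<phi> \<xi> \<eta> g" "c \<in> A" "x \<in> cdom c"
  shows "\<eta> c x \<bullet> \<xi> c x = 1" "ext_d (\<eta> c) (\<xi> c) (\<lambda>_. u) x = 0"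
    "\<eta> c x \<bullet> u = bil (g c x) (\<xi> c x) u"
    "ext_d (\<eta> c) (\<lambda>_. u) (\<lambda>_. v) x = bil (g c x) u (\<phi> c x *v v)"
    "\<phi> c x *v (\<phi> c x *v u) = u - (\<eta> c x \<bullet> u) *\<^sub>R \<xi> c x"
  using assms unfolding paracontact_metric_manifold_def reeb_field_def by blast+

lemma K_paracontact_chart:
  assumes K: "K_paracontact A n \<phi> \<xi> \<eta> g" and c: "c \<in> A"
  shows "chart_K_paracontact (cdom c) (g c) (\<xi> c) (\<eta> c) (\<phi> c)"
proof -
  have P: "paracontact_metric_manifold A n \<phi> \<xi> \<eta> g" using K by (simp add: K_paracontact_def)
  interpret metric_manifold A g by (rule paracontact_manifold[OF P])
  interpret chart_metric "cdom c" "g c" by (rule chart_metric[OF c])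
  have "lie_metric (g c) (\<xi> c) (\<lambda>_. u) (\<lambda>_. v) x = 0" if "x \<in> cdom c" for x u v
    using K c that unfolding K_paracontact_def killing_field_def by blast
  then show ?thesis
    using paracontact_chart[OF P c] paracontact_smooth[OF P c]
    by unfold_locales (auto simp: lie_metric_eq)
qed

lemma paraSasakian_K_paracontact:
  assumes "paraSasakian A n \<phi> \<xi> \<eta> g"
  shows "K_paracontact A n \<phi> \<xi> \<eta> g"
proof -
  have P: "paracontact_metric_manifold A n \<phi> \<xi> \<eta> g"
    and s: "\<And>c x u v. \<lbrakk>c \<in> A; x \<in> cdom c\<rbrakk> \<Longrightarrow> nabla_endo (g c) (\<lambda>_. u) (\<phi> c) (\<lambda>_. v) x
          = - bil (g c x) u v *\<^sub>R \<xi> c x + (\<eta> c x \<bullet> v) *\<^sub>R u"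
    using assms by (auto simp: paraSasakian_def)
  interpret metric_manifold A g by (rule paracontact_manifold[OF P])
  have "lie_metric (g c) (\<xi> c) (\<lambda>_. u) (\<lambda>_. v) x = 0" if c: "c \<in> A" and x: "x \<in> cdom c" for c x u v
  proof -
    interpret chart_metric "cdom c" "g c" by (rule chart_metric[OF c])
    show ?thesis
      unfolding lie_metric_eq[OF x]
      by (rule paraSasakian_killing[OF paracontact_smooth(1,3,2)[OF P c] paracontact_chart(1,3,4,5,2)[OF P c] s[OF c] x])
  qed
  moreover have "vector_field A \<xi>"
    using P unfolding paracontact_metric_manifold_def reeb_field_def by blast
  ultimately show ?thesis using P by (simp add: K_paracontact_def killing_field_def)
qed

text \<open>Inside one chart the integrand is minus the divergence of \<open>Y\<close>, which is
  compactly supported because \<open>U\<close> is.\<close>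

lemma integral_dirichlet_in_chart:
  assumes K: "K_paracontact A n \<phi> \<xi> \<eta> g" and vol: "volume_measure A g \<mu>"
    and m: "metric_manifold A g"
    and U: "C1_field A U" and perp: "\<And>d x. \<lbrakk>d \<in> A; x \<in> cdom d\<rbrakk> \<Longrightarrow> bil (g d x) (U d x) (\<xi> d x) = 0"
    and c: "c \<in> A" and C: "compact C" "C \<subseteq> fst c" "metric_manifold.vanishes_outside A C U"
  shows "(\<integral>p. metric_manifold.dirichlet_at A g U \<xi> p \<partial>\<mu>) = 0"
proof -
  interpret metric_manifold A g by (rule m)
  interpret chart_K_paracontact "cdom c" "g c" "\<xi> c" "\<eta> c" "\<phi> c" by (rule K_paracontact_chart[OF K c])
  have \<xi>: "C1_field A \<xi>"
    using K vector_field_C1 unfolding K_paracontact_def killing_field_def by blast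
  have P: "paracontact_metric_manifold A n \<phi> \<xi> \<eta> g" using K by (simp add: K_paracontact_def)
  define Y where "Y y = sqrt \<bar>det (g c y)\<bar> *\<^sub>R covd (g c) (\<xi> c) y (U c y)" for y
  have Uc: "C1 (cdom c) (U c)" using U c unfolding C1_field_def by blast
  \<comment> \<open>By \<nabla>\<xi> = -\<phi> this is \<open>Y\<close>; its regularity is thus read
    off from smoothness of \<phi>.\<close>
  have "C1 (cdom c) (\<lambda>y. (- sqrt \<bar>det (g c y)\<bar>) *\<^sub>R (\<phi> c y *v U c y))"
  proof -
    have "C1 (cdom c) (\<lambda>y. sqrt \<bar>det (g c y)\<bar> *\<^sub>R (-1 :: real))"
      by (intro C1_scaleR open_S C1_volume_density C1_const)
    then have "C1 (cdom c) (\<lambda>y. - sqrt \<bar>det (g c y)\<bar>)" by (simp del: Ck.simps)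
    from C1_scaleR[OF open_S this C1_matrix_vector_mult[OF open_S smooth_on_C1[OF paracontact_smooth(3)[OF P c]] Uc]]
    show ?thesis .
  qed
  then have Y: "C1 (cdom c) Y"
    by (rule C1_cong[OF open_S]) (simp add: Y_def covd_\<xi>)
  have Y0: "Y x = 0" if "x \<in> cdom c - snd c ` C" for x
  proof -
    have "cinv c x \<in> fst c - C" using that c by (force simp: image_iff)
    then have "U c (snd c (cinv c x)) = 0" using C(3) c unfolding vanishes_outside_def by blast
    then have "U c x = 0" using that c by simp
    then show ?thesis using that linear_0[OF covd_linear[OF _ diff_\<xi>]] by (simp add: Y_def)
  qed
  have cont: "continuous_on (fst c) (snd c)" using homeo[OF c] by (simp add: homeomorphism_def)
  have "compact (snd c ` C)" by (rule compact_continuous_image[OF continuous_on_subset[OF cont C(2)] C(1)])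
  moreover have "snd c ` C \<subseteq> cdom c" using C(2) by (auto simp: cdom_def)
  ultimately have div: "(\<integral>x. indicator (cdom c) x * tr (D Y x) \<partial>lborel) = 0"
    by (intro integral_divergence[OF open_S Y _ _ Y0])
  have "(\<integral>p. dirichlet_at U \<xi> p \<partial>\<mu>)
      = (\<integral>x. indicator (cdom c) x * (sqrt \<bar>det (g c x)\<bar> * dirichlet_at U \<xi> (cinv c x)) \<partial>lborel)"
    by (rule integral_chart[OF vol c])
      (use C in \<open>auto intro!: borel_measurable_continuous_onI continuous_on_dirichlet_at U \<xi> dirichlet_at_vanishes\<close>)
  also have "\<dots> = (\<integral>x. - (indicator (cdom c) x * tr (D Y x)) \<partial>lborel)"
  proof (rule Bochner_Integration.integral_cong)
    fix x
    show "indicator (cdom c) x * (sqrt \<bar>det (g c x)\<bar> * dirichlet_at U \<xi> (cinv c x))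
        = - (indicator (cdom c) x * tr (D Y x))"
    proof (cases "x \<in> cdom c")
      case True
      have "dirichlet_at U \<xi> (cinv c x) = dirichlet (g c) (U c) (\<xi> c) x"
        using dirichlet_at_eq[OF U \<xi> c, of "cinv c x"] c True by simp
      then show ?thesis
        using first_variation_divergence[OF True C1_field_diff[OF U c True] perp[OF c True]] True
        by (simp add: dirichlet_def Y_def[abs_def])
    qed simp
  qed simp
  also have "\<dots> = 0" using div by simp
  finally show ?thesis .
qed

text \<open>The derivative at t = 0 of the energy density is the Dirichlet product of \<xi> with the
  variation field \<open>U\<close>. That field is C^1, compactly supported and orthogonal to \<xi>,
  so the integral vanishes by localisation.\<close>

lemma energy_variation:
  assumes K: "K_paracontact A n \<phi> \<xi> \<eta> g" and vol: "volume_measure A g \<mu>" and Do: "open Do"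
    and \<epsilon>: "\<epsilon> > 0" and var: "length_variation A g 1 Do \<xi> \<epsilon> W"
  shows "((\<lambda>t. energy A g \<mu> Do (W t)) has_real_derivative 0) (at 0)"
proof -
  have P: "paracontact_metric_manifold A n \<phi> \<xi> \<eta> g" using K by (simp add: K_paracontact_def)
  have m: "metric_manifold A g" by (rule paracontact_manifold[OF P])
  interpret metric_manifold A g by (rule m)
  have \<xi>: "C1_field A \<xi>"
    using K vector_field_C1 unfolding K_paracontact_def killing_field_def by blast
  obtain C where C: "compact C" "C \<subseteq> Do"
    and WC: "\<And>t c p. \<lbrakk>\<bar>t\<bar> < \<epsilon>; c \<in> A; p \<in> fst c - C\<rbrakk> \<Longrightarrow> W t c (snd c p) = \<xi> c (snd c p)"
    using var unfolding length_variation_def by blast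
  have field: "vector_field A (W t)" and length: "constant_length A g 1 (W t)" if "\<bar>t\<bar> < \<epsilon>" for t
    using var that unfolding length_variation_def by blast+
  have WF: "C1_field A (W t)" if "\<bar>t\<bar> < \<epsilon>" for t by (rule vector_field_C1[OF field[OF that]])
  have W0: "W 0 c x = \<xi> c x" if "c \<in> A" "x \<in> cdom c" for c x
    using var that unfolding length_variation_def by blast
  have cv: "chart_variation (cdom c) (g c) \<epsilon> (\<lambda>t. W t c)" if c: "c \<in> A" for c
    using var c chart_metric[OF c] unfolding length_variation_def chart_variation_def chart_variation_axioms_def
    by auto
  define W' where "W' t c = chart_variation.W' (\<lambda>t. W t c) t" for t c
  define U where "U = W' 0"
  have time: "((\<lambda>s. W s c x) has_derivative (\<lambda>h. h *\<^sub>R U c x)) (at 0)" if "c \<in> A" "x \<in> cdom c" for c x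
    using chart_variation.W_time[OF cv[OF that(1)], of 0 x] that \<epsilon> by (simp add: U_def W'_def)
  have near: "(0::real) \<in> {-\<epsilon><..<\<epsilon>}" using \<epsilon> by simp
  have U: "C1_field A U"
    unfolding C1_field_def
  proof (intro conjI ballI)
    show "C1 (cdom c) (U c)" if "c \<in> A" for c
      unfolding U_def W'_def by (rule chart_variation.C1_W'[OF cv[OF that] near])
    fix c d x assume c: "c \<in> A" and d: "d \<in> A" and x: "x \<in> overlap c d"
    let ?J = "jacobian (transition c d) (at x)" and ?y = "transition c d x"
    have xc: "x \<in> cdom c" "?y \<in> cdom d" using x by (auto simp: overlap_eq c d transition_def)
    \<comment> \<open>The Jacobian does not depend on time, so differentiating the transformation
      law of \<open>W s\<close> at s = 0 yields that of \<open>U\<close>.\<close>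
    have "((\<lambda>s. ?J *v W s c x) has_derivative (\<lambda>h. ?J *v (h *\<^sub>R U c x))) (at 0)"
      by (intro bounded_linear.has_derivative[OF matrix_vector_mul_bounded_linear] time c xc)
    then have "((\<lambda>s. W s d ?y) has_derivative (\<lambda>h. ?J *v (h *\<^sub>R U c x))) (at 0)"
      by (rule has_derivative_transform_within_open[OF _ open_greaterThanLessThan near])
        (use field c d x in \<open>auto simp: vector_field_def abs_less_iff\<close>)
    from fun_cong[OF has_derivative_unique[OF this time[OF d xc(2)]], of 1] show "U d ?y = ?J *v U c x"
      by simp
  qed
  have UC: "vanishes_outside C U"
    unfolding vanishes_outside_def
  proof (intro ballI)
    fix c p assume c: "c \<in> A" and p: "p \<in> fst c - C"
    have "((\<lambda>s. \<xi> c (snd c p)) has_derivative (\<lambda>h. 0)) (at (0::real))" by simp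
    then have "((\<lambda>s. W s c (snd c p)) has_derivative (\<lambda>h. 0)) (at 0)"
      by (rule has_derivative_transform_within_open[OF _ open_greaterThanLessThan near])
        (use WC[OF _ c p] in \<open>auto simp: abs_less_iff\<close>)
    have "snd c p \<in> cdom c" using p by simp
    from fun_cong[OF has_derivative_unique[OF \<open>((\<lambda>s. W s c (snd c p)) has_derivative (\<lambda>h. 0)) (at 0)\<close> time[OF c this]], of 1]
    show "U c (snd c p) = 0" by simp
  qed
  \<comment> \<open>The variation has constant length; differentiating g(W, W) = 1 at time 0 gives
    orthogonality to \<xi>.\<close>
  have perp: "bil (g c x) (U c x) (\<xi> c x) = 0" if c: "c \<in> A" and x: "x \<in> cdom c" for c x
  proof -
    interpret chart_metric "cdom c" "g c" by (rule chart_metric[OF c])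
    have "((\<lambda>s. bil (g c x) (W s c x) (W s c x)) has_derivative
      (\<lambda>h. bil 0 (W 0 c x) (W 0 c x) + bil (g c x) (h *\<^sub>R U c x) (W 0 c x) + bil (g c x) (W 0 c x) (h *\<^sub>R U c x))) (at 0)"
      by (intro has_derivative_bil has_derivative_const time c x)
    from D_eq_zero[OF open_greaterThanLessThan near _ this, of 1 1]
    have "bil 0 (W 0 c x) (W 0 c x) + bil (g c x) (U c x) (W 0 c x) + bil (g c x) (W 0 c x) (U c x) = 0"
      using length c x by (simp add: constant_length_def abs_less_iff)
    then show ?thesis using g_sym[OF x, of "U c x" "\<xi> c x"] by (simp add: W0 c x bil_def[of 0])
  qed
  define e where "e t p = energy_density A g (W t) p" for t p
  have e_chart: "e t p = (CARD('b) + dirichlet (g c) (W t c) (W t c) (snd c p)) / 2"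
    if "\<bar>t\<bar> < \<epsilon>" "c \<in> A" "p \<in> fst c" for t c p
    unfolding e_def energy_density_dirichlet[OF WF[OF that(1)]]
    by (simp add: dirichlet_at_eq[OF WF WF] that)
  have e_time: "((\<lambda>t. e t p) has_real_derivative dirichlet (g c) (W' t c) (W t c) (snd c p)) (at t)"
    if t: "\<bar>t\<bar> < \<epsilon>" and c: "c \<in> A" "p \<in> fst c" for t c p
  proof -
    have tz: "(t, snd c p) \<in> {-\<epsilon><..<\<epsilon>} \<times> cdom c" using t c by (auto simp: abs_less_iff)
    note DERIV_cdivide[OF DERIV_add[OF DERIV_const chart_variation.dirichlet_W_time[OF cv[OF c(1)] tz]], of "CARD('b)" 2]
    then have "((\<lambda>t. (CARD('b) + dirichlet (g c) (W t c) (W t c) (snd c p)) / 2) has_real_derivative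
       dirichlet (g c) (W' t c) (W t c) (snd c p)) (at t)" by (simp add: W'_def)
    then show ?thesis
      by (rule has_field_derivative_transform_within_open[where S = "{-\<epsilon><..<\<epsilon>}"])
        (use t c in \<open>auto simp: e_chart abs_less_iff\<close>)
  qed
  have e_der: "((\<lambda>t. e t p) has_real_derivative dirichlet_at U \<xi> p) (at 0)" for p
  proof -
    let ?c = "chart_at A p"
    have "dirichlet (g ?c) (U ?c) (W 0 ?c) (snd ?c p) = dirichlet_at U \<xi> p"
      unfolding dirichlet_at_def
      by (rule dirichlet_cong[OF open_cdom[OF chart_at(1)] chart_in[OF chart_at(2)] refl])
        (simp add: W0 chart_at)
    then show ?thesis using e_time[of 0 ?c p] \<epsilon> chart_at[of p] by (simp add: U_def)
  qed
  have e_out: "e t p = e 0 p" if t: "\<bar>t\<bar> < \<epsilon>" and p: "p \<notin> C" for t p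
  proof -
    let ?c = "chart_at A p" and ?T = "{y \<in> cdom (chart_at A p). cinv (chart_at A p) y \<notin> C}"
    have eq: "W t ?c y = W 0 ?c y" if y: "y \<in> ?T" for y
    proof -
      have "W t ?c (snd ?c (cinv ?c y)) = \<xi> ?c (snd ?c (cinv ?c y))"
        by (rule WC[OF t chart_at(1)]) (use y chart_at(1) in auto)
      then show ?thesis using y chart_at(1) by (simp add: W0)
    qed
    have "dirichlet (g ?c) (W t ?c) (W t ?c) (snd ?c p) = dirichlet (g ?c) (W 0 ?c) (W 0 ?c) (snd ?c p)"
      by (rule dirichlet_cong[OF open_complement_in_chart[OF chart_at(1) C(1)] _ eq eq])
        (use p chart_at[of p] in auto)
    then show ?thesis using e_chart[OF t chart_at[of p]] e_chart[OF _ chart_at[of p], of 0] \<epsilon> by simp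
  qed
  have e_meas: "e t \<in> borel_measurable \<mu>" if "\<bar>t\<bar> < \<epsilon>" for t
    unfolding e_def energy_density_dirichlet[OF WF[OF that]]
    by (intro borel_measurable_\<mu>[OF vol] continuous_intros continuous_on_dirichlet_at WF that) simp
  \<comment> \<open>A bound linear in t and uniform on the support: the mean value theorem in t on
    finitely many coordinate balls, where the time derivative is bounded by compactness.\<close>
  obtain B where B: "\<And>t p. \<lbrakk>p \<in> C; \<bar>t\<bar> < \<epsilon> / 2\<rbrakk> \<Longrightarrow> \<bar>e t p - e 0 p\<bar> \<le> \<bar>t\<bar> * B"
  proof -
    obtain Q where Q: "finite Q" "\<And>c x r. (c, x, r) \<in> Q \<Longrightarrow> c \<in> A \<and> r > 0 \<and> cball x r \<subseteq> cdom c"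
      "C \<subseteq> (\<Union>(c, x, r)\<in>Q. chart_ball c x r)" using finite_ball_cover[OF C(1)] by blast
    have "\<exists>b. \<forall>t p. p \<in> (case q of (c, x, r) \<Rightarrow> chart_ball c x r) \<longrightarrow> \<bar>t\<bar> < \<epsilon> / 2 \<longrightarrow>
        \<bar>e t p - e 0 p\<bar> \<le> \<bar>t\<bar> * b" if q: "q \<in> Q" for q
    proof -
      obtain c x r where qe: "q = (c, x, r)" by (cases q)
      have cr: "c \<in> A" "cball x r \<subseteq> cdom c" using Q(2) q qe by auto
      \<comment> \<open>Half the time range: a compact interval inside the open one on which the
        variation is defined.\<close>
      let ?I = "{-(\<epsilon>/2)..\<epsilon>/2}"
      let ?f = "\<lambda>z. dirichlet (g c) (W' (fst z) c) (W (fst z) c) (snd z)"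
      have "continuous_on (?I \<times> cball x r) ?f"
        unfolding W'_def
        by (rule continuous_on_subset[OF chart_variation.continuous_on_dirichlet_W[OF cv[OF cr(1)]]])
          (use \<epsilon> cr in auto)
      from compact_real_bound[OF this compact_Times[OF compact_Icc compact_cball]]
      obtain b where b: "\<forall>z\<in>?I \<times> cball x r. \<bar>?f z\<bar> \<le> b" ..
      have "\<bar>e t p - e 0 p\<bar> \<le> \<bar>t\<bar> * b" if p: "p \<in> chart_ball c x r" and t: "\<bar>t\<bar> < \<epsilon> / 2" for t p
      proof -
        have pc: "p \<in> fst c" "snd c p \<in> cball x r" using p by (auto simp: chart_ball_def)
        have "norm (e t p - e 0 p) \<le> b * norm (t - 0)"
        proof (rule field_differentiable_bound[of ?I "\<lambda>t. e t p" "\<lambda>t. ?f (t, snd c p)"])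
          fix s assume s: "s \<in> ?I"
          then have "\<bar>s\<bar> < \<epsilon>" using \<epsilon> by auto
          from has_field_derivative_at_within[OF e_time[OF this cr(1) pc(1)], of ?I]
          show "((\<lambda>t. e t p) has_field_derivative ?f (s, snd c p)) (at s within ?I)" by (simp only: fst_conv snd_conv)
          show "norm (?f (s, snd c p)) \<le> b" using bspec[OF b SigmaI[OF s pc(2)]] by (simp only: real_norm_def)
        next
          show "t \<in> ?I" "0 \<in> ?I" using t \<epsilon> by auto
        qed simp
        then show ?thesis by (simp add: mult.commute)
      qed
      then show ?thesis by (auto simp: qe)
    qed
    then obtain b where b: "\<And>q t p. \<lbrakk>q \<in> Q; p \<in> (case q of (c, x, r) \<Rightarrow> chart_ball c x r); \<bar>t\<bar> < \<epsilon> / 2\<rbrakk> \<Longrightarrow>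
        \<bar>e t p - e 0 p\<bar> \<le> \<bar>t\<bar> * b q" by metis
    show ?thesis
    proof (rule that[of "\<Sum>q\<in>Q. \<bar>b q\<bar>"])
      fix t p assume p: "p \<in> C" and t: "\<bar>t\<bar> < \<epsilon> / 2"
      obtain q where q: "q \<in> Q" "p \<in> (case q of (c, x, r) \<Rightarrow> chart_ball c x r)"
        using subsetD[OF Q(3) p] unfolding UN_iff by blast
      have "b q \<le> (\<Sum>q\<in>Q. \<bar>b q\<bar>)" using member_le_sum[of q Q "\<lambda>q. \<bar>b q\<bar>"] Q(1) q(1) by fastforce
      then show "\<bar>e t p - e 0 p\<bar> \<le> \<bar>t\<bar> * (\<Sum>q\<in>Q. \<bar>b q\<bar>)"
        using b[OF q t] by (meson abs_ge_zero mult_left_mono order_trans)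
    qed
  qed
  define w where "w = (\<lambda>p. B * indicator C p)"
  have Cs: "C \<in> sets \<mu>" and Ds: "Do \<in> sets \<mu>"
    using C(1) Do by (auto simp: sets_\<mu>[OF vol] compact_imp_closed)
  have w: "integrable \<mu> w"
    unfolding w_def using emeasure_compact[OF vol C(1)] Cs
    by (intro integrable_mult_right integrable_real_indicator) auto
  define e' where "e' t p = indicator Do p *\<^sub>R e t p" for t p
  have meas': "e' t \<in> borel_measurable \<mu>" if "\<bar>t\<bar> < \<epsilon> / 2" for t
  proof -
    have "e t \<in> borel_measurable \<mu>" by (rule e_meas) (use that \<epsilon> in linarith)
    then show ?thesis unfolding e'_def using Ds by (intro borel_measurable_scaleR borel_measurable_indicator)
  qed
  have bound': "\<bar>e' t p - e' 0 p\<bar> \<le> \<bar>t\<bar> * w p" if "\<bar>t\<bar> < \<epsilon> / 2" for t p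
  proof (cases "p \<in> C")
    case True
    then show ?thesis using B[OF True that] C(2) by (auto simp: e'_def w_def)
  next
    case False
    then show ?thesis using e_out[of t p] that by (simp add: e'_def w_def)
  qed
  have der': "((\<lambda>t. e' t p) has_real_derivative indicator Do p *\<^sub>R dirichlet_at U \<xi> p) (at 0)" for p
    unfolding e'_def using DERIV_cmult[OF e_der[of p], of "indicator Do p"] by simp
  have zero: "(\<integral>p. indicator Do p *\<^sub>R dirichlet_at U \<xi> p \<partial>\<mu>) = 0"
  proof -
    have "indicator Do p *\<^sub>R dirichlet_at U \<xi> p = dirichlet_at U \<xi> p" for p
      using dirichlet_at_vanishes[OF C(1) UC, of p \<xi>] C(2) by (cases "p \<in> C") auto
    moreover have "(\<integral>p. dirichlet_at U \<xi> p \<partial>\<mu>) = 0"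
    proof (rule integral_dirichlet_localize[OF vol U \<xi> C(1) UC])
      fix U' c C'
      assume U': "C1_field A U'" "\<And>d x. \<lbrakk>d \<in> A; x \<in> cdom d\<rbrakk> \<Longrightarrow> \<exists>a. U' d x = a *\<^sub>R U d x"
        and c: "c \<in> A" "compact C'" "C' \<subseteq> fst c" "vanishes_outside C' U'"
      have "bil (g d x) (U' d x) (\<xi> d x) = 0" if "d \<in> A" "x \<in> cdom d" for d x
        using U'(2)[OF that] perp[OF that] by auto
      from integral_dirichlet_in_chart[OF K vol m U'(1) this c]
      show "(\<integral>p. dirichlet_at U' \<xi> p \<partial>\<mu>) = 0" .
    qed
    ultimately show ?thesis by (simp only:)
  qed
  have "((\<lambda>t. \<integral>p. e' t p \<partial>\<mu>) has_real_derivative 0) (at 0)"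
  \<comment> \<open>If the energy density of \<xi> is not integrable over \<open>Do\<close>, the
    integrals are 0 by convention for all small t, so the derivative is 0 in this case too.\<close>
  proof (cases "integrable \<mu> (e' 0)")
    case True
    have "((\<lambda>t. \<integral>p. e' t p \<partial>\<mu>) has_real_derivative (\<integral>p. indicator Do p *\<^sub>R dirichlet_at U \<xi> p \<partial>\<mu>)) (at 0)"
      by (rule derivative_under_integral[OF half_gt_zero[OF \<epsilon>] w meas' bound' der' True])
    then show ?thesis unfolding zero .
  next
    case False
    show ?thesis
      by (rule derivative_under_nonexistent_integral[OF half_gt_zero[OF \<epsilon>] w meas' bound' False])
  qed
  then show ?thesis by (simp add: energy_def set_lebesgue_integral_def e'_def e_def)
qed

lemma K_paracontact_harmonic:
  assumes K: "K_paracontact A n \<phi> \<xi> \<eta> g"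
  shows "constant_length A g 1 \<xi>" "harmonic_vector_field A g \<xi>"
proof -
  have P: "paracontact_metric_manifold A n \<phi> \<xi> \<eta> g" using K by (simp add: K_paracontact_def)
  show cl: "constant_length A g 1 \<xi>"
    unfolding constant_length_def using paracontact_chart(1,3)[OF P] by metis
  have "vector_field A \<xi>"
    using K unfolding K_paracontact_def killing_field_def by blast
  then show "harmonic_vector_field A g \<xi>"
    unfolding harmonic_vector_field_def
    using cl energy_variation[OF K] by (intro conjI exI[of _ 1]) auto
qed

theorem theorem4p1:
  fixes A :: "('a::{t2_space,second_countable_topology}, 'm::finite) chart set"
    and n :: nat
    and \<phi> g :: "('a, 'm, real ^ 'm ^ 'm) field"
    and \<xi> \<eta> :: "('a, 'm, real ^ 'm) field"
  shows "(K_paracontact A n \<phi> \<xi> \<eta> g \<longrightarrow>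
            (\<forall>c\<in>A. \<forall>x\<in>cdom c. ricci_op (g c) x (\<xi> c x) = - (2 * real n) *\<^sub>R \<xi> c x) \<and>
            H_paracontact A n \<phi> \<xi> \<eta> g \<and>
            defines_harmonic_map_T1 A g \<xi>) \<and>
         (paraSasakian A n \<phi> \<xi> \<eta> g \<longrightarrow>
            K_paracontact A n \<phi> \<xi> \<eta> g \<and> H_paracontact A n \<phi> \<xi> \<eta> g)"
proof -
  have H: "H_paracontact A n \<phi> \<xi> \<eta> g" if "K_paracontact A n \<phi> \<xi> \<eta> g"
    using that K_paracontact_harmonic(2)[OF that] by (simp add: H_paracontact_def K_paracontact_def)
  have ric: "ricci_op (g c) x (\<xi> c x) = - (2 * real n) *\<^sub>R \<xi> c x"
    and "metric_trace (g c x) (\<lambda>u v. curvature (g c) (nabla (g c) (\<lambda>_. u) (\<xi> c)) (\<xi> c) (\<lambda>_. v) x) = 0"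
    if K: "K_paracontact A n \<phi> \<xi> \<eta> g" and c: "c \<in> A" and x: "x \<in> cdom c" for c x
  proof -
    interpret chart_K_paracontact "cdom c" "g c" "\<xi> c" "\<eta> c" "\<phi> c" by (rule K_paracontact_chart[OF K c])
    have "CARD('m) = 2 * n + 1"
      using K by (simp add: K_paracontact_def paracontact_metric_manifold_def)
    then show "ricci_op (g c) x (\<xi> c x) = - (2 * real n) *\<^sub>R \<xi> c x" by (rule ricci_op_\<xi>[OF x])
    show "metric_trace (g c x) (\<lambda>u v. curvature (g c) (nabla (g c) (\<lambda>_. u) (\<xi> c)) (\<xi> c) (\<lambda>_. v) x) = 0"
      by (rule harmonic_map_trace[OF x])
  qed
  then have "defines_harmonic_map_T1 A g \<xi>" if "K_paracontact A n \<phi> \<xi> \<eta> g"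
    using that K_paracontact_harmonic[OF that] unfolding defines_harmonic_map_T1_def by blast
  with H ric show ?thesis using paraSasakian_K_paracontact by blast
qed

end
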